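(* Let $\mathfrak g$ be a (complex) simple Lie algebra with Killing form $(\cdot,\cdot)$, $\mathfrak h\subset\mathfrak g$ a Cartan subalgebra with inclusion $i:\mathfrak h\to\mathfrak g$, and let $r$ be a classical dynamical $r$-matrix with spectral parameter associated with $\mathfrak h\subset\mathfrak g$. Equip $T^*\mathfrak h^*\times\mathfrak g^*$ with the product of the canonical cotangent symplectic structure and the plus Lie-Poisson structure on $\mathfrak g^*$. Then the map $$L:T^*\mathfrak h^*\times\mathfrak g^*\to L\mathfrak g,\qquad(q,p,\xi)\mapsto p+r_-^\#(q)\xi,$$ (defined for $q$ at which $r$ is defined) satisfies the fundamental Poisson bracket relations $$\{L_1(z),L_2(w)\}=-[r^{12}(q,z-w),L_1(z)]+[r^{21}(q,w-z),L_2(w)]-\mathcal X_{i^*\xi}\,r(q,z-w)$$ $$\qquad\qquad\quad=-[r^{12}(q,z-w),L_1(z)+L_2(w)]-\mathcal X_{i^*\xi}\,r(q,z-w).$$ Moreover, if $f\in C^\infty(L\mathfrak g)$ is ad-invariant, then under the flow $\phi_t$ generated by the Hamiltonian $L^*f=f\circ L$, $$\frac{dL(\phi_t)}{dt}=\big[R_{m(\phi_t)}(df(L(\phi_t))),\,L(\phi_t)\big]+\big(\mathcal X_{i^*(pr_2\phi_t)}R\big)_{m(\phi_t)}\big(df(L(\phi_t))\big),$$ where $m(q,p,\xi)=q$, $pr_2(q,p,\xi)=\xi$, and $R$ is the operator associated with $r$ (see context).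
   Context: The Killing form is used to identify $\mathfrak g^*\cong\mathfrak g$, $\mathfrak h^*\cong\mathfrak h$, with $(a\otimes b,c\otimes d)=(a,c)(b,d)$ and $(a\otimes b,\xi\otimes1)=(a,\xi)b$. $i^*:\mathfrak g^*\to\mathfrak h^*$ is the transpose of $i$. A classical dynamical $r$-matrix with spectral parameter associated with $\mathfrak h\subset\mathfrak g$ is a meromorphic function $r:\mathfrak h^*\times\mathbb C\to\mathfrak g\otimes\mathfrak g$ satisfying: (a) zero weight condition $[h\otimes1+1\otimes h,r(q,z)]=0$ for $h\in\mathfrak h$; (b) generalized unitarity $r^{12}(q,z)+r^{21}(q,-z)=0$; (c) residue condition $\mathrm{Res}_{z=0}r(q,z)=\Omega$, the Casimir element in $(S^2\mathfrak g)^{\mathfrak g}$ of the Killing form; (d) the classical dynamical Yang-Baxter equation $$\mathrm{Alt}(d_{\mathfrak h}r)+[r^{12}(q,z_{1,2}),r^{13}(q,z_{1,3})]+[r^{12}(q,z_{1,2}),r^{23}(q,z_{2,3})]+[r^{13}(q,z_{1,3}),r^{23}(q,z_{2,3})]=0,$$ with $z_{i,j}=z_i-z_j$ and $\mathrm{Alt}(d_{\mathfrak h}r)=\sum_i\big(h_i^{(1)}\partial_ir^{23}(q,z_{2,3})+h_i^{(2)}\partial_ir^{31}(q,z_{3,1})+h_i^{(3)}\partial_ir^{12}(q,z_{1,2})\big)$, where $(h_i)$ is an orthonormal basis of $\mathfrak h$ and $\partial_i$ the derivative along the corresponding coordinate of $q\in\mathfrak h^*\cong\mathfrak h$. $L\mathfrak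 g$ is the Lie algebra of Laurent series $\sum_{n\ge-N}\xi_nz^n$ with coefficients in $\mathfrak g$ converging in some annulus $0<|z|<\epsilon$ (depending on the series). $L\mathfrak g^*$ (restricted dual) is the same with coefficients in $\mathfrak g^*$, paired with $L\mathfrak g$ by $\langle\xi,X\rangle=\frac1{2\pi i}\oint\langle\xi(z),X(z)\rangle dz$ over a small circle around $0$. $\mathfrak h\subset L\mathfrak g$ as constants. The map $r_-^\#(q):\mathfrak g^*\to L\mathfrak g$ is defined by $((r_-^\#(q)\xi)(z),\eta)=(r(q,z),\eta\otimes\xi)$ for all $\xi,\eta\in\mathfrak g^*$. The operator $R:\mathfrak h^*\to\mathcal L(L\mathfrak g^*,L\mathfrak g)$ is $(R_q\xi)(z)=\mathrm{p.v.}\frac1{2\pi i}\oint_C(r(q,w-z),\xi(w)\otimes1)dw$, where $0<|z|<\frac12r_0$ ($r_0>0$ such that $r(q,\cdot)$ has no pole in $|z|<r_0$ other than $0$, and $|z|$ in the annulus of convergence of $\xi$), and $C$ is the positively oriented circle of radius $|z|$ centred at $0$; p.v. is the principal value. For $a\in\mathfrak h^*$, $\mathcal X_a$ is the derivative with respect to $q$ in the constant direction $a$. In $(\mathcal X_aR)_q(\zeta)$ only $R$ is differentiated, with $\zeta\in L\mathfrak g^*$ fixed. Notation: $L_1(z)=L(z)\otimes1$, $L_2(w)=1\otimes L(w)$, and for a basis $(e_a)$ of $\mathfrak g$ with $L(z)=\sum_aL^a(z)e_a$, $\{L_1(z),L_2(w)\}=\sum_{a,b}\{L^a(z),L^b(w)\}\,e_a\otimes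 e_b$, a $\mathfrak g\otimes\mathfrak g$-valued function of the point $(q,p,\xi)$. A function $f$ on $L\mathfrak g$ has its differential $df(X)$ in $L\mathfrak g^*$; ad-invariant means $\langle df(X),[Y,X]\rangle=0$ for all $X,Y\in L\mathfrak g$. Conventions: in coordinates $p_i,q_j$ with respect to an orthonormal basis of $\mathfrak h$, $\{p_i,q_j\}=\delta_{ij}$, $\{p_i,p_j\}=\{q_i,q_j\}=0$; for $x,y\in\mathfrak g$ viewed as linear functions on $\mathfrak g^*$, $\{x,y\}(\xi)=\langle\xi,[x,y]\rangle$; $p,q$ Poisson commute with functions on $\mathfrak g^*$. The flow generated by a Hamiltonian $F$ satisfies $\frac d{dt}K(\phi_t)=\{K,F\}(\phi_t)$. *)

theory Defs
  imports "HOL-Complex_Analysis.Complex_Analysis"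
begin

text \<open>
  A complex Lie algebra of dimension \<open>n\<close> is an arbitrary bracket \<open>br\<close> on \<^typ>\<open>complex^'n\<close>; the
  standard basis vectors \<open>bv a\<close> are the basis \<open>(e\<^sub>a)\<close>. Its dual is also written \<^typ>\<open>complex^'n\<close>,
  in the dual basis, so that the evaluation pairing is \<open>pair\<close> (bilinear, not Hermitian).
\<close>

abbreviation bv :: "'n::finite \<Rightarrow> complex^'n" where
  "bv a \<equiv> axis a 1"

definition pair :: "complex^'n \<Rightarrow> complex^'n \<Rightarrow> complex" where
  "pair \<xi> x = (\<Sum>a\<in>UNIV. \<xi> $ a * x $ a)"

definition lie_algebra :: "(complex^'n \<Rightarrow> complex^'n \<Rightarrow> complex^'n) \<Rightarrow> bool" where
  "lie_algebra br \<longleftrightarrow>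
     (\<forall>x y z. br (x + y) z = br x z + br y z) \<and>
     (\<forall>x y z. br x (y + z) = br x y + br x z) \<and>
     (\<forall>c x y. br (c *s x) y = c *s br x y) \<and>
     (\<forall>c x y. br x (c *s y) = c *s br x y) \<and>
     (\<forall>x. br x x = 0) \<and>
     (\<forall>x y z. br x (br y z) + br y (br z x) + br z (br x y) = 0)"

definition lie_ideal :: "(complex^'n \<Rightarrow> complex^'n \<Rightarrow> complex^'n) \<Rightarrow> (complex^'n) set \<Rightarrow> bool" where
  "lie_ideal br I \<longleftrightarrow> vec.subspace I \<and> (\<forall>x. \<forall>y\<in>I. br x y \<in> I)"

definition simple_lie_algebra :: "(complex^'n \<Rightarrow> complex^'n \<Rightarrow> complex^'n) \<Rightarrow> bool" where
  "simple_lie_algebra br \<longleftrightarrow> lie_algebra br \<and> (\<exists>x y. br x y \<noteq> 0) \<and>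
     (\<forall>I. lie_ideal br I \<longrightarrow> I = {0} \<or> I = UNIV)"

definition killing :: "(complex^'n \<Rightarrow> complex^'n \<Rightarrow> complex^'n) \<Rightarrow> complex^'n \<Rightarrow> complex^'n \<Rightarrow> complex" where
  "killing br x y = trace (matrix (\<lambda>z. br x (br y z)))"

fun lower_central :: "(complex^'n \<Rightarrow> complex^'n \<Rightarrow> complex^'n) \<Rightarrow> (complex^'n) set \<Rightarrow> nat \<Rightarrow> (complex^'n) set" where
  "lower_central br H 0 = H"
| "lower_central br H (Suc k) = vec.span {br x y |x y. x \<in> H \<and> y \<in> lower_central br H k}"

definition cartan_subalgebra :: "(complex^'n \<Rightarrow> complex^'n \<Rightarrow> complex^'n) \<Rightarrow> (complex^'n) set \<Rightarrow> bool" where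
  "cartan_subalgebra br H \<longleftrightarrow>
     vec.subspace H \<and> (\<forall>x\<in>H. \<forall>y\<in>H. br x y \<in> H) \<and>
     (\<exists>k. lower_central br H k = {0}) \<and>
     (\<forall>x. (\<forall>y\<in>H. br x y \<in> H) \<longrightarrow> x \<in> H)"

definition orthonormal_basis ::
    "(complex^'n \<Rightarrow> complex^'n \<Rightarrow> complex^'n) \<Rightarrow> (complex^'n) set \<Rightarrow> ('l::finite \<Rightarrow> complex^'n) \<Rightarrow> bool" where
  "orthonormal_basis br H h \<longleftrightarrow>
     (\<forall>i j. killing br (h i) (h j) = (if i = j then 1 else 0)) \<and> vec.span (range h) = H"

text \<open>
  \<open>t $ a $ b\<close> is the coefficient of \<open>e\<^sub>a \<otimes> e\<^sub>b\<close>, and \<open>t $ a $ b $ c\<close> that of \<open>e\<^sub>a \<otimes> e\<^sub>b \<otimes> e\<^sub>c\<close>.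
  The flip \<open>t\<^sup>2\<^sup>1\<close> is \<^term>\<open>transpose t\<close>.
\<close>

definition tensor2 :: "complex^'n \<Rightarrow> complex^'n \<Rightarrow> complex^'n^'n" where
  "tensor2 x y = (\<chi> a b. x $ a * y $ b)"

definition tensor3 :: "complex^'n \<Rightarrow> complex^'n \<Rightarrow> complex^'n \<Rightarrow> complex^'n^'n^'n" where
  "tensor3 x y z = (\<chi> a b c. x $ a * y $ b * z $ c)"

text \<open>\<open>comm1 br t x = [t, x \<otimes> 1]\<close> and \<open>comm2 br t x = [t, 1 \<otimes> x]\<close>.\<close>

definition comm1 :: "(complex^'n \<Rightarrow> complex^'n \<Rightarrow> complex^'n) \<Rightarrow> complex^'n^'n \<Rightarrow> complex^'n \<Rightarrow> complex^'n^'n" where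
  "comm1 br t x = (\<Sum>a\<in>UNIV. \<Sum>b\<in>UNIV. tensor2 (t $ a $ b *s br (bv a) x) (bv b))"

definition comm2 :: "(complex^'n \<Rightarrow> complex^'n \<Rightarrow> complex^'n) \<Rightarrow> complex^'n^'n \<Rightarrow> complex^'n \<Rightarrow> complex^'n^'n" where
  "comm2 br t x = (\<Sum>a\<in>UNIV. \<Sum>b\<in>UNIV. tensor2 (t $ a $ b *s bv a) (br (bv b) x))"

text \<open>
  The three commutators \<open>[s\<^sup>1\<^sup>2, t\<^sup>1\<^sup>3]\<close>, \<open>[s\<^sup>1\<^sup>2, t\<^sup>2\<^sup>3]\<close>, \<open>[s\<^sup>1\<^sup>3, t\<^sup>2\<^sup>3]\<close>, taken in the third tensor
  power of the enveloping algebra; they lie in the third tensor power of the Lie algebra.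
\<close>

definition comm_12_13 :: "(complex^'n \<Rightarrow> complex^'n \<Rightarrow> complex^'n) \<Rightarrow> complex^'n^'n \<Rightarrow> complex^'n^'n \<Rightarrow> complex^'n^'n^'n" where
  "comm_12_13 br s t = (\<Sum>a\<in>UNIV. \<Sum>b\<in>UNIV. \<Sum>c\<in>UNIV. \<Sum>d\<in>UNIV.
     tensor3 ((s $ a $ b * t $ c $ d) *s br (bv a) (bv c)) (bv b) (bv d))"

definition comm_12_23 :: "(complex^'n \<Rightarrow> complex^'n \<Rightarrow> complex^'n) \<Rightarrow> complex^'n^'n \<Rightarrow> complex^'n^'n \<Rightarrow> complex^'n^'n^'n" where
  "comm_12_23 br s t = (\<Sum>a\<in>UNIV. \<Sum>b\<in>UNIV. \<Sum>c\<in>UNIV. \<Sum>d\<in>UNIV.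
     tensor3 ((s $ a $ b * t $ c $ d) *s bv a) (br (bv b) (bv c)) (bv d))"

definition comm_13_23 :: "(complex^'n \<Rightarrow> complex^'n \<Rightarrow> complex^'n) \<Rightarrow> complex^'n^'n \<Rightarrow> complex^'n^'n \<Rightarrow> complex^'n^'n^'n" where
  "comm_13_23 br s t = (\<Sum>a\<in>UNIV. \<Sum>b\<in>UNIV. \<Sum>c\<in>UNIV. \<Sum>d\<in>UNIV.
     tensor3 ((s $ a $ b * t $ c $ d) *s bv a) (bv c) (br (bv b) (bv d)))"

text \<open>\<open>x\<^sup>(\<^sup>1\<^sup>) t\<^sup>2\<^sup>3\<close>, \<open>x\<^sup>(\<^sup>2\<^sup>) t\<^sup>3\<^sup>1\<close> and \<open>x\<^sup>(\<^sup>3\<^sup>) t\<^sup>1\<^sup>2\<close>; in \<open>t\<^sup>3\<^sup>1\<close> the first leg of \<open>t\<close> sits in the third factor.\<close>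

definition put_1_23 :: "complex^'n \<Rightarrow> complex^'n^'n \<Rightarrow> complex^'n^'n^'n" where
  "put_1_23 x t = (\<Sum>a\<in>UNIV. \<Sum>b\<in>UNIV. tensor3 x (t $ a $ b *s bv a) (bv b))"

definition put_2_31 :: "complex^'n \<Rightarrow> complex^'n^'n \<Rightarrow> complex^'n^'n^'n" where
  "put_2_31 x t = (\<Sum>a\<in>UNIV. \<Sum>b\<in>UNIV. tensor3 (t $ a $ b *s bv b) x (bv a))"

definition put_3_12 :: "complex^'n \<Rightarrow> complex^'n^'n \<Rightarrow> complex^'n^'n^'n" where
  "put_3_12 x t = (\<Sum>a\<in>UNIV. \<Sum>b\<in>UNIV. tensor3 (t $ a $ b *s bv a) (bv b) x)"

text \<open>
  \<open>\<Omega> = \<Sum>\<^sub>a e\<^sub>a \<otimes> e\<^sup>a\<close>, where \<open>(e\<^sup>a)\<close> is the basis dual to \<open>(e\<^sub>a)\<close> for the Killing form; such a basis is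
  unique, and it exists because the Killing form of a simple Lie algebra is nondegenerate.
\<close>

definition is_casimir :: "(complex^'n \<Rightarrow> complex^'n \<Rightarrow> complex^'n) \<Rightarrow> complex^'n^'n \<Rightarrow> bool" where
  "is_casimir br \<Omega> \<longleftrightarrow>
     (\<exists>e'. (\<forall>a b. killing br (bv a) (e' b) = (if a = b then 1 else 0)) \<and>
           \<Omega> = (\<Sum>a\<in>UNIV. tensor2 (bv a) (e' a)))"

text \<open>
  \<open>sc\<close> is multiplication by complex scalars on the source: a function is holomorphic on an open
  set if it is differentiable at each point with a complex-linear derivative.
\<close>

definition holo_on :: "(complex \<Rightarrow> 'a \<Rightarrow> 'a) \<Rightarrow> ('a::real_normed_vector \<Rightarrow> complex) \<Rightarrow> 'a set \<Rightarrow> bool" where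
  "holo_on sc f S \<longleftrightarrow> open S \<and>
     (\<forall>x\<in>S. \<exists>D. (f has_derivative D) (at x) \<and> (\<forall>c v. D (sc c v) = c * D v))"

definition sc_qz :: "complex \<Rightarrow> (complex^'l) \<times> complex \<Rightarrow> (complex^'l) \<times> complex" where
  "sc_qz c = (\<lambda>(q, z). (c *s q, c * z))"

definition sc_sz :: "complex \<Rightarrow> complex \<times> complex \<Rightarrow> complex \<times> complex" where
  "sc_sz c = (\<lambda>(s, z). (c * s, c * z))"

text \<open>
  Via the Killing form and the orthonormal basis \<open>h\<close>, the coordinate vector \<open>q :: complex^'l\<close> stands
  for the element of the dual of the Cartan subalgebra corresponding to \<open>\<Sum>\<^sub>i q\<^sub>i h\<^sub>i\<close>.
\<close>

type_synonym ('l, 'n) rmat = "complex^'l \<Rightarrow> complex \<Rightarrow> complex^'n^'n"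

text \<open>
  Locally \<open>r = F / G\<close> with \<open>F\<close>, \<open>G\<close> holomorphic and \<open>G\<close> not identically zero on any nonempty open set.
  Where \<open>G\<close> vanishes the value of the (total) function \<open>r\<close> is immaterial; only the points near
  which \<open>r\<close> is holomorphic, \<open>regular_points r\<close>, are points of definition.
\<close>

definition meromorphic_r :: "('l::finite, 'n::finite) rmat \<Rightarrow> bool" where
  "meromorphic_r r \<longleftrightarrow>
     (\<forall>x. \<exists>V F G. x \<in> V \<and> holo_on sc_qz G V \<and> V \<subseteq> closure {y \<in> V. G y \<noteq> 0} \<and>
        (\<forall>a b. holo_on sc_qz (\<lambda>y. F y $ a $ b) V \<and>
               (\<forall>y\<in>V. G y \<noteq> 0 \<longrightarrow> r (fst y) (snd y) $ a $ b = F y $ a $ b / G y)))"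

definition regular_points :: "('l::finite, 'n::finite) rmat \<Rightarrow> ((complex^'l) \<times> complex) set" where
  "regular_points r =
     \<Union>{V. \<forall>a b. holo_on sc_qz (\<lambda>y. r (fst y) (snd y) $ a $ b) V}"

text \<open>
  The open set of those \<open>q\<close> at which \<open>r\<close> is defined: near \<open>q\<close>, the functions \<open>r(q', -)\<close> have no pole in
  a common punctured disc around \<open>0\<close>.
\<close>

definition q_domain :: "('l::finite, 'n::finite) rmat \<Rightarrow> (complex^'l) set" where
  "q_domain r = {q. \<exists>N \<epsilon>. open N \<and> q \<in> N \<and> \<epsilon> > 0 \<and>
     N \<times> (ball 0 \<epsilon> - {0}) \<subseteq> regular_points r}"

definition dir_deriv :: "complex^'l \<Rightarrow> ('l::finite, 'n::finite) rmat \<Rightarrow> ('l, 'n) rmat" where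
  "dir_deriv a r q z = (\<chi> b c. deriv (\<lambda>s. r (q + s *s a) z $ b $ c) 0)"

definition alt_dr :: "('l \<Rightarrow> complex^'n) \<Rightarrow> ('l::finite, 'n::finite) rmat \<Rightarrow> complex^'l \<Rightarrow>
    complex \<Rightarrow> complex \<Rightarrow> complex \<Rightarrow> complex^'n^'n^'n" where
  "alt_dr h r q z1 z2 z3 = (\<Sum>i\<in>UNIV.
       put_1_23 (h i) (dir_deriv (bv i) r q (z2 - z3))
     + put_2_31 (h i) (dir_deriv (bv i) r q (z3 - z1))
     + put_3_12 (h i) (dir_deriv (bv i) r q (z1 - z2)))"

definition dynamical_r_matrix :: "(complex^'n \<Rightarrow> complex^'n \<Rightarrow> complex^'n) \<Rightarrow> (complex^'n) set \<Rightarrow>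
    ('l \<Rightarrow> complex^'n) \<Rightarrow> ('l::finite, 'n::finite) rmat \<Rightarrow> bool" where
  "dynamical_r_matrix br H h r \<longleftrightarrow>
     meromorphic_r r \<and>
     (\<forall>x\<in>H. \<forall>(q, z)\<in>regular_points r. comm1 br (r q z) x + comm2 br (r q z) x = 0) \<and>
     (\<forall>q z. (q, z) \<in> regular_points r \<longrightarrow> (q, - z) \<in> regular_points r \<longrightarrow>
        r q z + transpose (r q (- z)) = 0) \<and>
     (\<forall>q\<in>q_domain r. is_casimir br (\<chi> a b. residue (\<lambda>z. r q z $ a $ b) 0)) \<and>
     (\<forall>q z1 z2 z3.
        (q, z1 - z2) \<in> regular_points r \<longrightarrow> (q, z1 - z3) \<in> regular_points r \<longrightarrow>
        (q, z2 - z3) \<in> regular_points r \<longrightarrow> (q, z3 - z1) \<in> regular_points r \<longrightarrow>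
        alt_dr h r q z1 z2 z3
          + comm_12_13 br (r q (z1 - z2)) (r q (z1 - z3))
          + comm_12_23 br (r q (z1 - z2)) (r q (z2 - z3))
          + comm_13_23 br (r q (z1 - z3)) (r q (z2 - z3)) = 0)"

text \<open>
  Laurent series with finite principal part, convergent in some punctured disc around \<open>0\<close>. The
  restricted dual is the same set of vectors, read with coefficients in the dual basis.
\<close>

type_synonym 'n loop = "complex fls ^ 'n"

definition loop_space :: "'n::finite loop set" where
  "loop_space = {X. \<forall>a. fls_conv_radius (X $ a) > 0}"

definition loop_eval :: "'n::finite loop \<Rightarrow> complex \<Rightarrow> complex^'n" where
  "loop_eval X z = (\<chi> a. eval_fls (X $ a) z)"

definition loop_bracket :: "(complex^'n \<Rightarrow> complex^'n \<Rightarrow> complex^'n) \<Rightarrow> 'n::finite loop \<Rightarrow> 'n loop \<Rightarrow> 'n loop" where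
  "loop_bracket br X Y =
     (\<chi> c. \<Sum>a\<in>UNIV. \<Sum>b\<in>UNIV. fls_const (br (bv a) (bv b) $ c) * X $ a * Y $ b)"

text \<open>
  \<^const>\<open>residue\<close> is by definition the value of \<open>1/(2\<pi>i)\<close> times the integral over small circles.
\<close>

definition loop_pairing :: "'n::finite loop \<Rightarrow> 'n loop \<Rightarrow> complex" where
  "loop_pairing \<xi> X = residue (\<lambda>z. pair (loop_eval \<xi> z) (loop_eval X z)) 0"

text \<open>
  No bound on the order of the pole at \<open>z = 0\<close> is required: since each \<open>c s\<close> has finite principal
  part, the order is automatically bounded near each parameter, by Baire's theorem.
\<close>

definition holo_curve :: "(complex \<Rightarrow> 'n::finite loop) \<Rightarrow> complex set \<Rightarrow> bool" where
  "holo_curve c S \<longleftrightarrow> open S \<and>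
     (\<forall>s\<in>S. c s \<in> loop_space \<and>
        (\<exists>\<delta>>0. \<exists>\<epsilon>>0. ball s \<delta> \<subseteq> S \<and>
           (\<forall>a. holo_on sc_sz (\<lambda>(s', z). loop_eval (c s') z $ a) (ball s \<delta> \<times> (ball 0 \<epsilon> - {0})))))"

definition curve_deriv :: "(complex \<Rightarrow> 'n::finite loop) \<Rightarrow> complex \<Rightarrow> 'n loop \<Rightarrow> bool" where
  "curve_deriv c s Y \<longleftrightarrow> Y \<in> loop_space \<and>
     (\<forall>a. \<forall>\<^sub>F z in at 0.
        ((\<lambda>s'. loop_eval (c s') z $ a) has_field_derivative loop_eval Y z $ a) (at s))"

text \<open>
  A smooth function \<open>f\<close> on the loop algebra with differential \<open>df\<close> in the restricted dual. As the
  differential is complex-linear, \<open>f\<close> is holomorphic; smoothness is tested on holomorphic curves,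
  along which \<open>f\<close> is holomorphic (hence has derivatives of all orders) and obeys the chain rule.
\<close>

definition smooth_with_differential :: "('n::finite loop \<Rightarrow> complex) \<Rightarrow> ('n loop \<Rightarrow> 'n loop) \<Rightarrow> bool" where
  "smooth_with_differential f df \<longleftrightarrow>
     (\<forall>X\<in>loop_space. df X \<in> loop_space) \<and>
     (\<forall>c S s Y. holo_curve c S \<longrightarrow> s \<in> S \<longrightarrow> curve_deriv c s Y \<longrightarrow>
        ((\<lambda>s'. f (c s')) has_field_derivative loop_pairing (df (c s)) Y) (at s))"

definition ad_invariant :: "(complex^'n \<Rightarrow> complex^'n \<Rightarrow> complex^'n) \<Rightarrow> ('n::finite loop \<Rightarrow> 'n loop) \<Rightarrow> bool" where
  "ad_invariant br df \<longleftrightarrow>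
     (\<forall>X\<in>loop_space. \<forall>Y\<in>loop_space. loop_pairing (df X) (loop_bracket br Y X) = 0)"

text \<open>Points are triples \<open>(q, p, \<xi>)\<close>, with \<open>q\<close>, \<open>p\<close> in coordinates with respect to \<open>h\<close>.\<close>

type_synonym ('l, 'n) phase = "(complex^'l) \<times> (complex^'l) \<times> (complex^'n)"

definition sc_phase :: "complex \<Rightarrow> ('l::finite, 'n::finite) phase \<Rightarrow> ('l, 'n) phase" where
  "sc_phase c = (\<lambda>(q, p, \<xi>). (c *s q, c *s p, c *s \<xi>))"

definition grad_q :: "(('l::finite, 'n::finite) phase \<Rightarrow> complex) \<Rightarrow> ('l, 'n) phase \<Rightarrow> complex^'l" where
  "grad_q F = (\<lambda>(q, p, \<xi>). \<chi> i. deriv (\<lambda>s. F (q + s *s bv i, p, \<xi>)) 0)"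

definition grad_p :: "(('l::finite, 'n::finite) phase \<Rightarrow> complex) \<Rightarrow> ('l, 'n) phase \<Rightarrow> complex^'l" where
  "grad_p F = (\<lambda>(q, p, \<xi>). \<chi> i. deriv (\<lambda>s. F (q, p + s *s bv i, \<xi>)) 0)"

definition grad_xi :: "(('l::finite, 'n::finite) phase \<Rightarrow> complex) \<Rightarrow> ('l, 'n) phase \<Rightarrow> complex^'n" where
  "grad_xi F = (\<lambda>(q, p, \<xi>). \<chi> a. deriv (\<lambda>s. F (q, p, \<xi> + s *s bv a)) 0)"

text \<open>\<open>{p\<^sub>i, q\<^sub>j} = \<delta>\<^sub>i\<^sub>j\<close>, and \<open>{x, y}(\<xi>) = \<langle>\<xi>, [x, y]\<rangle>\<close> for linear functions \<open>x\<close>, \<open>y\<close> of \<open>\<xi>\<close>.\<close>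

definition poisson :: "(complex^'n \<Rightarrow> complex^'n \<Rightarrow> complex^'n) \<Rightarrow>
    (('l, 'n) phase \<Rightarrow> complex) \<Rightarrow> (('l::finite, 'n::finite) phase \<Rightarrow> complex) \<Rightarrow> ('l, 'n) phase \<Rightarrow> complex" where
  "poisson br F K x =
     (\<Sum>i\<in>UNIV. grad_p F x $ i * grad_q K x $ i - grad_q F x $ i * grad_p K x $ i)
     + pair (snd (snd x)) (br (grad_xi F x) (grad_xi K x))"

text \<open>
  The transpose of the inclusion of the Cartan subalgebra, in coordinates: the functional
  \<open>i\<^sup>* \<xi>\<close> corresponds to \<open>\<Sum>\<^sub>i \<langle>\<xi>, h\<^sub>i\<rangle> h\<^sub>i\<close>.
\<close>

definition istar :: "('l::finite \<Rightarrow> complex^'n) \<Rightarrow> complex^'n \<Rightarrow> complex^'l" where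
  "istar h \<xi> = (\<chi> i. pair \<xi> (h i))"

text \<open>
  Time is real. The test functions \<open>K\<close> need only be defined near the point in question, as
  \<open>r(-, z)\<close> with \<open>z\<close> fixed is in general not holomorphic on all of \<open>M\<close>.
\<close>

definition hamiltonian_curve :: "(complex^'n \<Rightarrow> complex^'n \<Rightarrow> complex^'n) \<Rightarrow>
    ('l::finite, 'n::finite) phase set \<Rightarrow> (('l, 'n) phase \<Rightarrow> complex) \<Rightarrow>
    (real \<Rightarrow> ('l, 'n) phase) \<Rightarrow> real set \<Rightarrow> bool" where
  "hamiltonian_curve br M F \<phi> T \<longleftrightarrow> open T \<and> \<phi> ` T \<subseteq> M \<and>
     (\<forall>t\<in>T. \<forall>W K. W \<subseteq> M \<longrightarrow> \<phi> t \<in> W \<longrightarrow> holo_on sc_phase K W \<longrightarrow>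
        ((\<lambda>t'. K (\<phi> t')) has_vector_derivative poisson br K F (\<phi> t)) (at t))"

text \<open>
  \<open>r\<^sub>-\<^sup>#(q) \<xi>\<close> at \<open>z\<close> is determined by its pairing \<open>\<Sum>\<^sub>a\<^sub>b r\<^sub>a\<^sub>b \<eta>\<^sub>a \<xi>\<^sub>b\<close> with \<open>\<eta>\<close>,
  so it is the matrix-vector product below.
\<close>

definition rminus :: "('l, 'n::finite) rmat \<Rightarrow> complex^'l \<Rightarrow> complex^'n \<Rightarrow> complex \<Rightarrow> complex^'n" where
  "rminus r q \<xi> z = r q z *v \<xi>"

lemma rminus_pair: "pair \<eta> (rminus r q \<xi> z) = (\<Sum>a\<in>UNIV. \<Sum>b\<in>UNIV. r q z $ a $ b * (\<eta> $ a * \<xi> $ b))"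
  by (simp add: pair_def rminus_def matrix_vector_mult_def sum_distrib_left mult_ac)

definition L_at :: "('l \<Rightarrow> complex^'n) \<Rightarrow> ('l::finite, 'n::finite) rmat \<Rightarrow> ('l, 'n) phase \<Rightarrow> complex \<Rightarrow> complex^'n" where
  "L_at h r = (\<lambda>(q, p, \<xi>) z. (\<Sum>i\<in>UNIV. p $ i *s h i) + rminus r q \<xi> z)"

definition L_map :: "('l \<Rightarrow> complex^'n) \<Rightarrow> ('l::finite, 'n::finite) rmat \<Rightarrow> ('l, 'n) phase \<Rightarrow> 'n loop" where
  "L_map h r x = (\<chi> a. laurent_expansion (\<lambda>z. L_at h r x z $ a) 0)"

text \<open>
  Cauchy principal value of a contour integral over the circle through \<open>z\<close> centred at \<open>0\<close>, with the
  singularity at \<open>z\<close>: the arc \<open>|arg (w / z)| < \<delta>\<close>, which is the part of the circle in a small disc around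
  \<open>z\<close>, is removed.
\<close>

definition pv_circle :: "(complex \<Rightarrow> complex) \<Rightarrow> complex \<Rightarrow> complex" where
  "pv_circle g z = Lim (at_right 0)
     (\<lambda>\<delta>. contour_integral (part_circlepath 0 (norm z) (Arg z + \<delta>) (Arg z + 2 * pi - \<delta>)) g)"

text \<open>Here \<open>\<zeta> v* t\<close> is the contraction \<open>(t, \<zeta> \<otimes> 1) = \<Sum>\<^sub>a\<^sub>b t\<^sub>a\<^sub>b \<zeta>\<^sub>a e\<^sub>b\<close> of the first leg.\<close>

definition R_op :: "('l::finite, 'n::finite) rmat \<Rightarrow> complex^'l \<Rightarrow> 'n loop \<Rightarrow> complex \<Rightarrow> complex^'n" where
  "R_op r q \<zeta> z =
     (\<chi> b. 1 / (2 * pi * \<i>) * pv_circle (\<lambda>w. (loop_eval \<zeta> w v* r q (w - z)) $ b) z)"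

definition dir_deriv_R :: "complex^'l \<Rightarrow> ('l::finite, 'n::finite) rmat \<Rightarrow> complex^'l \<Rightarrow> 'n loop \<Rightarrow> complex \<Rightarrow> complex^'n" where
  "dir_deriv_R a r q \<zeta> z = (\<chi> b. deriv (\<lambda>s. R_op r (q + s *s a) \<zeta> z $ b) 0)"

end

theory Submission
  imports Defs
begin

no_notation fps_nth (infixl "$" 75)

text \<open>
  Contracting the third leg of the dynamical Yang-Baxter equation with \<open>\<xi>\<close> gives the bracket relations.
  For the Lax equation, \<open>df\<close> is paired with these relations by a residue at \<open>w = 0\<close>: ad-invariance kills the
  term with \<open>L(w)\<close>, and what remains is \<open>[\<rho>, L]\<close> plus the derivative of \<open>\<rho>\<close> along
  \<open>i\<^sup>* \<xi>\<close>, where \<open>\<rho>\<close> is the part of \<open>R\<^sub>q(df)\<close> coming from the pole at \<open>0\<close>. The principal value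
  contributes in addition half of the residue at \<open>w = z\<close>, namely \<open>\<Omega>\<close> contracted with \<open>df\<close>; it does not depend on \<open>q\<close>, and it commutes with \<open>L(z)\<close> by ad-invariance.
  That the principal value exists requires \<open>r\<close> to have a simple pole at \<open>z = 0\<close>, which is not assumed but follows
  from the Yang-Baxter equation and the simplicity of the Lie algebra.
\<close>

section \<open>Functions holomorphic along complex lines\<close>

text \<open>Joint meromorphy gives only local quotients F/G in all variables, and G may vanish
  identically on the slice through the given q. So it is not immediate that \<open>r q\<close> has a
  Laurent expansion at 0, although the loop L(q, p, \<xi>) and every residue need one. Derivatives
  of G transversal to the slice supply a denominator; for them a class of functions is used that is
  closed under directional derivatives by Cauchy's formula alone. Simplicity bounds the pole as
  follows: a leading coefficient of order at least two would be an invariant tensor with commuting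
  rows, and an ideal with zero bracket in a simple algebra is 0. Ad-invariance speaks of residues
  only, while the half residue has to commute with L at a single point z. Testing with the loops w^n
  y recovers every Laurent coefficient, hence a pointwise identity. The principal value is also
  differentiated in q, so its reduction to residues must hold for all q' near q on one common disc.
  A compactness argument provides that disc.\<close>

definition ddir :: "(complex^'l) \<times> complex \<Rightarrow> ((complex^'l) \<times> complex \<Rightarrow> complex) \<Rightarrow> (complex^'l) \<times> complex \<Rightarrow> complex" where
  "ddir v f x = deriv (\<lambda>s. f (x + sc_qz s v)) 0"

text \<open>By Osgood's lemma this is ordinary holomorphy. The form by lines passes to
  \<open>ddir v f\<close> by differentiating a Cauchy integral, with no need to construct the total
  derivative of a derivative.\<close>

definition line_holo_on :: "((complex^'l) \<times> complex \<Rightarrow> complex) \<Rightarrow> ((complex^'l) \<times> complex) set \<Rightarrow> bool" where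
  "line_holo_on f S \<longleftrightarrow> open S \<and> continuous_on S f \<and>
     (\<forall>x\<in>S. \<forall>v. (\<lambda>s. f (x + sc_qz s v)) field_differentiable (at 0))"

lemma sc_qz_simps [simp]: "fst (sc_qz c x) = c *s fst x" "snd (sc_qz c x) = c * snd x"
  by (simp_all add: sc_qz_def split_beta)

lemma sc_qz_0 [simp]: "sc_qz 0 v = 0"
  by (simp add: prod_eq_iff)

lemma sc_qz_add: "sc_qz (s + t) v = sc_qz s v + sc_qz t v"
  by (simp add: prod_eq_iff vec.scale_left_distrib ring_distribs)

lemma continuous_on_vmult [continuous_intros]:
  fixes g :: "'a::topological_space \<Rightarrow> complex^'l"
  assumes "continuous_on A f" "continuous_on A g"
  shows "continuous_on A (\<lambda>y. f y *s g y)"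
  unfolding vector_scalar_mult_def by (intro continuous_intros assms continuous_on_component)

lemma continuous_on_sc_qz [continuous_intros]:
  assumes "continuous_on A f" "continuous_on A g"
  shows "continuous_on A (\<lambda>y. sc_qz (f y) (g y))"
  unfolding sc_qz_def split_beta by (intro continuous_intros assms)

lemma norm_vmult: "norm (c *s (v :: complex^'l)) = norm c * norm v"
  by (simp add: norm_vec_def norm_mult L2_set_right_distrib)

lemma line_holo_on_has_derivative:
  assumes "line_holo_on f S" "x + sc_qz s v \<in> S"
  shows "((\<lambda>s. f (x + sc_qz s v)) has_field_derivative ddir v f (x + sc_qz s v)) (at s)"
proof -
  have "((\<lambda>t. f ((x + sc_qz s v) + sc_qz t v)) has_field_derivative ddir v f (x + sc_qz s v)) (at 0)"
    using assms unfolding ddir_def line_holo_on_def DERIV_deriv_iff_field_differentiable by blast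
  also have "(\<lambda>t. f ((x + sc_qz s v) + sc_qz t v)) = (\<lambda>t. f (x + sc_qz (t + s) v))"
    by (simp add: sc_qz_add add_ac)
  finally show ?thesis
    using DERIV_shift[of "\<lambda>t. f (x + sc_qz t v)" _ 0 s] by simp
qed

lemma line_holo_on_holomorphic:
  assumes "line_holo_on f S" "\<And>s. s \<in> A \<Longrightarrow> x + sc_qz s v \<in> S"
  shows "(\<lambda>s. f (x + sc_qz s v)) holomorphic_on A"
  unfolding holomorphic_on_def field_differentiable_def
  by (blast intro: has_field_derivative_at_within line_holo_on_has_derivative[OF assms(1)] assms(2))

lemma line_holo_onD: "line_holo_on f S \<Longrightarrow> open S" "line_holo_on f S \<Longrightarrow> continuous_on S f"
  by (auto simp: line_holo_on_def)

lemma line_holo_on_subset: "line_holo_on f S \<Longrightarrow> T \<subseteq> S \<Longrightarrow> open T \<Longrightarrow> line_holo_on f T"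
  by (auto simp: line_holo_on_def intro: continuous_on_subset)

lemma line_holo_on_diff:
  "line_holo_on f S \<Longrightarrow> line_holo_on g S \<Longrightarrow> line_holo_on (\<lambda>x. f x - g x) S"
  unfolding line_holo_on_def by (simp add: continuous_on_diff field_differentiable_diff)

lemma line_holo_on_mult:
  "line_holo_on f S \<Longrightarrow> line_holo_on g S \<Longrightarrow> line_holo_on (\<lambda>x. f x * g x) S"
  unfolding line_holo_on_def by (simp add: continuous_on_mult field_differentiable_mult)

lemma has_derivative_line: "((\<lambda>s. x + sc_qz s v) has_derivative (\<lambda>s. sc_qz s v)) (at s0)"
proof -
  have "bounded_linear (\<lambda>s. sc_qz s v)"
  proof (rule bounded_linear_intro[where K = "norm v"])
    show "norm (sc_qz s v) \<le> norm s * norm v" for s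
      by (simp add: norm_prod_def norm_vmult norm_mult power_mult_distrib real_sqrt_mult flip: distrib_left)
  next
    show "sc_qz (c *\<^sub>R s) v = c *\<^sub>R sc_qz s v" for c s
      by (simp add: prod_eq_iff vec_eq_iff vector_scalar_mult_def)
  qed (simp add: sc_qz_add)
  hence "((\<lambda>s. sc_qz s v) has_derivative (\<lambda>s. sc_qz s v)) (at s0)"
    by (rule bounded_linear_imp_has_derivative)
  from has_derivative_add[OF has_derivative_const this] show ?thesis by simp
qed

text \<open>One D serves all directions at once; this is what later makes \<open>dir_deriv\<close>
  linear in its direction.\<close>

lemma holo_on_ddir:
  assumes "holo_on sc_qz f S" "x \<in> S"
  shows "\<exists>D. (f has_derivative D) (at x) \<and> (\<forall>c v. D (sc_qz c v) = c * D v) \<and>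
    (\<forall>v. ((\<lambda>s. f (x + sc_qz s v)) has_field_derivative D v) (at 0))"
proof -
  obtain D where D: "(f has_derivative D) (at x)" "\<And>c v. D (sc_qz c v) = c * D v"
    using assms unfolding holo_on_def by blast
  have "((\<lambda>s. f (x + sc_qz s v)) has_field_derivative D v) (at 0)" for v
  proof -
    have "((\<lambda>s. f (x + sc_qz s v)) has_derivative (\<lambda>s. D (sc_qz s v))) (at 0)"
      using has_derivative_compose[OF has_derivative_line, of f D] D by simp
    also have "(\<lambda>s. D (sc_qz s v)) = (*) (D v)" by (simp add: D(2) fun_eq_iff mult.commute)
    finally show ?thesis by (simp add: has_field_derivative_def)
  qed
  with D show ?thesis by blast
qed

lemma holo_on_imp_line_holo_on:
  assumes "holo_on sc_qz f S"
  shows "line_holo_on f S"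
  unfolding line_holo_on_def
proof (intro conjI ballI allI)
  show "open S" using assms by (simp add: holo_on_def)
  show "continuous_on S f"
    using assms by (auto simp: holo_on_def intro!: continuous_at_imp_continuous_on
        intro: has_derivative_continuous)
  show "(\<lambda>s. f (x + sc_qz s v)) field_differentiable (at 0)" if "x \<in> S" for x v
    using holo_on_ddir[OF assms that] unfolding field_differentiable_def by blast
qed

text \<open>The preimage of S under (x, s) -> x + s v is open, and a product neighbourhood of (x0,
  0) in it gives one radius for all base points near x0. A fixed circle can then be the contour for
  all of them.\<close>

lemma open_line_ball:
  assumes "open S" "x0 \<in> S"
  obtains N \<rho> where "open N" "x0 \<in> N" "\<rho> > 0"
    "\<And>x s. x \<in> N \<Longrightarrow> norm s \<le> \<rho> \<Longrightarrow> x + sc_qz s v \<in> S"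
proof -
  let ?g = "\<lambda>y::((complex^'a) \<times> complex) \<times> complex. fst y + sc_qz (snd y) v"
  have "continuous_on UNIV ?g" by (intro continuous_intros)
  hence "open (?g -` S)" using assms(1) by (simp add: open_vimage)
  moreover have "(x0, 0) \<in> ?g -` S" using assms(2) by simp
  ultimately obtain N B where NB: "open N" "open B" "(x0, 0) \<in> N \<times> B" "N \<times> B \<subseteq> ?g -` S"
    by (rule open_prod_elim)
  then obtain \<rho> where \<rho>: "\<rho> > 0" "cball 0 \<rho> \<subseteq> B" by (meson SigmaE2 open_contains_cball)
  show ?thesis
  proof (rule that[of N \<rho>])
    fix x s assume "x \<in> N" "norm (s :: complex) \<le> \<rho>"
    hence "(x, s) \<in> N \<times> B" using \<rho> by auto
    thus "x + sc_qz s v \<in> S" using NB(4) by auto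
  qed (use NB \<rho> in auto)
qed

text \<open>Cauchy's formula for the first derivative, parametrised over [0, 1]: the domain of
  integration does not depend on x, so continuity and differentiability in x follow from theorems on
  parameter integrals.\<close>

lemma ddir_integral:
  assumes f: "line_holo_on f S" and "\<rho> > 0" and S: "\<And>s. norm s \<le> \<rho> \<Longrightarrow> x + sc_qz s v \<in> S"
  shows "ddir v f x = 1 / (2 * of_real pi * \<i>) * integral {0..1}
     (\<lambda>t. f (x + sc_qz (circlepath 0 \<rho> t) v) / (circlepath 0 \<rho> t)^2 *
          (2 * pi * \<i> * \<rho> * exp (2 * of_real pi * \<i> * t)))"
proof -
  let ?g = "\<lambda>s. f (x + sc_qz s v)"
  have h: "?g holomorphic_on cball 0 \<rho>"
    by (rule line_holo_on_holomorphic[OF f]) (auto intro: S)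
  have "(?g has_field_derivative (1 / (2 * of_real pi * \<i>) * contour_integral (circlepath 0 \<rho>) (\<lambda>u. ?g u / (u-0)^2))) (at 0)"
    using h \<open>\<rho> > 0\<close> by (intro Cauchy_derivative_integral_circlepath holomorphic_on_imp_continuous_on)
      (auto intro: holomorphic_on_subset)
  thus ?thesis
    unfolding ddir_def by (simp add: DERIV_imp_deriv contour_integral_integral vector_derivative_circlepath)
qed

lemma continuous_on_circlepath_param [continuous_intros]:
  "continuous_on A f \<Longrightarrow> continuous_on A (\<lambda>y. circlepath z \<rho> (f y))"
  unfolding circlepath by (intro continuous_intros)

lemma circlepath_0_neq_0 [simp]: "\<rho> > 0 \<Longrightarrow> circlepath 0 \<rho> t \<noteq> 0"
  by (simp add: circlepath)

lemma norm_circlepath_0: "norm (circlepath 0 \<rho> t) = \<bar>\<rho>\<bar>"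
  by (simp add: circlepath norm_mult)

lemma continuous_on_ddir:
  assumes f: "line_holo_on f S"
  shows "continuous_on S (ddir v f)"
proof (rule continuous_at_imp_continuous_on, rule ballI)
  fix x0 assume "x0 \<in> S"
  then obtain N \<rho> where N: "open N" "x0 \<in> N" "\<rho> > 0"
    "\<And>x s. x \<in> N \<Longrightarrow> norm s \<le> \<rho> \<Longrightarrow> x + sc_qz s v \<in> S"
    by (rule open_line_ball[OF line_holo_onD(1)[OF f], of x0 v]) blast+
  have "continuous_on N (\<lambda>x. 1 / (2 * of_real pi * \<i>) * integral (cbox 0 1)
     (\<lambda>t. f (x + sc_qz (circlepath 0 \<rho> t) v) / (circlepath 0 \<rho> t)^2 *
          (2 * pi * \<i> * \<rho> * exp (2 * of_real pi * \<i> * t))))"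
    apply (intro continuous_intros integral_continuous_on_param)
    unfolding split_beta
    using N by (intro continuous_intros continuous_on_compose2[OF line_holo_onD(2)[OF f]])
     (auto simp: norm_circlepath_0)
  also have "?this \<longleftrightarrow> continuous_on N (ddir v f)"
    by (intro continuous_on_cong refl) (subst ddir_integral[OF f], use N in auto)
  finally show "isCont (ddir v f) x0"
    using N by (simp add: continuous_on_eq_continuous_at)
qed

text \<open>Differentiation under the Cauchy integral in a second direction u: the derivative of the
  integrand involves \<open>ddir u f\<close>, which is continuous by the preceding lemma.
  Derivatives of every order thus stay in the class.\<close>

lemma line_holo_on_ddir:
  assumes f: "line_holo_on f S"
  shows "line_holo_on (ddir v f) S"
  unfolding line_holo_on_def
proof (intro conjI ballI allI)
  show "open S" using f by (rule line_holo_onD)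
  show "continuous_on S (ddir v f)" by (rule continuous_on_ddir) fact
  fix x0 u assume x0: "x0 \<in> S"
  then obtain N \<rho> where N: "open N" "x0 \<in> N" "\<rho> > 0"
    "\<And>x s. x \<in> N \<Longrightarrow> norm s \<le> \<rho> \<Longrightarrow> x + sc_qz s v \<in> S"
    by (rule open_line_ball[OF line_holo_onD(1)[OF f], of x0 v]) blast+
  \<comment> \<open>A second radius keeps the points x0 + s u inside N, so that the circles of
    radius \<rho> in direction v around them stay in S.\<close>
  obtain N' \<sigma> where N': "open N'" "x0 \<in> N'" "\<sigma> > 0"
    "\<And>x s. x \<in> N' \<Longrightarrow> norm s \<le> \<sigma> \<Longrightarrow> x + sc_qz s u \<in> N"
    by (rule open_line_ball[OF N(1,2), of u]) blast
  have S: "x0 + sc_qz s u + sc_qz t v \<in> S" if "norm s < \<sigma>" "norm t \<le> \<rho>" for s t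
    using N N' that by auto
  let ?c = "\<lambda>t. 1 / (circlepath 0 \<rho> t)^2 * (2 * pi * \<i> * \<rho> * exp (2 * of_real pi * \<i> * t))"
  have S': "x0 + sc_qz s u + sc_qz (circlepath 0 \<rho> t) v \<in> S" if "s \<in> ball 0 \<sigma>" for s t
    using S[of s "circlepath 0 \<rho> t"] that N by (simp add: norm_circlepath_0)
  have c: "continuous_on A ?c" for A
    using N(3) by (intro continuous_intros) auto
  have "(\<lambda>s. integral (cbox 0 1)
     (\<lambda>t. f (x0 + sc_qz s u + sc_qz (circlepath 0 \<rho> t) v) * ?c t)) holomorphic_on ball 0 \<sigma>"
  proof (rule leibniz_rule_holomorphic)
    let ?fx = "\<lambda>s t. ddir u f (x0 + sc_qz s u + sc_qz (circlepath 0 \<rho> t) v) * ?c t"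
    fix s :: complex assume s: "s \<in> ball 0 \<sigma>"
    show "((\<lambda>s. f (x0 + sc_qz s u + sc_qz (circlepath 0 \<rho> t) v) * ?c t) has_field_derivative ?fx s t)
        (at s within ball 0 \<sigma>)" for t
    proof -
      have eq: "x0 + sc_qz (circlepath 0 \<rho> t) v + sc_qz s u = x0 + sc_qz s u + sc_qz (circlepath 0 \<rho> t) v" for s
        by (simp add: add_ac)
      have "x0 + sc_qz (circlepath 0 \<rho> t) v + sc_qz s u \<in> S"
        using S'[OF s] by (simp add: eq)
      from line_holo_on_has_derivative[OF f this, unfolded eq] show ?thesis
        by (rule DERIV_cmult_right[OF has_field_derivative_at_within])
    qed
    have "continuous_on (cbox 0 1) (\<lambda>t. f (x0 + sc_qz s u + sc_qz (circlepath 0 \<rho> t) v))"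
      by (rule continuous_on_compose2[OF line_holo_onD(2)[OF f]])
         (use S'[OF s] in \<open>auto intro!: continuous_on_add continuous_on_const continuous_on_sc_qz
            continuous_on_circlepath_param continuous_on_id\<close>)
    thus "(\<lambda>t. f (x0 + sc_qz s u + sc_qz (circlepath 0 \<rho> t) v) * ?c t) integrable_on cbox 0 1"
      by (rule integrable_continuous[OF continuous_on_mult[OF _ c]])
  next
    have "continuous_on (ball 0 \<sigma> \<times> cbox 0 1) (\<lambda>y. ddir u f (x0 + sc_qz (fst y) u + sc_qz (circlepath 0 \<rho> (snd y)) v))"
      by (rule continuous_on_compose2[OF continuous_on_ddir[OF f]])
         (use S' in \<open>auto intro!: continuous_on_add continuous_on_const continuous_on_sc_qz
            continuous_on_circlepath_param continuous_on_id continuous_on_fst continuous_on_snd\<close>)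
    moreover have "continuous_on (ball 0 \<sigma> \<times> cbox 0 1) (\<lambda>y. ?c (snd y))"
      by (rule continuous_on_compose2[OF c continuous_on_snd[OF continuous_on_id] order_refl])
    ultimately show "continuous_on (ball 0 \<sigma> \<times> cbox 0 1)
        (\<lambda>(s, t). ddir u f (x0 + sc_qz s u + sc_qz (circlepath 0 \<rho> t) v) * ?c t)"
      unfolding split_beta by (rule continuous_on_mult)
  qed auto
  from holomorphic_on_mult[OF holomorphic_on_const[of "1 / (2 * of_real pi * \<i>)"] this]
  have "(\<lambda>s. 1 / (2 * of_real pi * \<i>) * integral (cbox 0 1)
     (\<lambda>t. f (x0 + sc_qz s u + sc_qz (circlepath 0 \<rho> t) v) * ?c t)) holomorphic_on ball 0 \<sigma>" .
  also have "?this \<longleftrightarrow> (\<lambda>s. ddir v f (x0 + sc_qz s u)) holomorphic_on ball 0 \<sigma>"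
  proof (intro holomorphic_cong refl)
    fix s :: complex assume "s \<in> ball 0 \<sigma>"
    thus "1 / (2 * of_real pi * \<i>) * integral (cbox 0 1)
     (\<lambda>t. f (x0 + sc_qz s u + sc_qz (circlepath 0 \<rho> t) v) * ?c t) = ddir v f (x0 + sc_qz s u)"
      using ddir_integral[OF f N(3) S[of s]] by simp
  qed
  finally show "(\<lambda>s. ddir v f (x0 + sc_qz s u)) field_differentiable (at 0)"
    using N' by (auto simp: holomorphic_on_def at_within_open[of _ "ball 0 \<sigma>"])
qed

section \<open>Tensors and invariance\<close>

lemma bv_nth: "bv i $ j = (if i = j then 1 else 0)"
  by (simp add: axis_def)

lemma sum_mult_bv: "(\<Sum>d\<in>UNIV. f d * bv d $ b) = (f b :: complex)"
  by (simp add: bv_nth if_distrib cong: if_cong)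

context
  fixes br :: "complex^'n \<Rightarrow> complex^'n \<Rightarrow> complex^'n"
  assumes lie: "lie_algebra br"
begin

lemma br_add: "br (x + y) z = br x z + br y z" "br x (y + z) = br x y + br x z"
  using lie unfolding lie_algebra_def by blast+

lemma br_smult: "br (c *s x) y = c *s br x y" "br x (c *s y) = c *s br x y"
  using lie unfolding lie_algebra_def by blast+

lemma br_self: "br x x = 0"
  using lie unfolding lie_algebra_def by blast

lemma br_jacobi: "br x (br y z) + br y (br z x) + br z (br x y) = 0"
  using lie unfolding lie_algebra_def by blast

lemma br_zero [simp]: "br 0 x = 0" "br x 0 = 0"
  using br_smult(1)[of 0 0 x] br_smult(2)[of x 0 0] by simp_all

lemma br_anti: "br x y = - br y x"
proof -
  have "br y x + br x y = 0"
    using br_self[of "x + y"] by (simp only: br_add br_self[of x] br_self[of y] add_0_left add_0_right)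
  thus ?thesis by (simp add: eq_neg_iff_add_eq_0 add.commute)
qed

lemma br_minus: "br (- x) y = - br x y" "br x (- y) = - br x y"
  using br_add(1)[of x "- x" y] br_add(2)[of x y "- y"] by (simp_all add: eq_neg_iff_add_eq_0 add.commute)

lemma br_diff: "br (x - y) z = br x z - br y z" "br x (y - z) = br x y - br x z"
  using br_add[of x "- y"] br_add(2)[of x y "- z"] by (simp_all add: br_minus)

lemma br_sum: "br (sum f A) y = (\<Sum>i\<in>A. br (f i) y)" "br x (sum g A) = (\<Sum>i\<in>A. br x (g i))"
  by (induction A rule: infinite_finite_induct) (simp_all add: br_add)

lemma br_jacobi': "br (br x y) z = br x (br y z) - br y (br x z)"
  using br_jacobi[of x y z] br_anti[of z "br x y"] br_anti[of z x]
  by (simp add: br_minus algebra_simps eq_neg_iff_add_eq_0)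

lemma br_expand_left: "br x y = (\<Sum>a\<in>UNIV. x $ a *s br (bv a) y)"
  by (subst basis_expansion[of x, symmetric]) (simp only: br_sum br_smult)

lemma br_expand_right: "br x y = (\<Sum>a\<in>UNIV. y $ a *s br x (bv a))"
  by (subst basis_expansion[of y, symmetric]) (simp only: br_sum br_smult)

lemma br_expand: "br x y = (\<Sum>a\<in>UNIV. \<Sum>b\<in>UNIV. (x $ a * y $ b) *s br (bv a) (bv b))"
  by (subst br_expand_left, subst br_expand_right) (simp add: vec.scale_sum_right)

text \<open>Fixing the index of the leg that is not bracketed leaves a vector: a column of t for the
  first leg, a row for the second. Tensor identities are handled in this scalar form from here
  on.\<close>

lemma comm1_nth: "comm1 br t x $ a $ b = br (column b t) x $ a"
  by (subst br_expand_left) (simp add: comm1_def tensor2_def column_def sum_mult_bv)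

lemma comm2_nth: "comm2 br t x $ a $ b = br (t $ a) x $ b"
proof -
  have "comm2 br t x $ a $ b = (\<Sum>c\<in>UNIV. (\<Sum>d\<in>UNIV. t $ c $ d * br (bv d) x $ b) * bv c $ a)"
    by (simp add: comm2_def tensor2_def sum_distrib_right sum_distrib_left mult_ac)
  thus ?thesis unfolding sum_mult_bv by (subst br_expand_left) simp
qed

lemma comm_12_13_nth: "comm_12_13 br s t $ a $ b $ d = br (column b s) (column d t) $ a"
proof -
  have "comm_12_13 br s t $ a $ b $ d = (\<Sum>a'\<in>UNIV. \<Sum>b'\<in>UNIV. (\<Sum>c'\<in>UNIV. \<Sum>d'\<in>UNIV.
      (s $ a' $ b' * t $ c' $ d' * br (bv a') (bv c') $ a) * bv d' $ d) * bv b' $ b)"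
    by (simp add: comm_12_13_def tensor3_def sum_distrib_right sum_distrib_left mult_ac)
  thus ?thesis unfolding sum_mult_bv by (subst br_expand) (simp add: column_def)
qed

lemma comm_12_23_nth: "comm_12_23 br s t $ a $ b $ d = br (s $ a) (column d t) $ b"
proof -
  have "comm_12_23 br s t $ a $ b $ d = (\<Sum>a'\<in>UNIV. (\<Sum>b'\<in>UNIV. \<Sum>c'\<in>UNIV. \<Sum>d'\<in>UNIV.
      (s $ a' $ b' * t $ c' $ d' * br (bv b') (bv c') $ b) * bv d' $ d) * bv a' $ a)"
    by (simp add: comm_12_23_def tensor3_def sum_distrib_right sum_distrib_left mult_ac)
  thus ?thesis unfolding sum_mult_bv by (subst br_expand) (simp add: column_def)
qed

lemma comm_13_23_nth: "comm_13_23 br s t $ a $ c $ e = br (s $ a) (t $ c) $ e"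
proof -
  have "comm_13_23 br s t $ a $ c $ e = (\<Sum>a'\<in>UNIV. (\<Sum>b'\<in>UNIV. \<Sum>c'\<in>UNIV. (\<Sum>d'\<in>UNIV.
      s $ a' $ b' * t $ c' $ d' * br (bv b') (bv d') $ e) * bv c' $ c) * bv a' $ a)"
    by (simp add: comm_13_23_def tensor3_def sum_distrib_right sum_distrib_left mult_ac)
  thus ?thesis unfolding sum_mult_bv by (subst br_expand) simp
qed

section \<open>Killing form and Casimir element\<close>

lemma killing_eq: "killing br x y = (\<Sum>c\<in>UNIV. br x (br y (bv c)) $ c)"
  by (simp add: killing_def trace_def matrix_def)

text \<open>Cyclicity of the trace; the hypotheses express linearity of f and g by expansion in the
  basis.\<close>

lemma trace_swap:
  assumes "\<And>u. f u = (\<Sum>a\<in>UNIV. u $ a *s f (bv a))" "\<And>u. g u = (\<Sum>a\<in>UNIV. u $ a *s g (bv a))"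
  shows "(\<Sum>c\<in>UNIV. f (g (bv c)) $ c) = (\<Sum>c\<in>UNIV. g (f (bv c)) $ (c :: 'n) :: complex)"
proof -
  have "(\<Sum>c\<in>UNIV. f (g (bv c)) $ c) = (\<Sum>c\<in>UNIV. \<Sum>d\<in>UNIV. g (bv c) $ d * f (bv d) $ c)"
    by (subst assms(1)) simp
  also have "\<dots> = (\<Sum>d\<in>UNIV. \<Sum>c\<in>UNIV. f (bv d) $ c * g (bv c) $ d)"
    by (subst sum.swap) (simp add: mult.commute)
  also have "\<dots> = (\<Sum>c\<in>UNIV. g (f (bv c)) $ c)"
    by (subst (2) assms(2)) simp
  finally show ?thesis .
qed

lemma killing_sym: "killing br x y = killing br y x"
  unfolding killing_eq by (rule trace_swap; rule br_expand_right)

lemma killing_bilinear: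
  "killing br (x + x') y = killing br x y + killing br x' y"
  "killing br x (y + y') = killing br x y + killing br x y'"
  "killing br (c *s x) y = c * killing br x y"
  "killing br x (c *s y) = c * killing br x y"
  "killing br 0 y = 0" "killing br x 0 = 0"
  "killing br (- x) y = - killing br x y"
  "killing br x (- y) = - killing br x y"
  by (simp_all add: killing_eq br_add br_smult br_minus sum.distrib sum_distrib_left sum_negf)

lemma killing_sum:
  "killing br (sum f A) y = (\<Sum>i\<in>A. killing br (f i) y)"
  "killing br x (sum g A) = (\<Sum>i\<in>A. killing br x (g i))"
  by (induction A rule: infinite_finite_induct) (simp_all add: killing_bilinear)

text \<open>Since ad [x, y] is the commutator of ad x and ad y, the sides are tr(xyz) - tr(yxz) and
  tr(xyz) - tr(xzy), which agree by cyclicity.\<close>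

lemma killing_invariant: "killing br (br x y) z = killing br x (br y z)"
proof -
  have "(\<Sum>c\<in>UNIV. br y (br x (br z (bv c))) $ c) = (\<Sum>c\<in>UNIV. br x (br z (br y (bv c))) $ c)"
    by (rule trace_swap[of "br y" "\<lambda>u. br x (br z u)"], rule br_expand_right)
       (subst br_expand_right, simp only: br_sum br_smult)
  thus ?thesis
    by (simp add: killing_eq br_jacobi' br_add br_minus sum_subtractf br_diff)
qed

text \<open>The rows of \<Omega> are the dual basis e'. Its entry (a, b) is therefore the Killing
  pairing of e' a with e' b, and symmetry of the form makes \<Omega> symmetric.\<close>

lemma
  assumes "is_casimir br \<Omega>"
  shows casimir_dual: "killing br y (\<Omega> $ b) = y $ b"
    and casimir_column: "column b \<Omega> = \<Omega> $ b"
proof -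
  obtain e' where e': "\<And>a b. killing br (bv a) (e' b) = (if a = b then 1 else 0)"
    "\<Omega> = (\<Sum>a\<in>UNIV. tensor2 (bv a) (e' a))"
    using assms by (auto simp: is_casimir_def)
  have \<Omega>: "\<Omega> $ a = e' a" for a
    by (simp add: e'(2) tensor2_def vec_eq_iff axis_def if_distrib if_distribR cong: if_cong)
  have dual: "killing br y (e' b) = y $ b" for y b
    by (subst basis_expansion[of y, symmetric], subst killing_sum)
       (simp add: killing_bilinear e'(1) if_distrib cong: if_cong)
  show "killing br y (\<Omega> $ b) = y $ b" by (simp add: \<Omega> dual)
  have "\<Omega> $ a $ b = \<Omega> $ b $ a" for a
    using dual[of "e' a" b] dual[of "e' b" a] by (simp add: \<Omega> killing_sym)
  thus "column b \<Omega> = \<Omega> $ b" by (simp add: vec_eq_iff column_def)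
qed

text \<open>\<Omega> inverts the Gram matrix of the Killing form, a one-sided inverse of square
  matrices being two-sided. Thus a linear identity checked on the columns of \<Omega> holds for
  every x.\<close>

lemma casimir_expansion:
  assumes "is_casimir br \<Omega>"
  shows "x = (\<Sum>c\<in>UNIV. killing br (bv c) x *s column c \<Omega>)"
proof -
  let ?K = "\<chi> a c. killing br (bv a) (bv c)"
  have "?K ** \<Omega> = mat 1"
  proof -
    have "(\<Sum>k\<in>UNIV. killing br (bv a) (bv k) * \<Omega> $ k $ b) = killing br (bv a) (\<Omega> $ b)" for a b
    proof -
      have "\<Omega> $ k $ b = \<Omega> $ b $ k" for k
        using casimir_column[OF assms, of b] by (simp add: vec_eq_iff column_def)
      thus ?thesis
        using killing_sum(2)[of "bv a" "\<lambda>k. \<Omega> $ b $ k *s bv k" UNIV]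
        by (simp add: killing_bilinear mult.commute basis_expansion)
    qed
    thus ?thesis
      by (simp add: matrix_matrix_mult_def vec_eq_iff mat_def casimir_dual[OF assms] axis_def)
  qed
  hence "\<Omega> ** ?K = mat 1" by (simp add: matrix_left_right_inverse)
  hence "x = \<Omega> *v (?K *v x)" by (simp add: matrix_vector_mul_assoc)
  also have "\<dots> = (\<Sum>c\<in>UNIV. (?K *v x) $ c *s column c \<Omega>)" by (rule matrix_mult_sum)
  also have "(?K *v x) = (\<chi> c. killing br (bv c) x)"
    using killing_sum(2)[of _ "\<lambda>k. x $ k *s bv k" UNIV]
    by (simp add: matrix_vector_mult_def killing_bilinear mult.commute basis_expansion)
  finally show ?thesis by simp
qed

text \<open>The Killing pairing of a row of \<Omega> with a row of \<Omega>' can be evaluated by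
  either duality. In particular the residue of r will not depend on q.\<close>

lemma casimir_unique:
  assumes "is_casimir br \<Omega>" "is_casimir br \<Omega>'"
  shows "\<Omega> = \<Omega>'"
proof -
  have "\<Omega> $ a $ b = \<Omega>' $ a $ b" for a b
  proof -
    have "\<Omega> $ a $ b = killing br (\<Omega> $ a) (\<Omega>' $ b)" by (simp add: casimir_dual[OF assms(2)])
    also have "\<dots> = \<Omega>' $ b $ a" by (subst killing_sym) (simp add: casimir_dual[OF assms(1)])
    also have "\<dots> = \<Omega>' $ a $ b"
      using casimir_column[OF assms(2), of b] by (simp add: vec_eq_iff column_def)
    finally show ?thesis .
  qed
  thus ?thesis by (simp add: vec_eq_iff)
qed

text \<open>Coordinates are Killing pairings with rows of \<Omega>, which turns the claim into
  invariance of the form.\<close>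

lemma casimir_invariant:
  assumes "is_casimir br \<Omega>"
  shows "br (column b \<Omega>) x $ a = - br (\<Omega> $ a) x $ b"
proof -
  have "br (\<Omega> $ b) x $ a = killing br (br (\<Omega> $ b) x) (\<Omega> $ a)" by (simp add: casimir_dual[OF assms])
  also have "\<dots> = killing br (\<Omega> $ b) (br x (\<Omega> $ a))" by (rule killing_invariant)
  also have "\<dots> = - killing br (br (\<Omega> $ a) x) (\<Omega> $ b)"
    by (subst br_anti) (simp add: killing_bilinear killing_sym)
  finally show ?thesis by (simp add: casimir_dual[OF assms] casimir_column[OF assms])
qed

end

lemma orthonormal_basis_independent:
  assumes "lie_algebra br" "orthonormal_basis br H h" "(\<Sum>i\<in>UNIV. c i *s h i) = 0"
  shows "c j = 0"
proof -
  have "killing br (\<Sum>i\<in>UNIV. c i *s h i) (h j) = c j"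
  proof -
    have "killing br (h i) (h j) = (if i = j then 1 else 0)" for i
      using assms(2) unfolding orthonormal_basis_def by blast
    thus ?thesis
      by (simp only: killing_sum[OF assms(1)] killing_bilinear[OF assms(1)]) (simp add: if_distrib cong: if_cong)
  qed
  thus ?thesis using assms(3) by (simp add: killing_bilinear[OF assms(1)])
qed

lemma pair_sum_right: "pair \<xi> (sum f A) = (\<Sum>i\<in>A. pair \<xi> (f i))"
  by (simp add: pair_def sum_distrib_left sum.swap[of _ A])

text \<open>The rows of an invariant tensor span an ideal.\<close>

lemma invariant_commuting_rows_eq_0:
  assumes g: "simple_lie_algebra br"
    and inv: "\<And>a b x. br (column b \<theta>) x $ a = - br (\<theta> $ a) x $ b"
    and comm: "\<And>a b. br (\<theta> $ a) (\<theta> $ b) = 0"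
  shows "\<theta> = 0"
proof -
  have lie: "lie_algebra br" using g by (simp add: simple_lie_algebra_def)
  let ?I = "vec.span (range (\<lambda>a. \<theta> $ a))"
  \<comment> \<open>Invariance rewrites the bracket of x with a row as a combination of rows, so
    their span absorbs brackets.\<close>
  have row: "br x (\<theta> $ a) = (\<Sum>c\<in>UNIV. br (bv c) x $ a *s \<theta> $ c)" for x a
  proof -
    have "br x (\<theta> $ a) $ b = (\<Sum>c\<in>UNIV. br (bv c) x $ a *s \<theta> $ c) $ b" for b
    proof -
      have "br x (\<theta> $ a) $ b = br (column b \<theta>) x $ a"
        by (subst br_anti[OF lie]) (simp add: inv)
      also have "\<dots> = (\<Sum>c\<in>UNIV. br (bv c) x $ a *s \<theta> $ c) $ b"
        by (subst br_expand_left[OF lie]) (simp add: column_def mult.commute)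
      finally show ?thesis .
    qed
    thus ?thesis by (simp add: vec_eq_iff)
  qed
  have "br x y \<in> ?I" if "y \<in> ?I" for x y
    using that
  proof (induction rule: vec.span_induct_alt)
    case (step c y z)
    then obtain a where "y = \<theta> $ a" by auto
    hence "br x y \<in> ?I" by (simp only: row) (auto intro!: vec.span_sum vec.span_scale intro: vec.span_base)
    thus ?case using step by (auto simp: br_add[OF lie] br_smult[OF lie] intro!: vec.span_add vec.span_scale)
  qed (simp add: br_zero[OF lie] vec.span_zero)
  hence "lie_ideal br ?I" by (simp add: lie_ideal_def vec.subspace_span)
  hence "?I = {0} \<or> ?I = UNIV" using g by (simp add: simple_lie_algebra_def)
  \<comment> \<open>If the rows spanned the whole algebra, their commuting would extend, in one
    argument and then in the other, to a bracket that is identically zero, against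
    simplicity.\<close>
  moreover have "?I \<noteq> UNIV"
  proof
    assume U: "?I = UNIV"
    have 1: "br x (\<theta> $ a) = 0" for x a
    proof -
      have "x \<in> ?I" using U by simp
      thus ?thesis
        by (induction rule: vec.span_induct_alt) (auto simp: br_add[OF lie] br_smult[OF lie] br_zero[OF lie] comm)
    qed
    have "br x y = 0" for x y
    proof -
      have "y \<in> ?I" using U by simp
      thus ?thesis
        by (induction rule: vec.span_induct_alt) (auto simp: br_add[OF lie] br_smult[OF lie] br_zero[OF lie] 1)
    qed
    thus False using g by (simp add: simple_lie_algebra_def)
  qed
  ultimately have "\<theta> $ a = 0" for a
    using vec.span_base[of "\<theta> $ a" "range (\<lambda>a. \<theta> $ a)"] by blast
  thus ?thesis by (simp add: vec_eq_iff)
qed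

lemma put_nth:
  "put_1_23 x t $ a $ b $ c = x $ a * t $ b $ c"
  "put_2_31 x t $ a $ b $ c = x $ b * t $ c $ a"
  "put_3_12 x t $ a $ b $ c = x $ c * t $ a $ b"
proof -
  have "put_1_23 x t $ a $ b $ c = (\<Sum>i\<in>UNIV. (\<Sum>j\<in>UNIV. (x $ a * t $ i $ j) * bv j $ c) * bv i $ b)"
    by (simp add: put_1_23_def tensor3_def sum_distrib_right sum_distrib_left mult_ac)
  thus "put_1_23 x t $ a $ b $ c = x $ a * t $ b $ c" unfolding sum_mult_bv .
  have "put_2_31 x t $ a $ b $ c = (\<Sum>i\<in>UNIV. (\<Sum>j\<in>UNIV. (x $ b * t $ i $ j) * bv j $ a) * bv i $ c)"
    by (simp add: put_2_31_def tensor3_def sum_distrib_right sum_distrib_left mult_ac)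
  thus "put_2_31 x t $ a $ b $ c = x $ b * t $ c $ a" unfolding sum_mult_bv .
  have "put_3_12 x t $ a $ b $ c = (\<Sum>i\<in>UNIV. (\<Sum>j\<in>UNIV. (x $ c * t $ i $ j) * bv j $ b) * bv i $ a)"
    by (simp add: put_3_12_def tensor3_def sum_distrib_right sum_distrib_left mult_ac)
  thus "put_3_12 x t $ a $ b $ c = x $ c * t $ a $ b" unfolding sum_mult_bv .
qed

section \<open>Meromorphic functions restricted to a slice\<close>

lemma higher_deriv_line:
  assumes "line_holo_on f S" "open A" "\<And>s. s \<in> A \<Longrightarrow> x + sc_qz s v \<in> S" "s \<in> A"
  shows "(deriv ^^ m) (\<lambda>s. f (x + sc_qz s v)) s = (ddir v ^^ m) f (x + sc_qz s v)"
proof -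
  have L: "line_holo_on ((ddir v ^^ m) f) S" for m
    by (induction m) (auto intro: assms line_holo_on_ddir)
  show "(deriv ^^ m) (\<lambda>s. f (x + sc_qz s v)) s = (ddir v ^^ m) f (x + sc_qz s v)"
    using assms(4)
  proof (induction m arbitrary: s)
    case (Suc m)
    have "eventually (\<lambda>t. t \<in> A) (nhds s)"
      using assms(2) Suc.prems by (rule eventually_nhds_in_open)
    hence "eventually (\<lambda>t. (deriv ^^ m) (\<lambda>s. f (x + sc_qz s v)) t = (ddir v ^^ m) f (x + sc_qz t v)) (nhds s)"
      by eventually_elim (rule Suc.IH)
    hence "deriv ((deriv ^^ m) (\<lambda>s. f (x + sc_qz s v))) s = deriv (\<lambda>t. (ddir v ^^ m) f (x + sc_qz t v)) s"
      by (rule deriv_cong_ev) simp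
    also have "\<dots> = ddir v ((ddir v ^^ m) f) (x + sc_qz s v)"
      by (rule DERIV_imp_deriv[OF line_holo_on_has_derivative[OF L assms(3)[OF Suc.prems]]])
    finally show ?case by simp
  qed simp
qed

lemma line_holo_on_eq_dense:
  assumes f: "line_holo_on f W" and A: "W \<subseteq> closure A" and eq: "\<And>y. y \<in> A \<Longrightarrow> y \<in> W \<Longrightarrow> f y = 0"
    and y: "y \<in> W"
  shows "f y = 0"
proof (rule ccontr)
  assume "f y \<noteq> 0"
  have "open (W \<inter> f -` (- {0}))"
    using line_holo_onD[OF f] by (intro continuous_open_preimage) auto
  moreover have "y \<in> (W \<inter> f -` (- {0})) \<inter> closure A"
    using \<open>f y \<noteq> 0\<close> y A by auto
  ultimately have "(W \<inter> f -` (- {0})) \<inter> A \<noteq> {}"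
    using open_Int_closure_eq_empty by blast
  thus False using eq by auto
qed

lemma dist_self_add: "dist x (x + y) = norm (y :: 'a::real_normed_vector)"
  by (simp add: dist_norm)

text \<open>
  If the denominator \<open>G\<close> vanishes identically on the slice through \<open>q\<close>, it does not do so to infinite
  order along a suitable line through \<open>q\<close>; the first nonvanishing derivative in the direction of that line
  is a denominator for the slice, because the product rule for \<open>F = G \<rho>\<close> collapses to one term.
\<close>

lemma not_essential_slice:
  fixes G F \<rho> :: "(complex^'l) \<times> complex \<Rightarrow> complex"
  assumes G: "line_holo_on G V" and F: "line_holo_on F V" and \<rho>: "line_holo_on \<rho> R"
    and V: "(q, 0) \<in> V" "V \<subseteq> closure {y \<in> V. G y \<noteq> 0}"
    and N: "open N" "q \<in> N" "\<epsilon> > 0" "N \<times> (ball 0 \<epsilon> - {0}) \<subseteq> R"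
    and eq: "\<And>y. y \<in> V \<Longrightarrow> y \<in> R \<Longrightarrow> G y \<noteq> 0 \<Longrightarrow> \<rho> y = F y / G y"
  shows "not_essential (\<lambda>z. \<rho> (q, z)) 0"
proof -
  \<comment> \<open>Both sides are continuous, so by density the product identity survives at the
    zeros of G, where the quotient says nothing.\<close>
  have prod: "F y = G y * \<rho> y" if "y \<in> V" "y \<in> R" for y
  proof -
    have "line_holo_on (\<lambda>y. F y - G y * \<rho> y) (V \<inter> R)"
      by (intro line_holo_on_diff line_holo_on_mult line_holo_on_subset[OF G] line_holo_on_subset[OF F]
           line_holo_on_subset[OF \<rho>] open_Int line_holo_onD(1)[OF G] line_holo_onD(1)[OF \<rho>]) auto
    from line_holo_on_eq_dense[OF this, of "{y \<in> V. G y \<noteq> 0}" y] show ?thesis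
      using V that eq by auto
  qed
  have "open (V \<inter> N \<times> ball 0 \<epsilon>)"
    using N line_holo_onD(1)[OF G] by (intro open_Int open_Times) auto
  then obtain \<delta> where \<delta>: "\<delta> > 0" "ball (q, 0) \<delta> \<subseteq> V \<inter> N \<times> ball 0 \<epsilon>"
    using V N by (meson IntI SigmaI centre_in_ball openE)
  \<comment> \<open>The thirds allow the line through (q, z) in direction q1 - q to run over |s| < 2
    with |z| < \<delta>/3 without leaving the ball of radius \<delta>. The parameter s = 1, where
    the line at height z1 meets (q1, z1), is interior to that disc.\<close>
  have "(q, 0) \<in> ball (q, 0) (\<delta>/3) \<inter> closure {y \<in> V. G y \<noteq> 0}"
    using \<delta> V by auto
  hence "ball (q, 0) (\<delta>/3) \<inter> {y \<in> V. G y \<noteq> 0} \<noteq> {}"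
    using open_Int_closure_eq_empty[OF open_ball, of "(q, 0)" "\<delta>/3" "{y \<in> V. G y \<noteq> 0}"] by blast
  then obtain q1 z1 where y1: "(q1, z1) \<in> ball (q, 0) (\<delta>/3)" "G (q1, z1) \<noteq> 0" by auto
  define a where "a = q1 - q"
  define v where "v = (a, 0 :: complex)"
  have a: "norm a < \<delta>/3" and z1: "norm z1 < \<delta>/3"
    using y1(1) dist_fst_le[of "(q1, z1)" "(q, 0)"] dist_snd_le[of "(q1, z1)" "(q, 0)"]
    unfolding mem_ball dist_commute[of "(q, 0)"] by (simp_all add: a_def flip: dist_norm)
  have line_eq: "(q, z) + sc_qz s v = (q + s *s a, z)" for s z
    by (simp add: prod_eq_iff v_def)
  have line: "(q, z) + sc_qz s v \<in> ball (q, 0) \<delta>" if "norm s < 2" "norm z < \<delta>/3" for s z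
  proof -
    have "norm (s *s a, z) \<le> norm s * norm a + norm z"
      using norm_Pair_le[of "s *s a" z] by (simp add: norm_vmult)
    also have "\<dots> < 2 * (\<delta>/3) + \<delta>/3"
      using that a by (intro add_le_less_mono mult_mono) auto
    finally have *: "norm (s *s a, z) < \<delta>" by simp
    have "(q, z) + sc_qz s v = (q, 0) + (s *s a, z)"
      by (simp add: prod_eq_iff v_def)
    moreover have "dist (q, 0) ((q, 0) + (s *s a, z)) = norm (s *s a, z)"
      by (rule dist_self_add)
    ultimately show ?thesis using * by (simp only: mem_ball)
  qed
  have lineV: "(q, z) + sc_qz s v \<in> V" if "s \<in> ball 0 2" "z \<in> ball 0 (\<delta>/3)" for s z
  proof -
    have "(q, z) + sc_qz s v \<in> ball (q, 0) \<delta>" using that by (intro line) simp_all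
    with \<delta>(2) show ?thesis by blast
  qed
  have lineR: "(q, z) + sc_qz s v \<in> R" if "s \<in> ball 0 2" "z \<in> ball 0 (\<delta>/3) - {0}" for s z
  proof -
    have "(q, z) + sc_qz s v \<in> ball (q, 0) \<delta>" using that by (intro line) simp_all
    with \<delta>(2) have "(q, z) + sc_qz s v \<in> N \<times> ball 0 \<epsilon>" by blast
    thus ?thesis using N(4) that unfolding line_eq by blast
  qed
  let ?D = "\<lambda>m. (ddir v ^^ m)"
  have hd: "(deriv ^^ m) (\<lambda>s. f ((q, z) + sc_qz s v)) 0 = ?D m f (q, z)"
    if "line_holo_on f S" "\<And>s. s \<in> ball 0 2 \<Longrightarrow> (q, z) + sc_qz s v \<in> S" for f S m z
    using higher_deriv_line[OF that(1), of "ball 0 2" "(q, z)" v 0 m] that(2) by simp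
  \<comment> \<open>Otherwise all derivatives in s vanish at s = 0 on the line at height z1, and the
    identity theorem forces G to vanish at s = 1, that is at (q1, z1).\<close>
  have "\<exists>m. \<exists>z\<in>ball 0 (\<delta>/3). ?D m G (q, z) \<noteq> 0"
  proof (rule ccontr)
    assume "\<not> ?thesis"
    hence "(deriv ^^ m) (\<lambda>s. G ((q, z1) + sc_qz s v)) 0 = 0" for m
      using hd[OF G lineV[of _ z1]] z1 by auto
    hence "G ((q, z1) + sc_qz 1 v) = 0"
      using z1 by (intro holomorphic_fun_eq_0_on_connected[where S = "ball 0 2" and z = 0 and f = "\<lambda>s. G ((q, z1) + sc_qz s v)"]
         line_holo_on_holomorphic[OF G] lineV) auto
    moreover have "(q, z1) + sc_qz 1 v = (q1, z1)" by (simp add: v_def a_def prod_eq_iff)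
    ultimately show False using y1 by simp
  qed
  \<comment> \<open>Minimality makes the lower derivatives vanish at every height z of the disc, not
    at one z only; this removes the other terms of the product rule for all z.\<close>
  then obtain m where m: "\<exists>z\<in>ball 0 (\<delta>/3). ?D m G (q, z) \<noteq> 0"
    and min: "\<And>j. j < m \<Longrightarrow> \<not> (\<exists>z\<in>ball 0 (\<delta>/3). ?D j G (q, z) \<noteq> 0)"
    using exists_least_iff[of "\<lambda>m. \<exists>z\<in>ball 0 (\<delta>/3). ?D m G (q, z) \<noteq> 0"] by blast
  have key: "?D m F (q, z) = ?D m G (q, z) * \<rho> (q, z)" if z: "z \<in> ball 0 (\<delta>/3) - {0}" for z
  proof -
    let ?l = "\<lambda>s. (q, z) + sc_qz s v"
    have "?D m F (q, z) = (deriv ^^ m) (\<lambda>s. F (?l s)) 0"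
      using hd[OF F lineV] z by simp
    also have "\<dots> = (deriv ^^ m) (\<lambda>s. G (?l s) * \<rho> (?l s)) 0"
    proof (rule higher_deriv_cong_ev)
      have "eventually (\<lambda>s. s \<in> ball 0 (2::real)) (nhds (0::complex))"
        by (intro eventually_nhds_in_open) auto
      thus "\<forall>\<^sub>F s in nhds 0. F (?l s) = G (?l s) * \<rho> (?l s)"
        by eventually_elim (use z lineV lineR prod in auto)
    qed simp
    also have "\<dots> = (\<Sum>i = 0..m. of_nat (m choose i) * (deriv ^^ i) (\<lambda>s. G (?l s)) 0 *
         (deriv ^^ (m - i)) (\<lambda>s. \<rho> (?l s)) 0)"
      using z by (intro higher_deriv_mult[where S = "ball 0 2"] line_holo_on_holomorphic[OF G] line_holo_on_holomorphic[OF \<rho>] lineV lineR) auto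
    also have "\<dots> = (\<Sum>i = 0..m. of_nat (m choose i) * ?D i G (q, z) * ?D (m - i) \<rho> (q, z))"
      using hd[OF G lineV, of z] hd[OF \<rho> lineR, of z] z by (intro sum.cong refl) simp
    also have "\<dots> = (\<Sum>i\<in>{m}. of_nat (m choose i) * ?D i G (q, z) * ?D (m - i) \<rho> (q, z))"
      using min z by (intro sum.mono_neutral_right) auto
    finally show ?thesis by simp
  qed
  have hol: "(\<lambda>z. ?D m f (q, z)) holomorphic_on ball 0 (\<delta>/3)" if "line_holo_on f V" for f
  proof -
    have "(\<lambda>z. ?D m f ((q, 0) + sc_qz z (0, 1))) holomorphic_on ball 0 (\<delta>/3)"
    proof (rule line_holo_on_holomorphic)
      show "line_holo_on (?D m f) V"
        by (induction m) (auto intro: that line_holo_on_ddir)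
    qed (use lineV[of 0] in \<open>auto simp: prod_eq_iff sc_qz_def\<close>)
    thus ?thesis by (simp add: sc_qz_def)
  qed
  obtain z0 where z0: "z0 \<in> ball 0 (\<delta>/3)" "?D m G (q, z0) \<noteq> 0" using m by blast
  \<comment> \<open>The m-th derivative of G is holomorphic in z on the whole disc and not
    identically zero, so it has no zeros close to 0 except possibly 0 itself. Off 0, \<rho> is thus
    a quotient of two functions holomorphic at 0.\<close>
  have "eventually (\<lambda>z. ?D m G (q, z) \<noteq> 0 \<and> z \<in> ball 0 (\<delta>/3)) (at 0)"
    using hol[OF G] z0 \<delta> by (intro non_zero_neighbour_alt[where \<beta> = z0]) auto
  moreover have "eventually (\<lambda>z. z \<noteq> (0::complex)) (at 0)"
    by (simp add: eventually_at_filter)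
  ultimately have ev: "eventually (\<lambda>z. ?D m F (q, z) / ?D m G (q, z) = \<rho> (q, z)) (at 0)"
    by eventually_elim (use key in auto)
  have 0: "(0::complex) \<in> ball 0 (\<delta>/3)" using \<delta> by simp
  show ?thesis
    by (rule not_essential_transform[OF not_essential_divide ev])
      (use hol[OF F] hol[OF G] 0 in \<open>auto intro!: not_essential_holomorphic[where A = "ball 0 (\<delta>/3)"]
         isolated_singularity_at_holomorphic[where s = "ball 0 (\<delta>/3)"] intro: holomorphic_on_subset\<close>)
qed

section \<open>Regular points of \<open>r\<close> and its singularity at 0 on slices\<close>

abbreviation rfun :: "('l::finite, 'n::finite) rmat \<Rightarrow> 'n \<Rightarrow> 'n \<Rightarrow> (complex^'l) \<times> complex \<Rightarrow> complex" where
  "rfun r a b \<equiv> (\<lambda>y. r (fst y) (snd y) $ a $ b)"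

lemma open_regular_points: "open (regular_points r)"
  unfolding regular_points_def
proof (rule open_Union, rule ballI)
  fix V assume "V \<in> {V. \<forall>a b. holo_on sc_qz (rfun r a b) V}"
  hence "holo_on sc_qz (rfun r undefined undefined) V" by blast
  thus "open V" unfolding holo_on_def by (rule conjunct1)
qed

lemma holo_on_regular: "holo_on sc_qz (rfun r a b) (regular_points r)"
  unfolding holo_on_def
proof (intro conjI ballI open_regular_points)
  fix x assume "x \<in> regular_points r"
  then obtain V where "x \<in> V" "holo_on sc_qz (rfun r a b) V"
    unfolding regular_points_def by blast
  thus "\<exists>D. (rfun r a b has_derivative D) (at x) \<and> (\<forall>c v. D (sc_qz c v) = c * D v)"
    unfolding holo_on_def by blast
qed

lemmas line_holo_on_regular = holo_on_imp_line_holo_on[OF holo_on_regular]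

lemma dir_deriv_eq_ddir: "dir_deriv a r q z $ b $ c = ddir (a, 0) (rfun r b c) (q, z)"
  by (simp add: dir_deriv_def ddir_def)

text \<open>Where G is nonzero the quotient F/G is holomorphic, and such points are dense near every
  point. Density later replaces regularity of (q, -z) in the Yang-Baxter equation.\<close>

lemma regular_points_dense:
  assumes "meromorphic_r r"
  shows "closure (regular_points r) = UNIV"
proof -
  have "x \<in> closure (regular_points r)" for x
  proof -
    obtain V F G where V: "x \<in> V" "holo_on sc_qz G V" "V \<subseteq> closure {y \<in> V. G y \<noteq> 0}"
      "\<forall>a b. holo_on sc_qz (\<lambda>y. F y $ a $ b) V \<and>
               (\<forall>y\<in>V. G y \<noteq> 0 \<longrightarrow> r (fst y) (snd y) $ a $ b = F y $ a $ b / G y)"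
      using assms[unfolded meromorphic_r_def, THEN spec, of x] by (elim exE conjE) (rule that)
    let ?U = "{y \<in> V. G y \<noteq> 0}"
    have oU: "open ?U"
    proof -
      have "open (V \<inter> G -` (- {0}))"
        using line_holo_onD[OF holo_on_imp_line_holo_on[OF V(2)]] by (intro continuous_open_preimage) auto
      also have "V \<inter> G -` (- {0}) = ?U" by auto
      finally show ?thesis .
    qed
    have "holo_on sc_qz (rfun r a b) ?U" for a b
      unfolding holo_on_def
    proof (intro conjI oU ballI)
      fix y assume y: "y \<in> ?U"
      have "holo_on sc_qz (\<lambda>y. F y $ a $ b) V" using V(4) by blast
      then obtain D where D: "((\<lambda>y. F y $ a $ b) has_derivative D) (at y)" "\<forall>c v. D (sc_qz c v) = c * D v"
        using y unfolding holo_on_def by blast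
      obtain E where E: "(G has_derivative E) (at y)" "\<forall>c v. E (sc_qz c v) = c * E v"
        using y V(2) unfolding holo_on_def by blast
      have "((\<lambda>y. F y $ a $ b / G y) has_derivative
          (\<lambda>h. (D h * G y - F y $ a $ b * E h) / (G y * G y))) (at y)"
        using y by (intro has_derivative_divide'[OF D(1) E(1)]) simp
      hence "(rfun r a b has_derivative (\<lambda>h. (D h * G y - F y $ a $ b * E h) / (G y * G y))) (at y)"
        by (rule has_derivative_transform_within_open[OF _ oU y]) (use V(4) in auto)
      thus "\<exists>D. (rfun r a b has_derivative D) (at y) \<and> (\<forall>c v. D (sc_qz c v) = c * D v)"
      proof (intro exI[of _ "\<lambda>h. (D h * G y - F y $ a $ b * E h) / (G y * G y)"] conjI allI)
        show "(D (sc_qz c v) * G y - F y $ a $ b * E (sc_qz c v)) / (G y * G y) =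
            c * ((D v * G y - F y $ a $ b * E v) / (G y * G y))" for c v
          by (simp add: D(2)[rule_format] E(2)[rule_format] right_diff_distrib mult.assoc mult.left_commute del: split_paired_All)
      qed
    qed
    hence "?U \<subseteq> regular_points r" unfolding regular_points_def by blast
    hence "closure ?U \<subseteq> closure (regular_points r)" by (rule closure_mono)
    thus ?thesis using V(1,3) by (meson subsetD)
  qed
  thus ?thesis by auto
qed

text \<open>For the derivative the slice lemma is applied anew, with G^2 as denominator and the
  numerator of the quotient rule: the pole of a q-derivative is not controlled by the pole of r on
  the slice through q alone.\<close>

lemma
  fixes r :: "('l::finite, 'n::finite) rmat"
  assumes r: "meromorphic_r r" and q: "q \<in> q_domain r"
  shows not_essential_r: "not_essential (\<lambda>z. r q z $ a $ b) 0"
    and not_essential_dir_deriv: "not_essential (\<lambda>z. dir_deriv d r q z $ a $ b) 0"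
proof -
  obtain V F G where V: "(q, 0) \<in> V" "holo_on sc_qz G V" "V \<subseteq> closure {y \<in> V. G y \<noteq> 0}"
    "\<forall>a b. holo_on sc_qz (\<lambda>y. F y $ a $ b) V \<and>
               (\<forall>y\<in>V. G y \<noteq> 0 \<longrightarrow> r (fst y) (snd y) $ a $ b = F y $ a $ b / G y)"
    using r[unfolded meromorphic_r_def, THEN spec, of "(q, 0)"] by (elim exE conjE) (rule that)
  let ?R = "regular_points r" and ?F = "\<lambda>y. F y $ a $ b" and ?\<rho> = "rfun r a b" and ?v = "(d, 0)"
  have G: "line_holo_on G V" using V(2) by (rule holo_on_imp_line_holo_on)
  have F: "line_holo_on ?F V" using V(4) by (intro holo_on_imp_line_holo_on) auto
  have eq: "?\<rho> y = ?F y / G y" if "y \<in> V" "G y \<noteq> 0" for y using V(4) that by auto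
  obtain N \<epsilon> where N: "open N" "q \<in> N" "\<epsilon> > 0" "N \<times> (ball 0 \<epsilon> - {0}) \<subseteq> ?R"
    using q unfolding q_domain_def by blast
  show "not_essential (\<lambda>z. r q z $ a $ b) 0"
    using not_essential_slice[OF G F line_holo_on_regular V(1,3) N] eq by auto
  have "not_essential (\<lambda>z. ddir ?v ?\<rho> (q, z)) 0"
  proof (rule not_essential_slice[OF _ _ line_holo_on_ddir[OF line_holo_on_regular] V(1) _ N])
    show "line_holo_on (\<lambda>y. G y * G y) V" by (intro line_holo_on_mult G)
    show "line_holo_on (\<lambda>y. ddir ?v ?F y * G y - ?F y * ddir ?v G y) V"
      by (intro line_holo_on_mult line_holo_on_diff line_holo_on_ddir G F)
    show "V \<subseteq> closure {y \<in> V. G y * G y \<noteq> 0}" using V(3) by simp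
    fix y assume y: "y \<in> V" "y \<in> ?R" "G y * G y \<noteq> 0"
    have der: "((\<lambda>s. f (y + sc_qz s ?v)) has_field_derivative ddir ?v f y) (at 0)" if "line_holo_on f S" "y \<in> S" for f S
      using line_holo_on_has_derivative[OF that(1), of y 0 ?v] that(2) by simp
    have "((\<lambda>s. ?F (y + sc_qz s ?v) / G (y + sc_qz s ?v)) has_field_derivative
       (ddir ?v ?F y * G y - ?F y * ddir ?v G y) / (G y * G y)) (at 0)"
      using DERIV_divide[OF der[OF F y(1)] der[OF G y(1)]] y by simp
    \<comment> \<open>The quotient rule gives the derivative of F/G. That this is also the
      derivative of r needs r = F/G on a piece of the line through y, not only at y.\<close>
    moreover have "eventually (\<lambda>s. ?F (y + sc_qz s ?v) / G (y + sc_qz s ?v) = ?\<rho> (y + sc_qz s ?v)) (nhds 0)"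
    proof -
      have "open (V \<inter> G -` (- {0}))"
        using line_holo_onD[OF G] by (intro continuous_open_preimage) auto
      moreover have "y \<in> V \<inter> G -` (- {0})" using y by auto
      ultimately obtain M \<delta> where M: "y \<in> M" "\<delta> > 0"
        "\<And>x s. x \<in> M \<Longrightarrow> norm s \<le> \<delta> \<Longrightarrow> x + sc_qz s ?v \<in> V \<inter> G -` (- {0})"
        by (rule open_line_ball[of _ _ ?v]) blast
      have "eventually (\<lambda>s. s \<in> ball 0 \<delta>) (nhds (0::complex))"
        using M by (intro eventually_nhds_in_open) auto
      thus ?thesis
      proof eventually_elim
        case (elim s)
        hence "y + sc_qz s ?v \<in> V \<inter> G -` (- {0})" using M(1) by (intro M(3)) auto
        thus ?case using eq[of "y + sc_qz s ?v"] by simp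
      qed
    qed
    ultimately have "((\<lambda>s. ?\<rho> (y + sc_qz s ?v)) has_field_derivative
       (ddir ?v ?F y * G y - ?F y * ddir ?v G y) / (G y * G y)) (at 0)"
      by (subst (asm) DERIV_cong_ev[OF refl _ refl]) auto
    thus "ddir ?v ?\<rho> y = (ddir ?v ?F y * G y - ?F y * ddir ?v G y) / (G y * G y)"
      unfolding ddir_def[of _ "?\<rho>"] by (rule DERIV_imp_deriv)
  qed
  thus "not_essential (\<lambda>z. dir_deriv d r q z $ a $ b) 0"
    by (simp add: dir_deriv_eq_ddir)
qed

section \<open>The dynamical Yang-Baxter equation\<close>

lemma tendsto_br:
  assumes lie: "lie_algebra br"
    and "\<And>i. ((\<lambda>n. f n $ i) \<longlongrightarrow> x $ i) F" "\<And>i. ((\<lambda>n. g n $ i) \<longlongrightarrow> y $ i) F"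
  shows "((\<lambda>n. br (f n) (g n) $ c) \<longlongrightarrow> br x y $ c) F"
proof -
  have *: "br u v $ c = (\<Sum>a\<in>UNIV. \<Sum>b\<in>UNIV. u $ a * v $ b * br (bv a) (bv b) $ c)" for u v
    by (subst br_expand[OF lie]) simp
  have "(\<lambda>n. br (f n) (g n) $ c) = (\<lambda>n. \<Sum>a\<in>UNIV. \<Sum>b\<in>UNIV. f n $ a * g n $ b * br (bv a) (bv b) $ c)"
    by (intro ext *)
  thus ?thesis unfolding *[of x y] by (simp only:) (intro tendsto_sum tendsto_mult tendsto_const assms(2,3))
qed

lemma L_at_nth: "L_at h r (q, p, \<xi>) z $ a = (\<Sum>i\<in>UNIV. p $ i * h i $ a) + (\<Sum>b\<in>UNIV. r q z $ a $ b * \<xi> $ b)"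
  by (simp add: L_at_def rminus_def matrix_vector_mult_def)

lemma dir_deriv_has_derivative:
  assumes "(q + s *s d, z) \<in> regular_points r"
  shows "((\<lambda>s. r (q + s *s d) z $ a $ b) has_field_derivative dir_deriv d r (q + s *s d) z $ a $ b) (at s)"
  using line_holo_on_has_derivative[OF line_holo_on_regular, of "(q, z)" s "(d, 0)" r a b] assms
  by (simp add: dir_deriv_eq_ddir sc_qz_def)

lemma isCont_r:
  assumes "y \<in> regular_points r"
  shows "isCont (\<lambda>y. r (fst y) (snd y) $ a $ b) y"
    and "isCont (\<lambda>y. dir_deriv d r (fst y) (snd y) $ a $ b) y"
  using line_holo_onD(2)[OF line_holo_on_regular[of r a b]]
        continuous_on_ddir[OF line_holo_on_regular[of r a b], of "(d, 0)"]
        assms open_regular_points[of r]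
  by (simp_all add: continuous_on_eq_continuous_at dir_deriv_eq_ddir)

text \<open>Linearity in d comes from the total derivative. It expresses the derivative along
  \<open>istar h \<xi>\<close> by the coordinate derivatives that occur in the Yang-Baxter
  equation.\<close>

lemma dir_deriv_linear:
  assumes "(q, z) \<in> regular_points r"
  shows "dir_deriv d r q z $ a $ b = (\<Sum>i\<in>UNIV. d $ i * dir_deriv (bv i) r q z $ a $ b)"
proof -
  obtain D where D: "(rfun r a b has_derivative D) (at (q, z))" "\<forall>c v. D (sc_qz c v) = c * D v"
      "\<forall>v. ((\<lambda>s. rfun r a b ((q, z) + sc_qz s v)) has_field_derivative D v) (at 0)"
    using holo_on_ddir[OF holo_on_regular assms, of a b] by (elim exE conjE) (rule that)
  have D': "dir_deriv v r q z $ a $ b = D (v, 0)" for v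
    unfolding dir_deriv_eq_ddir ddir_def using D(3) by (intro DERIV_imp_deriv) (rule spec)
  have lin: "linear D" using D(1) by (rule has_derivative_linear)
  have "(d, 0) = (\<Sum>i\<in>UNIV. sc_qz (d $ i) (bv i, 0 :: complex))"
    by (simp add: prod_eq_iff fst_sum snd_sum basis_expansion)
  hence "D (d, 0) = (\<Sum>i\<in>UNIV. d $ i * D (bv i, 0))"
    using D(2) by (simp add: linear_sum[OF lin] del: split_paired_All)
  thus ?thesis by (simp add: D')
qed

lemma L_at_has_derivative_q:
  assumes "(q + s *s d, z) \<in> regular_points r"
  shows "((\<lambda>s. L_at h r (q + s *s d, p, \<xi>) z $ a) has_field_derivative
     (\<Sum>b\<in>UNIV. dir_deriv d r (q + s *s d) z $ a $ b * \<xi> $ b)) (at s)"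
  unfolding L_at_nth
  by (rule derivative_eq_intros refl dir_deriv_has_derivative[OF assms])+ simp

lemma L_at_has_derivative_p:
  "((\<lambda>s. L_at h r (q, p + s *s d, \<xi>) z $ a) has_field_derivative (\<Sum>i\<in>UNIV. d $ i * h i $ a)) (at s)"
  unfolding L_at_nth by (rule derivative_eq_intros refl | simp)+

lemma L_at_has_derivative_xi:
  "((\<lambda>s. L_at h r (q, p, \<xi> + s *s d) z $ a) has_field_derivative (\<Sum>b\<in>UNIV. r q z $ a $ b * d $ b)) (at s)"
  unfolding L_at_nth by (rule derivative_eq_intros refl | simp add: mult.commute)+

lemma bv_mult_sum: "(\<Sum>i\<in>UNIV. bv j $ i * f i) = (f j :: complex)" "(\<Sum>i\<in>UNIV. f i * bv j $ i) = (f j :: complex)"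
  by (simp_all add: bv_nth if_distrib if_distribR cong: if_cong)

lemma grad_L_at:
  "grad_p (\<lambda>x. L_at h r x z $ a) (q, p, \<xi>) $ i = h i $ a"
  "grad_xi (\<lambda>x. L_at h r x z $ a) (q, p, \<xi>) = r q z $ a"
  "(q, z) \<in> regular_points r \<Longrightarrow>
     grad_q (\<lambda>x. L_at h r x z $ a) (q, p, \<xi>) $ i = (\<Sum>b\<in>UNIV. dir_deriv (bv i) r q z $ a $ b * \<xi> $ b)"
  using DERIV_imp_deriv[OF L_at_has_derivative_p[of h r q p "bv i" \<xi> z a 0]]
        DERIV_imp_deriv[OF L_at_has_derivative_xi[of h r q p \<xi> _ z a 0]]
        DERIV_imp_deriv[OF L_at_has_derivative_q[of q 0 "bv i" z r h p \<xi> a]]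
  by (simp_all add: grad_p_def grad_q_def grad_xi_def bv_mult_sum vec_eq_iff)

locale dynamical_r_matrix_on =
  fixes br :: "complex^'n \<Rightarrow> complex^'n \<Rightarrow> complex^'n" and H :: "(complex^'n) set"
    and h :: "'l::finite \<Rightarrow> complex^'n" and r :: "('l, 'n::finite) rmat"
  assumes simple: "simple_lie_algebra br"
    and ortho: "orthonormal_basis br H h"
    and dyn: "dynamical_r_matrix br H h r"
begin

lemma lie: "lie_algebra br"
  using simple by (simp add: simple_lie_algebra_def)

lemma meromorphic: "meromorphic_r r"
  using dyn by (simp add: dynamical_r_matrix_def)

lemma h_in_H: "h i \<in> H"
  using ortho by (auto simp: orthonormal_basis_def intro: vec.span_base)

lemma zero_weight:
  assumes "(q, z) \<in> regular_points r"
  shows "br (column b (r q z)) (h i) $ a + br (r q z $ a) (h i) $ b = 0"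
proof -
  have "comm1 br (r q z) (h i) + comm2 br (r q z) (h i) = 0"
    using dyn h_in_H[of i] assms unfolding dynamical_r_matrix_def by blast
  hence "(comm1 br (r q z) (h i) + comm2 br (r q z) (h i)) $ a $ b = 0" by simp
  thus ?thesis by (simp add: comm1_nth[OF lie] comm2_nth[OF lie])
qed

lemma unitarity:
  assumes "(q, z) \<in> regular_points r" "(q, - z) \<in> regular_points r"
  shows "r q (- z) $ a $ b = - r q z $ b $ a"
proof -
  have "r q z + transpose (r q (- z)) = 0"
    using dyn assms unfolding dynamical_r_matrix_def by blast
  hence "(r q z + transpose (r q (- z))) $ b $ a = 0" by simp
  thus ?thesis by (simp add: transpose_def eq_neg_iff_add_eq_0 add.commute)
qed

text \<open>Regular points form an open set, so unitarity holds on a piece of the line q + s d and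
  can be differentiated there.\<close>

lemma dir_deriv_unitarity:
  assumes "(q, z) \<in> regular_points r" "(q, - z) \<in> regular_points r"
  shows "dir_deriv d r q (- z) $ a $ b = - dir_deriv d r q z $ b $ a"
proof -
  have ev: "eventually (\<lambda>s. (q + s *s d, u) \<in> regular_points r) (nhds 0)" if u: "(q, u) \<in> regular_points r" for u
  proof -
    obtain N \<delta> where N: "(q, u) \<in> N" "\<delta> > 0"
        "\<And>x s. x \<in> N \<Longrightarrow> norm s \<le> \<delta> \<Longrightarrow> x + sc_qz s (d, 0) \<in> regular_points r"
      by (rule open_line_ball[OF open_regular_points u, of "(d, 0)"]) blast
    have "eventually (\<lambda>s. s \<in> ball 0 \<delta>) (nhds (0::complex))"
      using N by (intro eventually_nhds_in_open) auto
    thus ?thesis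
      by eventually_elim (use N(3)[OF N(1)] in \<open>auto simp: sc_qz_def\<close>)
  qed
  have "eventually (\<lambda>s. r (q + s *s d) (- z) $ a $ b = - r (q + s *s d) z $ b $ a) (nhds 0)"
    using ev[OF assms(1)] ev[OF assms(2)] by eventually_elim (rule unitarity)
  moreover have "((\<lambda>s. - r (q + s *s d) z $ b $ a) has_field_derivative - dir_deriv d r q z $ b $ a) (at 0)"
    using dir_deriv_has_derivative[of q 0 d z r b a] assms(1) by (intro DERIV_minus) simp
  ultimately have "((\<lambda>s. r (q + s *s d) (- z) $ a $ b) has_field_derivative - dir_deriv d r q z $ b $ a) (at 0)"
    by (subst DERIV_cong_ev[OF refl _ refl]) auto
  thus ?thesis by (simp add: dir_deriv_def DERIV_imp_deriv)
qed

text \<open>The coefficient at (a, b, c) of the equation for (z1, z2, z3) = (z, w, 0); setting z3 =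
  0 is no restriction because only differences occur.\<close>

definition cdybe_lhs :: "complex^'l \<Rightarrow> complex \<Rightarrow> complex \<Rightarrow> 'n \<Rightarrow> 'n \<Rightarrow> 'n \<Rightarrow> complex" where
  "cdybe_lhs q z w a b c =
     (\<Sum>i\<in>UNIV. h i $ a * dir_deriv (bv i) r q w $ b $ c - h i $ b * dir_deriv (bv i) r q z $ a $ c
        + h i $ c * dir_deriv (bv i) r q (z - w) $ a $ b)
     + br (column b (r q (z - w))) (column c (r q z)) $ a
     + br (r q (z - w) $ a) (column c (r q w)) $ b
     + br (r q z $ a) (r q w $ b) $ c"

lemma cdybe_generic:
  assumes "(q, z) \<in> regular_points r" "(q, w) \<in> regular_points r" "(q, z - w) \<in> regular_points r"
    "(q, - z) \<in> regular_points r"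
  shows "cdybe_lhs q z w a b c = 0"
proof -
  have "\<forall>q z1 z2 z3.
        (q, z1 - z2) \<in> regular_points r \<longrightarrow> (q, z1 - z3) \<in> regular_points r \<longrightarrow>
        (q, z2 - z3) \<in> regular_points r \<longrightarrow> (q, z3 - z1) \<in> regular_points r \<longrightarrow>
        alt_dr h r q z1 z2 z3
          + comm_12_13 br (r q (z1 - z2)) (r q (z1 - z3))
          + comm_12_23 br (r q (z1 - z2)) (r q (z2 - z3))
          + comm_13_23 br (r q (z1 - z3)) (r q (z2 - z3)) = 0"
    using dyn unfolding dynamical_r_matrix_def by blast
  from this[rule_format, of q z w 0] assms
  have "(alt_dr h r q z w 0 + comm_12_13 br (r q (z - w)) (r q z) + comm_12_23 br (r q (z - w)) (r q w)
     + comm_13_23 br (r q z) (r q w)) $ a $ b $ c = 0" by simp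
  thus ?thesis
    by (simp add: cdybe_lhs_def alt_dr_def put_nth comm_12_13_nth[OF lie] comm_12_23_nth[OF lie]
       comm_13_23_nth[OF lie] dir_deriv_unitarity[OF assms(1,4)])
qed

text \<open>
  The term with spectral parameter \<open>z\<^sub>3 - z\<^sub>1 = - z\<close> has been rewritten by unitarity. At a point where
  \<open>(q, - z)\<close> is not regular, although \<open>(q, z)\<close> is, the value \<open>r q (- z)\<close> is immaterial, and the equation
  follows by continuity from nearby points.
\<close>

lemma cdybe:
  assumes "(q, z) \<in> regular_points r" "(q, w) \<in> regular_points r" "(q, z - w) \<in> regular_points r"
  shows "cdybe_lhs q z w a b c = 0"
proof -
  \<comment> \<open>Density holds only in all variables jointly, so q varies along the approximating
    sequence as well. The number w stays fixed, and the three assumed regularities persist for large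
    n because the regular set is open.\<close>
  have "(q, - z) \<in> closure (regular_points r)"
    using regular_points_dense[OF meromorphic] by simp
  then obtain y where y: "\<And>n. y n \<in> regular_points r" "y \<longlonglongrightarrow> (q, - z)"
    unfolding closure_sequential by blast
  let ?q = "\<lambda>n. fst (y n)" and ?z = "\<lambda>n. - snd (y n)"
  have lim: "?q \<longlonglongrightarrow> q" "?z \<longlonglongrightarrow> z"
    using tendsto_fst[OF y(2)] tendsto_minus[OF tendsto_snd[OF y(2)]] by simp_all
  have P: "(\<lambda>n. (?q n, ?z n)) \<longlonglongrightarrow> (q, z)" "(\<lambda>n. (?q n, w)) \<longlonglongrightarrow> (q, w)"
    "(\<lambda>n. (?q n, ?z n - w)) \<longlonglongrightarrow> (q, z - w)"
    by (intro tendsto_intros lim)+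
  have R: "(\<lambda>n. r (?q n) (v n) $ i $ j) \<longlonglongrightarrow> r q v' $ i $ j" 
       "(\<lambda>n. dir_deriv d r (?q n) (v n) $ i $ j) \<longlonglongrightarrow> dir_deriv d r q v' $ i $ j"
    if "(\<lambda>n. (?q n, v n)) \<longlonglongrightarrow> (q, v')" "(q, v') \<in> regular_points r" for v v' i j d
    using isCont_tendsto_compose[OF isCont_r(1)[OF that(2)] that(1)]
      isCont_tendsto_compose[OF isCont_r(2)[OF that(2)] that(1)] by simp_all
  note R' = R[OF P(1) assms(1)] R[OF P(2) assms(2)] R[OF P(3) assms(3)]
  have "(\<lambda>n. cdybe_lhs (?q n) (?z n) w a b c) \<longlonglongrightarrow> cdybe_lhs q z w a b c"
    unfolding cdybe_lhs_def
    by (intro tendsto_add tendsto_sum tendsto_diff tendsto_mult tendsto_const R' tendsto_br[OF lie])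
       (simp_all add: column_def R')
  moreover have "eventually (\<lambda>n. cdybe_lhs (?q n) (?z n) w a b c = 0) sequentially"
    using topological_tendstoD[OF P(1) open_regular_points assms(1)]
      topological_tendstoD[OF P(2) open_regular_points assms(2)]
      topological_tendstoD[OF P(3) open_regular_points assms(3)]
    by eventually_elim (use y(1) in \<open>auto intro!: cdybe_generic\<close>)
  ultimately show ?thesis
    by (rule LIMSEQ_unique[OF _ tendsto_eventually])
qed

text \<open>The Poisson bracket produces the derivative terms with some h i in the first or second
  leg and the bracket of rows of r(z) and r(w). The Yang-Baxter equation trades them for the three
  terms that contain r(z - w), which make up the right-hand side.\<close>

lemma poisson_L_at:
  assumes z: "(q, z) \<in> regular_points r" and w: "(q, w) \<in> regular_points r"
    and zw: "(q, z - w) \<in> regular_points r"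
  shows "poisson br (\<lambda>x. L_at h r x z $ a) (\<lambda>x. L_at h r x w $ b) (q, p, \<xi>) =
     - (br (column b (r q (z - w))) (L_at h r (q, p, \<xi>) z) $ a + br (r q (z - w) $ a) (L_at h r (q, p, \<xi>) w) $ b)
     - dir_deriv (istar h \<xi>) r q (z - w) $ a $ b"
proof -
  let ?R = "r q (z - w)" and ?dd = "\<lambda>i. dir_deriv (bv i) r q"
  define P where "P = (\<Sum>i\<in>UNIV. p $ i *s h i)"
  have col: "r q u *v \<xi> = (\<Sum>c\<in>UNIV. \<xi> $ c *s column c (r q u))" for u
    by (rule matrix_mult_sum)
  have L: "L_at h r (q, p, \<xi>) u = P + (\<Sum>c\<in>UNIV. \<xi> $ c *s column c (r q u))" for u
    by (simp add: L_at_def P_def rminus_def col)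
  \<comment> \<open>The p part of L is the same element of H at z and at w, so by the zero weight
    condition its two contributions cancel.\<close>
  have P0: "br (column b ?R) P $ a + br (?R $ a) P $ b = 0"
    using zero_weight[OF zw, of b _ a]
    by (simp add: P_def br_sum[OF lie] br_smult[OF lie] flip: sum.distrib distrib_left)
  have X: "dir_deriv (istar h \<xi>) r q (z - w) $ a $ b = (\<Sum>c\<in>UNIV. \<xi> $ c * (\<Sum>i\<in>UNIV. h i $ c * ?dd i (z - w) $ a $ b))"
    by (subst dir_deriv_linear[OF zw], simp add: istar_def pair_def sum_distrib_left sum_distrib_right)
       (subst sum.swap, simp add: mult_ac)
  have "poisson br (\<lambda>x. L_at h r x z $ a) (\<lambda>x. L_at h r x w $ b) (q, p, \<xi>) =
      (\<Sum>c\<in>UNIV. \<xi> $ c * ((\<Sum>i\<in>UNIV. h i $ a * ?dd i w $ b $ c - h i $ b * ?dd i z $ a $ c) + br (r q z $ a) (r q w $ b) $ c))"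
    unfolding poisson_def
    by (simp add: grad_L_at z w pair_def sum.distrib distrib_left sum_distrib_left right_diff_distrib
          sum_subtractf mult_ac sum.swap[of _ "UNIV :: 'l set" "UNIV :: 'n set"])
  also have "\<dots> = (\<Sum>c\<in>UNIV. \<xi> $ c * - ((\<Sum>i\<in>UNIV. h i $ c * ?dd i (z - w) $ a $ b)
      + br (column b ?R) (column c (r q z)) $ a + br (?R $ a) (column c (r q w)) $ b))"
  proof (intro sum.cong refl arg_cong2[where f = "(*)"])
    fix c
    show "(\<Sum>i\<in>UNIV. h i $ a * ?dd i w $ b $ c - h i $ b * ?dd i z $ a $ c) + br (r q z $ a) (r q w $ b) $ c =
       - ((\<Sum>i\<in>UNIV. h i $ c * ?dd i (z - w) $ a $ b)
      + br (column b ?R) (column c (r q z)) $ a + br (?R $ a) (column c (r q w)) $ b)"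
      using cdybe[OF z w zw, of a b c] unfolding cdybe_lhs_def sum.distrib by (simp only: eq_neg_iff_add_eq_0 add_ac)
  qed
  also have "\<dots> = - (br (column b ?R) (L_at h r (q, p, \<xi>) z) $ a + br (?R $ a) (L_at h r (q, p, \<xi>) w) $ b)
     - dir_deriv (istar h \<xi>) r q (z - w) $ a $ b"
    unfolding L X mult_minus_right sum_negf distrib_left sum.distrib
    using P0[unfolded add_eq_0_iff] by (simp add: br_add[OF lie] br_sum[OF lie] br_smult[OF lie])
  finally show ?thesis .
qed

end

section \<open>The pole at the origin is simple\<close>

lemma r_holomorphic:
  assumes "\<And>z. z \<in> A \<Longrightarrow> (q, z) \<in> regular_points r"
  shows "(\<lambda>z. r q z $ a $ b) holomorphic_on A"
    and "(\<lambda>z. dir_deriv d r q z $ a $ b) holomorphic_on A"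
  using line_holo_on_holomorphic[OF line_holo_on_regular, of A "(q, 0)" "(0, 1)" r a b]
    line_holo_on_holomorphic[OF line_holo_on_ddir[OF line_holo_on_regular], of A "(q, 0)" "(0, 1)" r "(d, 0)" a b] assms
  by (simp_all add: sc_qz_def dir_deriv_eq_ddir)

lemma q_domain_ball:
  assumes "q \<in> q_domain r"
  obtains \<epsilon> where "\<epsilon> > 0" "\<And>z. z \<in> ball 0 \<epsilon> - {0} \<Longrightarrow> (q, z) \<in> regular_points r"
  using assms unfolding q_domain_def by blast

lemma
  fixes r :: "('l::finite, 'n::finite) rmat"
  assumes "meromorphic_r r" "q \<in> q_domain r"
  shows r_has_laurent_expansion:
      "(\<lambda>z. r q z $ a $ b) has_laurent_expansion laurent_expansion (\<lambda>z. r q z $ a $ b) 0"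
    and dir_deriv_has_laurent_expansion:
      "(\<lambda>z. dir_deriv d r q z $ a $ b) has_laurent_expansion laurent_expansion (\<lambda>z. dir_deriv d r q z $ a $ b) 0"
proof -
  obtain \<epsilon> where \<epsilon>: "\<epsilon> > 0" "\<And>z. z \<in> ball 0 \<epsilon> - {0} \<Longrightarrow> (q, z) \<in> regular_points r"
    using q_domain_ball[OF assms(2)] by blast
  show "(\<lambda>z. r q z $ a $ b) has_laurent_expansion laurent_expansion (\<lambda>z. r q z $ a $ b) 0"
    by (intro not_essential_has_laurent_expansion_0 not_essential_r assms
        isolated_singularity_at_holomorphic[where s = "ball 0 \<epsilon>"] r_holomorphic(1)) (use \<epsilon> in auto)
  show "(\<lambda>z. dir_deriv d r q z $ a $ b) has_laurent_expansion laurent_expansion (\<lambda>z. dir_deriv d r q z $ a $ b) 0"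
    by (intro not_essential_has_laurent_expansion_0 not_essential_dir_deriv assms
        isolated_singularity_at_holomorphic[where s = "ball 0 \<epsilon>"] r_holomorphic(2)) (use \<epsilon> in auto)
qed

definition pole_order_le :: "nat \<Rightarrow> (complex \<Rightarrow> complex) \<Rightarrow> bool" where
  "pole_order_le k f \<longleftrightarrow> (\<exists>F. f has_laurent_expansion F \<and> (\<forall>j < - int k. fls_nth F j = 0))"

lemma pole_order_le_mono: "pole_order_le k f \<Longrightarrow> k \<le> m \<Longrightarrow> pole_order_le m f"
  unfolding pole_order_le_def by force

lemma pole_order_le_exists:
  assumes "f has_laurent_expansion F"
  shows "pole_order_le (nat (- fls_subdegree F)) f"
  unfolding pole_order_le_def using assms by (intro exI[of _ F]) (auto intro: fls_eq0_below_subdegree)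

lemma pole_order_le_tendsto:
  assumes "f has_laurent_expansion F" "\<forall>j < - int k. fls_nth F j = 0"
  shows "((\<lambda>z. z ^ k * f z) \<longlongrightarrow> fls_nth F (- int k)) (at 0)"
proof -
  have "(\<lambda>z. f z * z powi int k) has_laurent_expansion fls_shift (- int k) F"
    using assms(1) by (rule has_laurent_expansion_shift)
  moreover have "fls_subdegree (fls_shift (- int k) F) \<ge> 0"
    using assms(2) by (intro fls_subdegree_ge0I) simp
  ultimately have "((\<lambda>z. f z * z powi int k) \<longlongrightarrow> fls_nth (fls_shift (- int k) F) 0) (at 0)"
    by (rule has_laurent_expansion_imp_tendsto_0)
  thus ?thesis by (simp add: mult.commute)
qed

lemma pole_order_le_reduce:
  assumes "pole_order_le (Suc k) f" "((\<lambda>z. z ^ Suc k * f z) \<longlongrightarrow> 0) (at 0)"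
  shows "pole_order_le k f"
proof -
  obtain F where F: "f has_laurent_expansion F" "\<forall>j < - int (Suc k). fls_nth F j = 0"
    using assms(1) unfolding pole_order_le_def by blast
  have 0: "fls_nth F (- int (Suc k)) = 0"
    using tendsto_unique[OF _ pole_order_le_tendsto[OF F] assms(2)] by simp
  have "fls_nth F j = 0" if "j < - int k" for j
  proof (cases "j = - int (Suc k)")
    case False
    thus ?thesis using F(2) that by auto
  qed (use 0 in simp)
  thus ?thesis using F(1) unfolding pole_order_le_def by blast
qed

text \<open>Serves the limits in which all spectral parameters shrink to 0 at a fixed ratio.\<close>

lemma tendsto_scaled_arg:
  assumes "((\<lambda>z. z ^ k * f z) \<longlongrightarrow> \<theta>) (at 0)" "c \<noteq> (0::complex)"
  shows "((\<lambda>t. t ^ k * f (c * t)) \<longlongrightarrow> \<theta> / c ^ k) (at 0)"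
proof -
  have "filterlim (\<lambda>t. c * t) (at 0) (at 0)"
    using assms(2) by (auto simp: filterlim_at eventually_at_filter intro!: tendsto_eq_intros)
  from filterlim_compose[OF assms(1) this] have "((\<lambda>t. (c * t) ^ k * f (c * t)) \<longlongrightarrow> \<theta>) (at 0)" .
  from tendsto_divide[OF this tendsto_const, of "c ^ k"] show ?thesis
    using assms(2) by (simp add: power_mult_distrib)
qed

lemma residue_sum:
  assumes "open S" "z \<in> S" "finite I" "\<And>i. i \<in> I \<Longrightarrow> f i holomorphic_on S - {z}"
  shows "residue (\<lambda>w. \<Sum>i\<in>I. f i w) z = (\<Sum>i\<in>I. residue (f i) z)"
  using assms(3,4)
proof (induction I rule: finite_induct)
  case (insert i I)
  have "residue (\<lambda>w. f i w + (\<Sum>i\<in>I. f i w)) z = residue (f i) z + residue (\<lambda>w. \<Sum>i\<in>I. f i w) z"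
    by (intro residue_add[OF assms(1,2)] holomorphic_on_sum insert) auto
  thus ?case using insert by simp
qed (simp add: residue_const)

lemma residue_br:
  assumes lie: "lie_algebra br" and S: "open S" "z \<in> S" "\<And>i. (\<lambda>w. f w $ i) holomorphic_on S - {z}"
  shows "residue (\<lambda>w. br u (f w) $ a) z = br u (\<chi> i. residue (\<lambda>w. f w $ i) z) $ a"
    and "(\<lambda>w. br u (f w) $ a) holomorphic_on S - {z}"
proof -
  have eq: "br u v $ a = (\<Sum>i\<in>UNIV. br u (bv i) $ a * v $ i)" for v
    by (subst br_expand_right[OF lie]) (simp add: mult.commute)
  have eq': "(\<lambda>w. br u (f w) $ a) = (\<lambda>w. \<Sum>i\<in>UNIV. br u (bv i) $ a * f w $ i)"
    by (intro ext eq)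
  show "(\<lambda>w. br u (f w) $ a) holomorphic_on S - {z}"
    unfolding eq' by (intro holomorphic_on_sum holomorphic_on_mult holomorphic_on_const S)
  have "residue (\<lambda>w. br u (f w) $ a) z = (\<Sum>i\<in>UNIV. residue (\<lambda>w. br u (bv i) $ a * f w $ i) z)"
    unfolding eq' by (intro residue_sum[OF S(1,2)] holomorphic_on_mult holomorphic_on_const S) auto
  also have "\<dots> = (\<Sum>i\<in>UNIV. br u (bv i) $ a * residue (\<lambda>w. f w $ i) z)"
    by (intro sum.cong refl residue_lmul[OF S(1,2)] S)
  also have "\<dots> = br u (\<chi> i. residue (\<lambda>w. f w $ i) z) $ a"
    by (subst (2) eq) simp
  finally show "residue (\<lambda>w. br u (f w) $ a) z = br u (\<chi> i. residue (\<lambda>w. f w $ i) z) $ a" .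
qed

text \<open>For k = 1 both sides equal 4, in accordance with the pole of order one that r does
  have.\<close>

lemma two_powers_less:
  assumes "k \<ge> 2"
  shows "2 * 2 ^ k < (3 ^ k + 1 :: nat)"
  using assms
proof (induction k rule: dec_induct)
  case (step k)
  thus ?case by simp
qed simp

context dynamical_r_matrix_on
begin

definition casimir :: "complex^'l \<Rightarrow> complex^'n^'n" where
  "casimir q = (\<chi> a b. residue (\<lambda>z. r q z $ a $ b) 0)"

lemma is_casimir_casimir: "q \<in> q_domain r \<Longrightarrow> is_casimir br (casimir q)"
  using dyn unfolding dynamical_r_matrix_def casimir_def by blast

text \<open>
  Here \<open>\<theta>\<close> and \<open>\<theta>' i\<close> are the coefficients of \<open>z\<^sup>-\<^sup>k\<close> in \<open>r(q, z)\<close> and in its derivatives. The limit \<open>z \<rightarrow> w\<close>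
  of the dynamical Yang-Baxter equation, followed by the residue in \<open>w\<close>, shows that \<open>\<theta>\<close> commutes with the
  coproduct of the Lie algebra. The limit where \<open>z\<close> and \<open>w\<close> tend to \<open>0\<close> with a fixed ratio shows that the rows
  of \<open>\<theta>\<close> commute if \<open>k \<ge> 2\<close>.
\<close>

lemma leading_coefficient_invariant:
  assumes q: "q \<in> q_domain r" and k: "k \<ge> 1"
    and \<theta>: "\<And>a b. ((\<lambda>z. z ^ k * r q z $ a $ b) \<longlongrightarrow> \<theta> $ a $ b) (at 0)"
    and \<theta>': "\<And>i a b. ((\<lambda>z. z ^ k * dir_deriv (bv i) r q z $ a $ b) \<longlongrightarrow> \<theta>' i $ a $ b) (at 0)"
  shows "br (column b \<theta>) x $ a = - br (\<theta> $ a) x $ b" and "\<theta>' i = 0"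
proof -
  obtain \<epsilon> where \<epsilon>: "\<epsilon> > 0" "\<And>z. z \<in> ball 0 \<epsilon> - {0} \<Longrightarrow> (q, z) \<in> regular_points r"
    using q_domain_ball[OF q] by blast
  \<comment> \<open>The equation is taken at (z, w) = (x + y, y), multiplied by x^k, and x tends to
    0: only the terms with r or its derivatives at z - w = x survive.\<close>
  have lim: "(\<Sum>i\<in>UNIV. h i $ c * \<theta>' i $ a $ b) + br (column b \<theta>) (column c (r q y)) $ a
       + br (\<theta> $ a) (column c (r q y)) $ b = 0" if y: "y \<in> ball 0 (\<epsilon>/2) - {0}" for y a b c
  proof -
    have yr: "(q, y) \<in> regular_points r" using y \<epsilon> by auto
    let ?e = "\<lambda>x. (\<Sum>i\<in>UNIV. h i $ a * (x ^ k * dir_deriv (bv i) r q y $ b $ c)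
        - h i $ b * (x ^ k * dir_deriv (bv i) r q (x + y) $ a $ c)
        + h i $ c * (x ^ k * dir_deriv (bv i) r q x $ a $ b))
     + br (x ^ k *s column b (r q x)) (column c (r q (x + y))) $ a
     + br (x ^ k *s r q x $ a) (column c (r q y)) $ b
     + x ^ k * br (r q (x + y) $ a) (r q y $ b) $ c"
    have e: "x ^ k * cdybe_lhs q (x + y) y a b c = ?e x" for x
      by (simp add: cdybe_lhs_def br_smult[OF lie] sum_distrib_left distrib_left right_diff_distrib mult_ac)
    have xk: "((\<lambda>x::complex. x ^ k) \<longlongrightarrow> 0) (at 0)"
      using k by (auto intro!: tendsto_eq_intros)
    have sh: "((\<lambda>x. (q, x + y)) \<longlongrightarrow> (q, y)) (at 0)"
      by (auto intro!: tendsto_eq_intros)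
    have r: "((\<lambda>x. r q (x + y) $ i $ j) \<longlongrightarrow> r q y $ i $ j) (at 0)"
        "((\<lambda>x. dir_deriv d r q (x + y) $ i $ j) \<longlongrightarrow> dir_deriv d r q y $ i $ j) (at 0)" for i j d
      using isCont_tendsto_compose[OF isCont_r(1)[OF yr] sh] isCont_tendsto_compose[OF isCont_r(2)[OF yr] sh]
      by simp_all
    have "(?e \<longlongrightarrow> (\<Sum>i\<in>UNIV. h i $ a * (0 * dir_deriv (bv i) r q y $ b $ c)
        - h i $ b * (0 * dir_deriv (bv i) r q y $ a $ c) + h i $ c * \<theta>' i $ a $ b)
        + br (column b \<theta>) (column c (r q y)) $ a + br (\<theta> $ a) (column c (r q y)) $ b
        + 0 * br (r q y $ a) (r q y $ b) $ c) (at 0)"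
      by (intro tendsto_add tendsto_sum tendsto_diff tendsto_mult tendsto_const r \<theta> \<theta>' xk tendsto_br[OF lie])
         (simp_all add: column_def r \<theta>)
    moreover have "eventually (\<lambda>x. ?e x = 0) (at 0)"
    proof -
      have "eventually (\<lambda>x. x \<in> ball 0 (\<epsilon>/2) - {-y} - {0}) (at (0::complex))"
        using y \<epsilon> by (intro eventually_at_in_open open_Diff) auto
      thus ?thesis
      proof eventually_elim
        case (elim x)
        have "norm (x + y) \<le> norm x + norm y" by (rule norm_triangle_ineq)
        hence "x + y \<in> ball 0 \<epsilon> - {0}" using elim y by (auto simp: eq_neg_iff_add_eq_0)
        moreover have "x \<in> ball 0 \<epsilon> - {0}" using elim \<epsilon> by auto
        ultimately have "cdybe_lhs q (x + y) y a b c = 0"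
          using yr \<epsilon>(2) by (intro cdybe) auto
        thus ?case unfolding e[symmetric] by simp
      qed
    qed
    ultimately have "(\<Sum>i\<in>UNIV. h i $ a * (0 * dir_deriv (bv i) r q y $ b $ c)
        - h i $ b * (0 * dir_deriv (bv i) r q y $ a $ c) + h i $ c * \<theta>' i $ a $ b)
        + br (column b \<theta>) (column c (r q y)) $ a + br (\<theta> $ a) (column c (r q y)) $ b
        + 0 * br (r q y $ a) (r q y $ b) $ c = 0"
      by (intro tendsto_unique[OF _ _ tendsto_eventually]) auto
    thus ?thesis by simp
  qed
  have inv: "br (column b \<theta>) x $ a = - br (\<theta> $ a) x $ b" for a b x
  proof -
    let ?S = "ball 0 (\<epsilon>/2) :: complex set"
    have S: "open ?S" "0 \<in> ?S" using \<epsilon> by auto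
    have hol: "(\<lambda>y. column c (r q y) $ i) holomorphic_on ?S - {0}" for c i
      using \<epsilon> by (simp add: column_def) (intro r_holomorphic(1), auto)
    have res: "(\<chi> i. residue (\<lambda>y. column c (r q y) $ i) 0) = column c (casimir q)" for c
      by (simp add: column_def casimir_def)
    \<comment> \<open>In the residue at y = 0 the derivative term, being constant in y, drops out,
      while r turns into the Casimir element.\<close>
    have col: "br (column b \<theta>) (column c (casimir q)) $ a + br (\<theta> $ a) (column c (casimir q)) $ b = 0" for c
    proof -
      let ?k = "\<Sum>i\<in>UNIV. h i $ c * \<theta>' i $ a $ b"
      have "residue (\<lambda>y. (?k + br (column b \<theta>) (column c (r q y)) $ a) + br (\<theta> $ a) (column c (r q y)) $ b) 0
          = residue (\<lambda>y. 0) 0"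
        by (rule residue_cong) (use lim eventually_at_in_open[OF S] in \<open>auto elim!: eventually_mono\<close>)
      also have "residue (\<lambda>y. (?k + br (column b \<theta>) (column c (r q y)) $ a) + br (\<theta> $ a) (column c (r q y)) $ b) 0
         = residue (\<lambda>y. ?k) 0 + residue (\<lambda>y. br (column b \<theta>) (column c (r q y)) $ a) 0
            + residue (\<lambda>y. br (\<theta> $ a) (column c (r q y)) $ b) 0"
        by (subst residue_add[OF S]; (intro holomorphic_on_add holomorphic_on_const residue_br(2)[OF lie S] hol)?)
           (subst residue_add[OF S]; (intro holomorphic_on_add holomorphic_on_const residue_br(2)[OF lie S] hol refl)?)
      finally show ?thesis
        by (simp add: residue_const residue_br(1)[OF lie S hol] res)
    qed
    have "br (column b \<theta>) x $ a + br (\<theta> $ a) x $ b = 0"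
      by (subst (1 2) casimir_expansion[OF lie is_casimir_casimir[OF q], of x])
         (simp add: br_sum[OF lie] br_smult[OF lie] col flip: sum.distrib distrib_left)
    thus ?thesis by (simp add: eq_neg_iff_add_eq_0)
  qed
  show "br (column b \<theta>) x $ a = - br (\<theta> $ a) x $ b" by (rule inv)
  \<comment> \<open>With invariance known, the two brackets in \<open>lim\<close> cancel at any y of
    the punctured disc; \<epsilon>/4 is merely one such point. What remains is a vanishing linear
    combination of the h i.\<close>
  have y: "of_real (\<epsilon>/4) \<in> ball (0::complex) (\<epsilon>/2) - {0}" using \<epsilon> by simp
  have "\<theta>' i $ a $ b = 0" for a b
  proof (rule orthonormal_basis_independent[OF lie ortho, of "\<lambda>i. \<theta>' i $ a $ b"])
    show "(\<Sum>i\<in>UNIV. \<theta>' i $ a $ b *s h i) = 0"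
      using lim[OF y, of _ a b] by (simp add: inv vec_eq_iff mult.commute)
  qed
  thus "\<theta>' i = 0" by (simp add: vec_eq_iff)
qed

lemma leading_coefficient_zero:
  assumes q: "q \<in> q_domain r" and k: "k \<ge> 2"
    and \<theta>: "\<And>a b. ((\<lambda>z. z ^ k * r q z $ a $ b) \<longlongrightarrow> \<theta> $ a $ b) (at 0)"
    and \<theta>': "\<And>i a b. ((\<lambda>z. z ^ k * dir_deriv (bv i) r q z $ a $ b) \<longlongrightarrow> \<theta>' i $ a $ b) (at 0)"
  shows "\<theta> = 0"
proof -
  obtain \<epsilon> where \<epsilon>: "\<epsilon> > 0" "\<And>z. z \<in> ball 0 \<epsilon> - {0} \<Longrightarrow> (q, z) \<in> regular_points r"
    using q_domain_ball[OF q] by blast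
  have k1: "k \<ge> 1" using k by simp
  note inv = leading_coefficient_invariant(1)[OF q k1 \<theta> \<theta>']
  \<comment> \<open>Here z = (m + n) t, w = n t and z - w = m t. The factor t^(2k) balances the two
    poles in each bracket; the derivative terms have only one and vanish in the limit.\<close>
  have lim: "br (column b \<theta>) (column c \<theta>) $ a / (m ^ k * (m + n) ^ k)
      + br (\<theta> $ a) (column c \<theta>) $ b / (m ^ k * n ^ k)
      + br (\<theta> $ a) (\<theta> $ b) $ c / ((m + n) ^ k * n ^ k) = 0"
    if mn: "m \<noteq> 0" "n \<noteq> 0" "m + n \<noteq> 0" for m n :: complex and a b c
  proof -
    let ?e = "\<lambda>t. (\<Sum>i\<in>UNIV. h i $ a * (t ^ k * (t ^ k * dir_deriv (bv i) r q (n * t) $ b $ c))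
        - h i $ b * (t ^ k * (t ^ k * dir_deriv (bv i) r q ((m + n) * t) $ a $ c))
        + h i $ c * (t ^ k * (t ^ k * dir_deriv (bv i) r q (m * t) $ a $ b)))
     + br (t ^ k *s column b (r q (m * t))) (t ^ k *s column c (r q ((m + n) * t))) $ a
     + br (t ^ k *s r q (m * t) $ a) (t ^ k *s column c (r q (n * t))) $ b
     + br (t ^ k *s r q ((m + n) * t) $ a) (t ^ k *s r q (n * t) $ b) $ c"
    have mt: "(m + n) * t - n * t = m * t" for t by (simp add: algebra_simps)
    have e: "t ^ k * (t ^ k * cdybe_lhs q ((m + n) * t) (n * t) a b c) = ?e t" for t
      by (simp only: cdybe_lhs_def mt br_smult[OF lie] sum_distrib_left distrib_left right_diff_distrib
            vector_smult_component)
         (simp only: mult_ac)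
    have tk: "((\<lambda>t::complex. t ^ k) \<longlongrightarrow> 0) (at 0)"
      using k by (auto intro!: tendsto_eq_intros)
    note s = tendsto_scaled_arg[OF \<theta> mn(1)] tendsto_scaled_arg[OF \<theta> mn(2)] tendsto_scaled_arg[OF \<theta> mn(3)]
       tendsto_scaled_arg[OF \<theta>' mn(1)] tendsto_scaled_arg[OF \<theta>' mn(2)] tendsto_scaled_arg[OF \<theta>' mn(3)]
    have "(?e \<longlongrightarrow> (\<Sum>i\<in>UNIV. h i $ a * (0 * (\<theta>' i $ b $ c / n ^ k)) - h i $ b * (0 * (\<theta>' i $ a $ c / (m + n) ^ k))
        + h i $ c * (0 * (\<theta>' i $ a $ b / m ^ k)))
        + br ((1 / m ^ k) *s column b \<theta>) ((1 / (m + n) ^ k) *s column c \<theta>) $ a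
        + br ((1 / m ^ k) *s \<theta> $ a) ((1 / n ^ k) *s column c \<theta>) $ b
        + br ((1 / (m + n) ^ k) *s \<theta> $ a) ((1 / n ^ k) *s \<theta> $ b) $ c) (at 0)"
      by (intro tendsto_add tendsto_sum tendsto_diff tendsto_mult tendsto_const s tk tendsto_br[OF lie])
         (use s in \<open>simp_all add: column_def\<close>)
    moreover have "eventually (\<lambda>t. ?e t = 0) (at 0)"
    proof -
      let ?\<delta> = "\<epsilon> / (norm m + norm n)"
      have pos: "norm m + norm n > 0" using mn by (simp add: add_pos_pos)
      have "eventually (\<lambda>t. t \<in> ball 0 ?\<delta> - {0}) (at (0::complex))"
        using \<epsilon> pos by (intro eventually_at_in_open) auto
      thus ?thesis
      proof eventually_elim
        case (elim t)
        have t: "norm t * (norm m + norm n) < \<epsilon>" "t \<noteq> 0"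
          using elim pos by (auto simp: pos_less_divide_eq)
        have c: "(q, c * t) \<in> regular_points r" if "c \<noteq> 0" "norm c \<le> norm m + norm n" for c
        proof -
          have "norm (c * t) \<le> norm t * (norm m + norm n)"
            using mult_right_mono[OF that(2) norm_ge_zero[of t]] by (simp add: norm_mult mult.commute)
          thus ?thesis using t that by (intro \<epsilon>(2)) auto
        qed
        have "(q, (m + n) * t - n * t) \<in> regular_points r"
          unfolding mt using mn by (intro c) simp_all
        moreover have "(q, (m + n) * t) \<in> regular_points r"
          using mn norm_triangle_ineq by (intro c)
        moreover have "(q, n * t) \<in> regular_points r"
          using mn by (intro c) simp_all
        ultimately have "cdybe_lhs q ((m + n) * t) (n * t) a b c = 0"
          by (intro cdybe)
        thus ?case unfolding e[symmetric] by simp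
      qed
    qed
    ultimately have "(\<Sum>i\<in>UNIV. h i $ a * (0 * (\<theta>' i $ b $ c / n ^ k)) - h i $ b * (0 * (\<theta>' i $ a $ c / (m + n) ^ k))
        + h i $ c * (0 * (\<theta>' i $ a $ b / m ^ k)))
        + br ((1 / m ^ k) *s column b \<theta>) ((1 / (m + n) ^ k) *s column c \<theta>) $ a
        + br ((1 / m ^ k) *s \<theta> $ a) ((1 / n ^ k) *s column c \<theta>) $ b
        + br ((1 / (m + n) ^ k) *s \<theta> $ a) ((1 / n ^ k) *s \<theta> $ b) $ c = 0"
      by (intro tendsto_unique[OF _ _ tendsto_eventually]) auto
    thus ?thesis by (simp add: br_smult[OF lie] mult_ac)
  qed
  have "br (\<theta> $ a) (\<theta> $ b) $ c = 0" for a b c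
  proof -
    \<comment> \<open>By invariance the middle bracket of \<open>lim\<close> is -A, so two unknowns
      remain. The pairs (m, n) = (1, 1) and (1, 2) give C = (2^k - 1) A and C = (3^k - 2^k) A,
      compatible for k >= 2 only if A = C = 0.\<close>
    let ?A = "br (column b \<theta>) (column c \<theta>) $ a" and ?C = "br (\<theta> $ a) (\<theta> $ b) $ c"
    have inv': "br (\<theta> $ a) (column c \<theta>) $ b = - ?A" using inv by simp
    have "?A / 2 ^ k - ?A + ?C / 2 ^ k = 0"
      using lim[of 1 1 b c a] by (simp add: inv')
    hence 1: "?C = (2 ^ k - 1) * ?A" by (simp add: field_simps)
    have "?A / 3 ^ k - ?A / 2 ^ k + ?C / (3 ^ k * 2 ^ k) = 0"
      using lim[of 1 2 b c a] by (simp add: inv')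
    hence 2: "?C = (3 ^ k - 2 ^ k) * ?A" by (simp add: field_simps)
    have "of_nat (3 ^ k + 1) \<noteq> (of_nat (2 * 2 ^ k) :: complex)"
      unfolding of_nat_eq_iff using two_powers_less[OF k] by simp
    hence "(3 ^ k - 2 ^ k :: complex) \<noteq> 2 ^ k - 1"
      by (simp add: algebra_simps)
    hence "?A = 0" using 1 2 by simp
    thus ?thesis using 1 by simp
  qed
  thus ?thesis
    by (intro invariant_commuting_rows_eq_0[OF simple inv]) (simp add: vec_eq_iff)
qed

lemma simple_pole:
  assumes q: "q \<in> q_domain r"
  shows "pole_order_le 1 (\<lambda>z. r q z $ a $ b)"
proof -
  \<comment> \<open>The bound is carried for the q-derivatives as well: their leading coefficients
    of the same order enter the limits above, and both kinds are shown to vanish together.\<close>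
  define P where "P k \<longleftrightarrow> (\<forall>a b. pole_order_le k (\<lambda>z. r q z $ a $ b)) \<and>
     (\<forall>i a b. pole_order_le k (\<lambda>z. dir_deriv (bv i) r q z $ a $ b))" for k
  have step: "P (Suc k)" if "P (Suc (Suc k))" for k
  proof -
    let ?k = "Suc (Suc k)"
    have "\<exists>c. ((\<lambda>z. z ^ ?k * r q z $ a $ b) \<longlongrightarrow> c) (at 0)" for a b
      using that pole_order_le_tendsto unfolding P_def pole_order_le_def by blast
    then obtain t where t: "\<And>a b. ((\<lambda>z. z ^ ?k * r q z $ a $ b) \<longlongrightarrow> t a b) (at 0)" by metis
    have "\<exists>c. ((\<lambda>z. z ^ ?k * dir_deriv (bv i) r q z $ a $ b) \<longlongrightarrow> c) (at 0)" for a b i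
      using that pole_order_le_tendsto unfolding P_def pole_order_le_def by blast
    then obtain t' where t': "\<And>i a b. ((\<lambda>z. z ^ ?k * dir_deriv (bv i) r q z $ a $ b) \<longlongrightarrow> t' i a b) (at 0)" by metis
    have lims: "((\<lambda>z. z ^ ?k * r q z $ a $ b) \<longlongrightarrow> (\<chi> a b. t a b) $ a $ b) (at 0)"
      "((\<lambda>z. z ^ ?k * dir_deriv (bv i) r q z $ a $ b) \<longlongrightarrow> (\<chi> a b. t' i a b) $ a $ b) (at 0)" for i a b
      using t t' by simp_all
    have "(\<chi> a b. t a b) = 0" by (rule leading_coefficient_zero[OF q _ lims]) simp
    moreover have "(\<chi> a b. t' i a b) = 0" for i
      by (rule leading_coefficient_invariant(2)[OF q _ lims]) simp
    ultimately have "((\<lambda>z. z ^ ?k * r q z $ a $ b) \<longlongrightarrow> 0) (at 0)"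
      "((\<lambda>z. z ^ ?k * dir_deriv (bv i) r q z $ a $ b) \<longlongrightarrow> 0) (at 0)" for i a b
      using lims(1)[of a b] lims(2)[of i a b] by simp_all
    thus ?thesis using that unfolding P_def by (blast intro: pole_order_le_reduce)
  qed
  define d where "d a b = nat (- fls_subdegree (laurent_expansion (\<lambda>z. r q z $ a $ b) 0))" for a b
  define d' where "d' i a b = nat (- fls_subdegree (laurent_expansion (\<lambda>z. dir_deriv (bv i) r q z $ a $ b) 0))" for i a b
  \<comment> \<open>The sum of all orders is a common bound for the finitely many entries. The
    descent needs order at least two and so stops at order one.\<close>
  define K where "K = (\<Sum>a\<in>UNIV. \<Sum>b\<in>UNIV. d a b) + (\<Sum>i\<in>UNIV. \<Sum>a\<in>UNIV. \<Sum>b\<in>UNIV. d' i a b)"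
  have "d a b \<le> (\<Sum>b\<in>UNIV. d a b)" "(\<Sum>b\<in>UNIV. d a b) \<le> (\<Sum>a\<in>UNIV. \<Sum>b\<in>UNIV. d a b)"
    "d' i a b \<le> (\<Sum>b\<in>UNIV. d' i a b)" "(\<Sum>b\<in>UNIV. d' i a b) \<le> (\<Sum>a\<in>UNIV. \<Sum>b\<in>UNIV. d' i a b)"
    "(\<Sum>a\<in>UNIV. \<Sum>b\<in>UNIV. d' i a b) \<le> (\<Sum>i\<in>UNIV. \<Sum>a\<in>UNIV. \<Sum>b\<in>UNIV. d' i a b)" for i a b
    by (rule member_le_sum; simp)+
  hence K: "d a b \<le> Suc K" "d' i a b \<le> Suc K" for i a b
    unfolding K_def by (meson le_SucI order_trans trans_le_add1 trans_le_add2)+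
  have "P (Suc K)"
    unfolding P_def using K unfolding d_def d'_def
    by (auto intro: pole_order_le_mono[OF pole_order_le_exists[OF r_has_laurent_expansion[OF meromorphic q]]]
       pole_order_le_mono[OF pole_order_le_exists[OF dir_deriv_has_laurent_expansion[OF meromorphic q]]])
  hence "P (Suc 0)"
    by (induction K) (auto intro: step)
  thus ?thesis by (simp add: P_def)
qed

end

section \<open>Principal values on a circle\<close>

text \<open>Lets the circle start at \<open>Arg z\<close>, which may be negative, instead of at 0;
  hence the range allowed for a.\<close>

lemma integral_periodic:
  fixes f :: "real \<Rightarrow> complex"
  assumes f: "continuous_on UNIV f" and p: "\<And>t. f (t + p) = f t" "p \<ge> 0" and a: "- p \<le> a" "a \<le> p"
  shows "integral {a..a + p} f = integral {0..p} f"
proof -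
  have int: "f integrable_on {x..y}" for x y
    by (intro integrable_continuous_real continuous_on_subset[OF f]) auto
  have shift: "integral {x + p..y + p} f = integral {x..y} f" for x y
    using integral_shift_Icc_real[of x y f p] p by (simp add: o_def add.commute)
  have *: "integral {a..a + p} f = integral {0..p} f" if "0 \<le> a" "a \<le> p" for a
  proof -
    have "integral {a..a + p} f = integral {a..p} f + integral {0 + p..a + p} f"
      using Henstock_Kurzweil_Integration.integral_combine[where a = a and c = p and b = "a + p" and f = f, OF that(2) _ int] that by simp
    also have "integral {0 + p..a + p} f = integral {0..a} f" by (rule shift)
    also have "integral {a..p} f + integral {0..a} f = integral {0..p} f"
      using that Henstock_Kurzweil_Integration.integral_combine[where a = 0 and c = a and b = p and f = f] int by (simp add: add.commute)
    finally show ?thesis .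
  qed
  show ?thesis
  proof (cases "a \<ge> 0")
    case False
    have "integral {a..a + p} f = integral {a + p..(a + p) + p} f" by (rule shift[symmetric])
    also have "\<dots> = integral {0..p} f" using False a by (intro *) auto
    finally show ?thesis .
  qed (use * a in auto)
qed

text \<open>On the circle w = z cis u this is dw/(w - z) per du. The real part is half the cotangent
  of u/2, odd about u = pi; the constant \<i>/2 is the origin of the half residue.\<close>

lemma cis_quotient:
  assumes "sin (u / 2) \<noteq> 0"
  shows "\<i> * cis u / (cis u - 1) = of_real (cos (u / 2) / (2 * sin (u / 2))) + \<i> / 2"
proof -
  have u: "cis u = cis (u / 2) ^ 2" by (simp add: power2_eq_square cis_mult)
  have d: "cis u - 1 = 2 * \<i> * of_real (sin (u / 2)) * cis (u / 2)"
    using sin_double[of "u / 2"] cos_double_sin[of "u / 2"]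
    by (simp add: complex_eq_iff power2_eq_square)
  have "cis (u / 2) \<noteq> 0" by simp
  hence "\<i> * cis u / (cis u - 1) = cis (u / 2) / (2 * of_real (sin (u / 2)))"
    using assms unfolding d unfolding u by (simp add: field_simps power2_eq_square)
  also have "\<dots> = of_real (cos (u / 2) / (2 * sin (u / 2))) + \<i> / 2"
    using assms by (simp add: complex_eq_iff field_simps Re_divide Im_divide power2_eq_square)
  finally show ?thesis .
qed

text \<open>The primitive is log sin plus a linear term. The logarithms cancel because the removed
  arc is symmetric about the pole; the linear term contributes \<i>/2 times the length 2 pi - 2
  \<delta>.\<close>

lemma has_integral_cis_quotient:
  assumes "0 < \<delta>" "\<delta> < pi"
  shows "((\<lambda>t. \<i> * cis (t - A) / (cis (t - A) - 1)) has_integral \<i> * of_real (pi - \<delta>)) {A + \<delta>..A + 2 * pi - \<delta>}"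
proof -
  let ?\<Phi> = "\<lambda>t. complex_of_real (ln (sin ((t - A) / 2))) + \<i> / 2 * of_real (t - A)"
  have "((\<lambda>t. \<i> * cis (t - A) / (cis (t - A) - 1)) has_integral
      (?\<Phi> (A + 2 * pi - \<delta>) - ?\<Phi> (A + \<delta>))) {A + \<delta>..A + 2 * pi - \<delta>}"
  proof (rule fundamental_theorem_of_calculus)
    fix t assume t: "t \<in> {A + \<delta>..A + 2 * pi - \<delta>}"
    have s: "sin ((t - A) / 2) > 0" using t assms by (intro sin_gt_zero) auto
    have "((\<lambda>t. ln (sin ((t - A) / 2))) has_real_derivative cos ((t - A) / 2) / (2 * sin ((t - A) / 2))) (at t)"
      using s by (auto intro!: derivative_eq_intros simp: field_simps)
    hence "((\<lambda>t. complex_of_real (ln (sin ((t - A) / 2)))) has_vector_derivative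
        complex_of_real (cos ((t - A) / 2) / (2 * sin ((t - A) / 2)))) (at t)"
      by (rule has_vector_derivative_of_real)
    moreover have "((\<lambda>t. \<i> / 2 * of_real (t - A)) has_vector_derivative \<i> / 2) (at t)"
      by (auto intro!: derivative_eq_intros simp: has_vector_derivative_def scaleR_conv_of_real)
    ultimately have "(?\<Phi> has_vector_derivative
        complex_of_real (cos ((t - A) / 2) / (2 * sin ((t - A) / 2))) + \<i> / 2) (at t)"
      by (rule has_vector_derivative_add)
    also have "complex_of_real (cos ((t - A) / 2) / (2 * sin ((t - A) / 2))) + \<i> / 2 = \<i> * cis (t - A) / (cis (t - A) - 1)"
      using s by (intro cis_quotient[symmetric]) simp
    finally show "(?\<Phi> has_vector_derivative \<i> * cis (t - A) / (cis (t - A) - 1)) (at t within {A + \<delta>..A + 2 * pi - \<delta>})"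
      by (rule has_vector_derivative_at_within)
  qed (use assms in auto)
  also have "?\<Phi> (A + 2 * pi - \<delta>) - ?\<Phi> (A + \<delta>) = \<i> * of_real (pi - \<delta>)"
  proof -
    have "sin ((2 * pi - \<delta>) / 2) = sin (\<delta> / 2)"
      using sin_pi_minus[of "\<delta> / 2"] by (simp add: diff_divide_distrib)
    moreover have "A + 2 * pi - \<delta> - A = 2 * pi - \<delta>" by simp
    ultimately show ?thesis by (simp add: field_simps)
  qed
  finally show ?thesis .
qed

text \<open>Subtracting c/(w - z) leaves a function holomorphic off 0, whose integral over the full
  circle is given by the residue at 0. The subtracted part contributes pi \<i> c, half of what an
  enclosed pole would give.\<close>

lemma pv_circle_simple_pole:
  assumes z: "z \<noteq> 0" "norm z < R" and g: "g holomorphic_on ball 0 R - {0, z}"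
    and c: "((\<lambda>w. (w - z) * g w) \<longlongrightarrow> c) (at z)"
  shows "pv_circle g z = 2 * pi * \<i> * (residue g 0 + c / 2)"
proof -
  let ?S = "ball 0 R - {0} :: complex set" and ?A = "Arg z"
  \<comment> \<open>G fills in the removable singularity of (w - z) g at z; the function g1 below is
    its difference quotient there.\<close>
  define G where "G = (\<lambda>w. if w = z then c else (w - z) * g w)"
  have S: "open ?S" "z \<in> ?S" using z by auto
  have G: "G holomorphic_on ?S"
  proof (rule no_isolated_singularity'[where K = "{z}"])
    have "(\<lambda>w. (w - z) * g w) holomorphic_on ?S - {z}"
      by (intro holomorphic_intros holomorphic_on_subset[OF g]) auto
    thus "G holomorphic_on ?S - {z}"
      by (rule holomorphic_transform) (auto simp: G_def)
    fix y assume "y \<in> {z}"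
    have "(G \<longlongrightarrow> c) (at z)"
      by (rule Lim_transform_eventually[OF c]) (auto simp: G_def eventually_at_filter)
    thus "(G \<longlongrightarrow> G y) (at y within ?S)"
      using \<open>y \<in> {z}\<close> by (auto simp: G_def intro: tendsto_within_subset)
  qed (use S in auto)
  define g1 where "g1 = (\<lambda>w. if w = z then deriv G z else g w - G z / (w - z))"
  have g1: "g1 holomorphic_on ?S"
    unfolding g1_def by (rule pole_theorem_open[OF G S(1)]) (auto simp: G_def)
  have g_eq: "g w = c / (w - z) + g1 w" if "w \<noteq> z" for w
    using that by (simp add: g1_def G_def)
  have zc: "z = norm z * cis ?A" using z by (simp add: cis_Arg sgn_eq)
  define F where "F = (\<lambda>t. g1 (norm z * cis t) * norm z * \<i> * cis t)"
  have contF: "continuous_on UNIV F"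
    unfolding F_def using z
    by (intro continuous_intros continuous_on_compose2[OF holomorphic_on_imp_continuous_on[OF g1]])
       (auto simp: norm_mult)
  have intF: "F integrable_on {x..y}" for x y
    by (intro integrable_continuous_real continuous_on_subset[OF contF]) auto
  have res: "residue g1 0 = residue g 0"
  proof -
    let ?B = "ball 0 (norm z) :: complex set"
    have B: "open ?B" "0 \<in> ?B" using z by auto
    have h: "(\<lambda>w. c / (w - z)) holomorphic_on ?B" by (intro holomorphic_intros) auto
    have "residue g 0 = residue (\<lambda>w. c / (w - z) + g1 w) 0"
      by (rule residue_cong[OF eventually_mono[OF eventually_at_in_open[OF B]]]) (auto intro: g_eq)
    also have "\<dots> = residue (\<lambda>w. c / (w - z)) 0 + residue g1 0"
      using z by (intro residue_add[OF B]) (auto intro: holomorphic_on_subset[OF h] holomorphic_on_subset[OF g1])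
    also have "residue (\<lambda>w. c / (w - z)) 0 = 0" by (rule residue_holo[OF B h])
    finally show ?thesis by simp
  qed
  have full: "integral {?A..?A + 2 * pi} F = 2 * pi * \<i> * residue g 0"
  proof -
    have "integral {?A..?A + 2 * pi} F = integral {0..2 * pi} F"
    proof (rule integral_periodic[OF contF])
      show "F (t + 2 * pi) = F t" for t
        using cis_mult[of t "2 * pi"] by (simp add: F_def)
    qed (use Arg_bounded[of z] in \<open>auto simp: less_imp_le\<close>)
    also have "\<dots> = contour_integral (circlepath 0 (norm z)) g1"
      unfolding circlepath_def by (subst contour_integral_part_circlepath_eq) (auto simp: F_def)
    also have "\<dots> = 2 * pi * \<i> * residue g1 0"
      by (rule contour_integral_unique[OF base_residue[of "ball 0 R"]])
         (use z g1 le_less_trans[OF norm_ge_zero z(2)] in auto)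
    finally show ?thesis by (simp add: res)
  qed
  have arc: "contour_integral (part_circlepath 0 (norm z) (?A + \<delta>) (?A + 2 * pi - \<delta>)) g =
      c * (\<i> * of_real (pi - \<delta>)) + integral {?A + \<delta>..?A + 2 * pi - \<delta>} F"
    if \<delta>: "0 < \<delta>" "\<delta> < pi" for \<delta>
  proof -
    let ?I = "{?A + \<delta>..?A + 2 * pi - \<delta>}"
    have "contour_integral (part_circlepath 0 (norm z) (?A + \<delta>) (?A + 2 * pi - \<delta>)) g =
       integral ?I (\<lambda>t. g (0 + norm z * cis t) * norm z * \<i> * cis t)"
      using \<delta> by (intro contour_integral_part_circlepath_eq) auto
    also have "\<dots> = integral ?I (\<lambda>t. c * (\<i> * cis (t - ?A) / (cis (t - ?A) - 1)) + F t)"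
    proof (rule integral_cong)
      fix t assume t: "t \<in> ?I"
      have s: "sin ((t - ?A) / 2) \<noteq> 0"
        using t \<delta> sin_gt_zero[of "(t - ?A) / 2"] by auto
      have "cis (t - ?A) \<noteq> 1"
      proof
        assume "cis (t - ?A) = 1"
        hence c1: "cos (t - ?A) = 1" by (simp add: complex_eq_iff)
        define u where "u = (t - ?A) / 2"
        have "t - ?A = 2 * u" by (simp add: u_def)
        with c1 have "sin u = 0" by (simp add: cos_double_sin)
        thus False using s by (simp add: u_def)
      qed
      define e where "e = cis (t - ?A)"
      have e: "e - 1 \<noteq> 0" using \<open>cis (t - ?A) \<noteq> 1\<close> by (simp add: e_def)
      have ct: "norm z * cis t = z * e"
      proof -
        have "z * e = (norm z * cis ?A) * e" by (rule arg_cong[OF zc])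
        thus ?thesis by (simp add: cis_mult e_def mult.assoc)
      qed
      have "norm z * cis t - z = z * (e - 1)" unfolding ct by (simp add: algebra_simps)
      moreover from this have "norm z * cis t \<noteq> z" using e z by auto
      ultimately have "g (norm z * cis t) = c / (z * (e - 1)) + g1 (norm z * cis t)"
        using g_eq by simp
      hence "g (0 + norm z * cis t) * norm z * \<i> * cis t = c / (z * (e - 1)) * \<i> * (norm z * cis t) + F t"
        by (simp add: F_def algebra_simps)
      also have "c / (z * (e - 1)) * \<i> * (norm z * cis t) = c * (\<i> * e / (e - 1))"
        unfolding ct using z e by (simp add: field_simps)
      finally show "g (0 + norm z * cis t) * norm z * \<i> * cis t = c * (\<i> * cis (t - ?A) / (cis (t - ?A) - 1)) + F t"
        by (simp add: e_def)
    qed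
    also have "\<dots> = c * (\<i> * of_real (pi - \<delta>)) + integral ?I F"
      using has_integral_add[OF has_integral_mult_right[OF has_integral_cis_quotient[OF \<delta>, of ?A], of c]
          integrable_integral[OF intF]] by (rule integral_unique)
    finally show ?thesis .
  qed
  \<comment> \<open>Continuity of the indefinite integral shows that the limit defining the
    principal value exists; \<open>Lim\<close> would otherwise be an unspecified value.\<close>
  define J where "J x = integral {?A..x} F" for x
  have contJ: "continuous_on {?A..?A + 2 * pi} J"
    unfolding J_def by (rule indefinite_integral_continuous_1[OF intF])
  have IJ: "integral {?A + \<delta>..?A + 2 * pi - \<delta>} F = J (?A + 2 * pi - \<delta>) - J (?A + \<delta>)" if "0 < \<delta>" "\<delta> < pi" for \<delta>
    using Henstock_Kurzweil_Integration.integral_combine[where a = ?A and c = "?A + \<delta>" and b = "?A + 2 * pi - \<delta>" and f = F] intF that by (simp add: J_def algebra_simps)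
  have ev: "eventually (\<lambda>\<delta>. 0 < \<delta> \<and> \<delta> < pi) (at_right (0::real))"
    by (auto simp: eventually_at_right_field intro!: exI[of _ pi])
  have lim1: "((\<lambda>\<delta>. J (?A + 2 * pi - \<delta>)) \<longlongrightarrow> J (?A + 2 * pi)) (at_right 0)"
    by (rule continuous_on_tendsto_compose[OF contJ])
       (auto intro!: tendsto_eq_intros eventually_mono[OF ev])
  have lim2: "((\<lambda>\<delta>. J (?A + \<delta>)) \<longlongrightarrow> J ?A) (at_right 0)"
    by (rule continuous_on_tendsto_compose[OF contJ])
       (auto intro!: tendsto_eq_intros eventually_mono[OF ev])
  have "((\<lambda>\<delta>. c * (\<i> * of_real (pi - \<delta>)) + (J (?A + 2 * pi - \<delta>) - J (?A + \<delta>))) \<longlongrightarrow>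
      c * (\<i> * of_real (pi - 0)) + (J (?A + 2 * pi) - J ?A)) (at_right 0)"
    by (intro tendsto_intros lim1 lim2)
  also have "c * (\<i> * of_real (pi - 0)) + (J (?A + 2 * pi) - J ?A) = 2 * pi * \<i> * (residue g 0 + c / 2)"
    unfolding J_def full by (simp add: algebra_simps)
  finally have lim: "((\<lambda>\<delta>. c * (\<i> * of_real (pi - \<delta>)) + (J (?A + 2 * pi - \<delta>) - J (?A + \<delta>))) \<longlongrightarrow>
      2 * pi * \<i> * (residue g 0 + c / 2)) (at_right 0)" .
  have "((\<lambda>\<delta>. contour_integral (part_circlepath 0 (norm z) (?A + \<delta>) (?A + 2 * pi - \<delta>)) g) \<longlongrightarrow>
      2 * pi * \<i> * (residue g 0 + c / 2)) (at_right 0)"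
    by (rule Lim_transform_eventually[OF lim]) (use arc IJ in \<open>auto intro: eventually_mono[OF ev]\<close>)
  thus ?thesis unfolding pv_circle_def by (intro tendsto_Lim) auto
qed

section \<open>Loops and the chain rule\<close>

lemma holo_on_const: "open S \<Longrightarrow> holo_on sc (\<lambda>x. c) S"
  unfolding holo_on_def by (auto intro!: exI[of _ "\<lambda>_. 0"] derivative_intros)

lemma holo_on_add:
  assumes "holo_on sc f S" "holo_on sc g S"
  shows "holo_on sc (\<lambda>x. f x + g x) S"
  unfolding holo_on_def
proof (intro conjI ballI)
  show "open S" using assms(1) by (simp add: holo_on_def)
  fix x assume x: "x \<in> S"
  obtain D where D: "(f has_derivative D) (at x)" "\<forall>c v. D (sc c v) = c * D v"
    using assms(1) x unfolding holo_on_def by blast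
  obtain E where E: "(g has_derivative E) (at x)" "\<forall>c v. E (sc c v) = c * E v"
    using assms(2) x unfolding holo_on_def by blast
  show "\<exists>D. ((\<lambda>x. f x + g x) has_derivative D) (at x) \<and> (\<forall>c v. D (sc c v) = c * D v)"
    using D(2) E(2) by (intro exI[of _ "\<lambda>v. D v + E v"] conjI has_derivative_add D(1) E(1)) (simp add: distrib_left)
qed

lemma holo_on_mult:
  assumes "holo_on sc f S" "holo_on sc g S"
  shows "holo_on sc (\<lambda>x. f x * g x) S"
  unfolding holo_on_def
proof (intro conjI ballI)
  show "open S" using assms(1) by (simp add: holo_on_def)
  fix x assume x: "x \<in> S"
  obtain D where D: "(f has_derivative D) (at x)" "\<forall>c v. D (sc c v) = c * D v"
    using assms(1) x unfolding holo_on_def by blast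
  obtain E where E: "(g has_derivative E) (at x)" "\<forall>c v. E (sc c v) = c * E v"
    using assms(2) x unfolding holo_on_def by blast
  show "\<exists>D. ((\<lambda>x. f x * g x) has_derivative D) (at x) \<and> (\<forall>c v. D (sc c v) = c * D v)"
    using D(2) E(2) by (intro exI[of _ "\<lambda>v. f x * E v + D v * g x"] conjI has_derivative_mult D(1) E(1))
      (simp add: algebra_simps)
qed

lemma holo_on_sum:
  assumes "open S" "\<And>i. i \<in> I \<Longrightarrow> holo_on sc (f i) S"
  shows "holo_on sc (\<lambda>x. \<Sum>i\<in>I. f i x) S"
  using assms(2)
proof (induction I rule: infinite_finite_induct)
  case (insert i I)
  thus ?case using holo_on_add[of sc "f i" S "\<lambda>x. \<Sum>i\<in>I. f i x"] by simp
qed (use assms(1) in \<open>auto intro: holo_on_const\<close>)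

lemma holo_on_linear:
  assumes "open S" "bounded_linear g" "\<And>c v. g (sc c v) = c * g v"
  shows "holo_on sc g S"
  unfolding holo_on_def using assms by (blast intro: bounded_linear_imp_has_derivative)

lemma holo_on_compose_affine:
  assumes "holo_on sc' f T" "open S" "bounded_linear l" "\<And>c v. l (sc c v) = sc' c (l v)"
    and "\<And>x. x \<in> S \<Longrightarrow> y + l x \<in> T"
  shows "holo_on sc (\<lambda>x. f (y + l x)) S"
  unfolding holo_on_def
proof (intro conjI ballI assms(2))
  fix x assume x: "x \<in> S"
  obtain D where D: "(f has_derivative D) (at (y + l x))" "\<forall>c v. D (sc' c v) = c * D v"
    using assms(1) assms(5)[OF x] unfolding holo_on_def by blast
  have "((\<lambda>x. y + l x) has_derivative l) (at x)"
    using has_derivative_add[OF has_derivative_const bounded_linear_imp_has_derivative[OF assms(3)]] by simp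
  from has_derivative_compose[OF this D(1)] D(2) assms(4)
  show "\<exists>D. ((\<lambda>x. f (y + l x)) has_derivative D) (at x) \<and> (\<forall>c v. D (sc c v) = c * D v)"
    by (intro exI[of _ "\<lambda>v. D (l v)"]) simp
qed

lemma holo_on_cong:
  assumes "holo_on sc f S" "\<And>x. x \<in> S \<Longrightarrow> f x = g x"
  shows "holo_on sc g S"
  unfolding holo_on_def
proof (intro conjI ballI)
  show S: "open S" using assms(1) by (simp add: holo_on_def)
  fix x assume x: "x \<in> S"
  obtain D where D: "(f has_derivative D) (at x)" "\<forall>c v. D (sc c v) = c * D v"
    using assms(1) x unfolding holo_on_def by blast
  have "(g has_derivative D) (at x)"
    by (rule has_derivative_transform_within_open[OF D(1) S x assms(2)])
  with D(2) show "\<exists>D. (g has_derivative D) (at x) \<and> (\<forall>c v. D (sc c v) = c * D v)" by blast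
qed

lemma bounded_linear_vmult_left: "bounded_linear (\<lambda>s. s *s (d :: complex^'l))"
proof (rule bounded_linear_intro[where K = "norm d"])
  show "(r *\<^sub>R s) *s d = r *\<^sub>R (s *s d)" for r s
    by (simp add: vec_eq_iff)
qed (simp_all add: vec.scale_left_distrib norm_vmult)

lemma open_q_domain: "open (q_domain r)"
proof (subst open_subopen, rule ballI)
  fix q assume "q \<in> q_domain r"
  then obtain N \<epsilon> where N: "open N" "q \<in> N" "\<epsilon> > 0" "N \<times> (ball 0 \<epsilon> - {0}) \<subseteq> regular_points r"
    unfolding q_domain_def by blast
  hence "N \<subseteq> q_domain r" unfolding q_domain_def by blast
  thus "\<exists>T. open T \<and> q \<in> T \<and> T \<subseteq> q_domain r" using N by blast
qed

section \<open>Laurent expansions and the loops they define\<close>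

lemma ex_laurent_const: "\<exists>F. (\<lambda>z::complex. c :: complex) has_laurent_expansion F"
  by (rule exI has_laurent_expansion_const)+

lemma ex_laurent_add:
  assumes "\<exists>F. f has_laurent_expansion F" "\<exists>G. g has_laurent_expansion G"
  shows "\<exists>F. (\<lambda>z. f z + g z) has_laurent_expansion F"
  using assms by (blast intro: has_laurent_expansion_add)

lemma ex_laurent_mult:
  assumes "\<exists>F. f has_laurent_expansion F" "\<exists>G. g has_laurent_expansion G"
  shows "\<exists>F. (\<lambda>z. f z * g z) has_laurent_expansion F"
  using assms by (blast intro: has_laurent_expansion_mult)

lemma ex_laurent_sum:
  assumes "\<And>i. i \<in> I \<Longrightarrow> \<exists>F. f i has_laurent_expansion F"
  shows "\<exists>F. (\<lambda>z. \<Sum>i\<in>I. f i z) has_laurent_expansion F"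
proof -
  obtain F where "\<And>i. i \<in> I \<Longrightarrow> f i has_laurent_expansion F i" using assms by metis
  from has_laurent_expansion_sum[OF this] show ?thesis by (rule exI)
qed

lemma
  fixes r :: "('l::finite, 'n::finite) rmat"
  assumes "meromorphic_r r" "q \<in> q_domain r"
  shows ex_laurent_r: "\<exists>F. (\<lambda>z. r q z $ a $ b) has_laurent_expansion F"
    and ex_laurent_dir_deriv: "\<exists>F. (\<lambda>z. dir_deriv d r q z $ a $ b) has_laurent_expansion F"
  by (rule exI, rule r_has_laurent_expansion[OF assms], rule exI, rule dir_deriv_has_laurent_expansion[OF assms])

definition loop_of :: "(complex \<Rightarrow> complex^'n) \<Rightarrow> 'n::finite loop" where
  "loop_of v = (\<chi> a. laurent_expansion (\<lambda>z. v z $ a) 0)"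

lemma loop_of_nth:
  assumes "\<And>a. \<exists>F. (\<lambda>z. v z $ a) has_laurent_expansion F"
  shows "(\<lambda>z. v z $ a) has_laurent_expansion loop_of v $ a"
  using assms[of a] laurent_expansion_0_eqI by (auto simp: loop_of_def)

lemma loop_of_in_loop_space:
  assumes "\<And>a. \<exists>F. (\<lambda>z. v z $ a) has_laurent_expansion F"
  shows "loop_of v \<in> loop_space"
  using loop_of_nth[OF assms] by (auto simp: loop_space_def has_laurent_expansion_def)

text \<open>A Laurent series need represent v only close to 0; holomorphy on the punctured ball
  extends the agreement to all of it.\<close>

lemma loop_eval_loop_of:
  assumes "\<And>a. \<exists>F. (\<lambda>z. v z $ a) has_laurent_expansion F"
    and "\<And>a. (\<lambda>z. v z $ a) holomorphic_on ball 0 \<epsilon> - {0}" "z \<in> ball 0 \<epsilon> - {0}"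
  shows "loop_eval (loop_of v) z = v z"
  using eval_fls_eqI[OF loop_of_nth[OF assms(1)], of _ "ereal \<epsilon>" z] assms(2,3)
  by (simp add: loop_eval_def vec_eq_iff)

lemma eventually_loop_eval_loop_of:
  assumes "\<And>a. \<exists>F. (\<lambda>z. v z $ a) has_laurent_expansion F"
  shows "eventually (\<lambda>z. loop_eval (loop_of v) z = v z) (at 0)"
proof -
  have "eventually (\<lambda>z. \<forall>a\<in>UNIV. eval_fls (loop_of v $ a) z = v z $ a) (at 0)"
    using loop_of_nth[OF assms] by (intro eventually_ball_finite) (auto simp: has_laurent_expansion_def)
  thus ?thesis by eventually_elim (simp add: loop_eval_def vec_eq_iff)
qed

lemma L_map_eq_loop_of: "L_map h r x = loop_of (L_at h r x)"
  by (simp add: L_map_def loop_of_def)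

lemma L_at_ex_laurent:
  fixes r :: "('l::finite, 'n::finite) rmat"
  assumes "meromorphic_r r" "q \<in> q_domain r"
  shows "\<exists>F. (\<lambda>z. L_at h r (q, p, \<xi>) z $ a) has_laurent_expansion F"
  unfolding L_at_nth
  by (intro ex_laurent_add ex_laurent_sum ex_laurent_mult ex_laurent_const ex_laurent_r[OF assms])

lemma L_at_holomorphic:
  assumes "\<And>z. z \<in> A \<Longrightarrow> (q, z) \<in> regular_points r"
  shows "(\<lambda>z. L_at h r (q, p, \<xi>) z $ a) holomorphic_on A"
  unfolding L_at_nth by (intro holomorphic_intros r_holomorphic(1) assms)

lemma loop_eval_L_map:
  assumes "meromorphic_r r" "q \<in> q_domain r"
    and "\<And>z. z \<in> ball 0 \<epsilon> - {0} \<Longrightarrow> (q, z) \<in> regular_points r" "z \<in> ball 0 \<epsilon> - {0}"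
  shows "loop_eval (L_map h r (q, p, \<xi>)) z = L_at h r (q, p, \<xi>) z"
  unfolding L_map_eq_loop_of
  by (rule loop_eval_loop_of[OF L_at_ex_laurent[OF assms(1,2)] L_at_holomorphic[OF assms(3)] assms(4)])

text \<open>Smoothness of f is known only along holomorphic curves of loops, so the image under L of
  a complex line in phase space is shown to be one. The combined direction (d, e, \<eta>) covers all
  three gradients at once.\<close>

lemma f_L_map_has_derivative:
  fixes r :: "('l::finite, 'n::finite) rmat"
  assumes f: "smooth_with_differential f df" and r: "meromorphic_r r" and q: "q \<in> q_domain r"
  shows "((\<lambda>s. f (L_map h r (q + s *s d, p + s *s e, \<xi> + s *s \<eta>))) has_field_derivative
     loop_pairing (df (L_map h r (q, p, \<xi>)))
       (loop_of (\<lambda>z. (\<Sum>i\<in>UNIV. e $ i *s h i) + dir_deriv d r q z *v \<xi> + r q z *v \<eta>))) (at 0)"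
proof -
  obtain N \<epsilon> where N: "open N" "q \<in> N" "\<epsilon> > 0" "N \<times> (ball 0 \<epsilon> - {0}) \<subseteq> regular_points r"
    using q unfolding q_domain_def by blast
  have Nq: "q' \<in> q_domain r" if "q' \<in> N" for q' using N that unfolding q_domain_def by blast
  have reg: "(q', z) \<in> regular_points r" if "q' \<in> N" "z \<in> ball 0 \<epsilon> - {0}" for q' z
    using N(4) that by blast
  \<comment> \<open>For s in S the point q + s d stays in N, so one punctured disc of radius
    \<epsilon> serves all parameters.\<close>
  define S where "S = (\<lambda>s. q + s *s d) -` N"
  have S: "open S" "0 \<in> S"
  proof -
    have "continuous_on UNIV (\<lambda>s. q + s *s d)"
      by (intro continuous_on_add continuous_on_const continuous_on_vmult continuous_on_id)
    thus "open S" unfolding S_def using N(1) by (rule open_vimage[rotated])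
  qed (use N in \<open>simp add: S_def\<close>)
  let ?c = "\<lambda>s. L_map h r (q + s *s d, p + s *s e, \<xi> + s *s \<eta>)"
  let ?V = "\<lambda>z. (\<Sum>i\<in>UNIV. e $ i *s h i) + dir_deriv d r q z *v \<xi> + r q z *v \<eta>"
  have c_eval: "loop_eval (?c s) z $ a = (\<Sum>i\<in>UNIV. (p $ i + s * e $ i) * h i $ a) +
      (\<Sum>b\<in>UNIV. r (q + s *s d) z $ a $ b * (\<xi> $ b + s * \<eta> $ b))"
    if "s \<in> S" "z \<in> ball 0 \<epsilon> - {0}" for s z a
    using that by (subst loop_eval_L_map[OF r Nq, where \<epsilon> = \<epsilon>]) (auto simp: S_def L_at_nth intro: reg)
  have "holo_curve ?c S"
    unfolding holo_curve_def
  proof (intro conjI ballI S)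
    fix s assume s: "s \<in> S"
    show "?c s \<in> loop_space"
      unfolding L_map_eq_loop_of using s
      by (intro loop_of_in_loop_space L_at_ex_laurent r Nq) (simp add: S_def)
    obtain \<delta> where \<delta>: "\<delta> > 0" "ball s \<delta> \<subseteq> S" using S(1) s by (rule openE)
    show "\<exists>\<delta>>0. \<exists>\<epsilon>>0. ball s \<delta> \<subseteq> S \<and>
       (\<forall>a. holo_on sc_sz (\<lambda>(s', z). loop_eval (?c s') z $ a) (ball s \<delta> \<times> (ball 0 \<epsilon> - {0})))"
    proof (intro exI conjI allI)
      fix a
      let ?U = "ball s \<delta> \<times> (ball 0 \<epsilon> - {0}) :: (complex \<times> complex) set"
      have U: "open ?U" by (intro open_Times open_delete) auto
      have fst: "holo_on sc_sz fst ?U"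
        by (rule holo_on_linear[OF U bounded_linear_fst]) (simp add: sc_sz_def split_beta)
      have rr: "holo_on sc_sz (\<lambda>y. rfun r a b ((q, 0) + (fst y *s d, snd y))) ?U" for b
      proof (rule holo_on_compose_affine[OF holo_on_regular U])
        show "bounded_linear (\<lambda>y. (fst y *s d, snd y))"
          by (intro bounded_linear_Pair bounded_linear_compose[OF bounded_linear_vmult_left bounded_linear_fst]
              bounded_linear_snd)
        fix x assume x: "x \<in> ?U"
        hence "q + fst x *s d \<in> N" using \<delta>(2) by (auto simp: S_def)
        moreover have "snd x \<in> ball 0 \<epsilon> - {0}" using x by auto
        ultimately show "(q, 0) + (fst x *s d, snd x) \<in> regular_points r" using reg by simp
      qed (simp add: sc_sz_def sc_qz_def split_beta)
      have "holo_on sc_sz (\<lambda>y. (\<Sum>i\<in>UNIV. (p $ i + fst y * e $ i) * h i $ a) +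
         (\<Sum>b\<in>UNIV. rfun r a b ((q, 0) + (fst y *s d, snd y)) * (\<xi> $ b + fst y * \<eta> $ b))) ?U"
        by (intro holo_on_add holo_on_sum holo_on_mult holo_on_const U fst rr)
      thus "holo_on sc_sz (\<lambda>(s', z). loop_eval (?c s') z $ a) ?U"
      proof (rule holo_on_cong)
        fix y assume "y \<in> ?U"
        hence "fst y \<in> S" "snd y \<in> ball 0 \<epsilon> - {0}" using \<delta>(2) by auto
        from c_eval[OF this, of a] show "(\<Sum>i\<in>UNIV. (p $ i + fst y * e $ i) * h i $ a) +
         (\<Sum>b\<in>UNIV. rfun r a b ((q, 0) + (fst y *s d, snd y)) * (\<xi> $ b + fst y * \<eta> $ b)) =
           (case y of (s', z) \<Rightarrow> loop_eval (?c s') z $ a)"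
          by (simp add: split_beta)
      qed
    qed (use \<delta> N in auto)
  qed
  moreover have "curve_deriv ?c 0 (loop_of ?V)"
    unfolding curve_deriv_def
  proof (intro conjI allI)
    have V: "\<exists>F. (\<lambda>z. ?V z $ a) has_laurent_expansion F" for a
      unfolding matrix_vector_mult_def vector_add_component sum_component vec_lambda_beta vector_smult_component
      by (intro ex_laurent_add ex_laurent_sum ex_laurent_mult ex_laurent_const ex_laurent_r[OF r q]
          ex_laurent_dir_deriv[OF r q])
    show "loop_of ?V \<in> loop_space" by (rule loop_of_in_loop_space[OF V])
    fix a
    have "eventually (\<lambda>z. z \<in> ball 0 \<epsilon> - {0}) (at (0::complex))"
      using N by (intro eventually_at_in_open) auto
    with eventually_loop_eval_loop_of[OF V]
    show "\<forall>\<^sub>F z in at 0. ((\<lambda>s'. loop_eval (?c s') z $ a) has_field_derivative loop_eval (loop_of ?V) z $ a) (at 0)"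
    proof eventually_elim
      case (elim z)
      have zr: "(q + 0 *s d, z) \<in> regular_points r" using reg[OF N(2) elim(2)] by simp
      have "((\<lambda>s. (\<Sum>i\<in>UNIV. (p $ i + s * e $ i) * h i $ a) +
           (\<Sum>b\<in>UNIV. r (q + s *s d) z $ a $ b * (\<xi> $ b + s * \<eta> $ b))) has_field_derivative ?V z $ a) (at 0)"
        by (rule derivative_eq_intros refl dir_deriv_has_derivative[OF zr])+
           (simp add: matrix_vector_mult_def sum.distrib mult.commute)
      hence "((\<lambda>s. loop_eval (?c s) z $ a) has_field_derivative ?V z $ a) (at 0)"
        by (rule has_field_derivative_transform_within_open[OF _ S]) (use c_eval elim in auto)
      thus ?case by (simp only: elim(1))
    qed
  qed
  ultimately have "((\<lambda>s'. f (?c s')) has_field_derivative loop_pairing (df (?c 0)) (loop_of ?V)) (at 0)"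
    using f S(2) unfolding smooth_with_differential_def by blast
  thus ?thesis by simp
qed

section \<open>Residues\<close>

lemma pair_add_right: "pair \<xi> (x + y) = pair \<xi> x + pair \<xi> y"
  and pair_smult_right: "pair \<xi> (c *s x) = c * pair \<xi> x"
  and pair_minus_right: "pair \<xi> (- x) = - pair \<xi> x"
  by (simp_all add: pair_def distrib_left sum.distrib sum_distrib_left sum_negf mult_ac)

lemma vector_matrix_nth: "(x v* t) $ c = (\<Sum>b\<in>UNIV. x $ b * t $ b $ (c :: 'n::finite))" for x :: "complex^'m::finite"
  by (simp add: vector_matrix_mult_def mult.commute)

lemma holomorphic_on_pair:
  assumes "\<And>b. (\<lambda>w. E w $ b) holomorphic_on A" "\<And>b. (\<lambda>w. V w $ b) holomorphic_on A"
  shows "(\<lambda>w. pair (E w) (V w)) holomorphic_on A"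
  unfolding pair_def by (intro holomorphic_on_sum holomorphic_on_mult assms)

lemma residue_pair_sum:
  assumes S: "open S" "z \<in> S" and I: "finite I"
    and E: "\<And>b. (\<lambda>w. E w $ b) holomorphic_on S - {z}"
    and V: "\<And>i b. i \<in> I \<Longrightarrow> (\<lambda>w. V i w $ b) holomorphic_on S - {z}"
  shows "residue (\<lambda>w. pair (E w) (\<Sum>i\<in>I. c i *s V i w)) z = (\<Sum>i\<in>I. c i * residue (\<lambda>w. pair (E w) (V i w)) z)"
proof -
  have "residue (\<lambda>w. \<Sum>i\<in>I. c i * pair (E w) (V i w)) z = (\<Sum>i\<in>I. residue (\<lambda>w. c i * pair (E w) (V i w)) z)"
    by (intro residue_sum[OF S I] holomorphic_on_mult holomorphic_on_const holomorphic_on_pair E V)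
  also have "\<dots> = (\<Sum>i\<in>I. c i * residue (\<lambda>w. pair (E w) (V i w)) z)"
    by (intro sum.cong refl residue_lmul[OF S] holomorphic_on_pair E V)
  finally show ?thesis by (simp add: pair_sum_right pair_smult_right)
qed

lemma residue_pair_add:
  assumes S: "open S" "z \<in> S" and E: "\<And>b. (\<lambda>w. E w $ b) holomorphic_on S - {z}"
    and V: "\<And>b. (\<lambda>w. V w $ b) holomorphic_on S - {z}" and W: "\<And>b. (\<lambda>w. W w $ b) holomorphic_on S - {z}"
  shows "residue (\<lambda>w. pair (E w) (V w + W w)) z = residue (\<lambda>w. pair (E w) (V w)) z + residue (\<lambda>w. pair (E w) (W w)) z"
  unfolding pair_add_right by (intro residue_add[OF S] holomorphic_on_pair E V W)

lemma loop_pairing_loop_of: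
  assumes "\<And>a. \<exists>F. (\<lambda>z. v z $ a) has_laurent_expansion F"
  shows "loop_pairing \<zeta> (loop_of v) = residue (\<lambda>z. pair (loop_eval \<zeta> z) (v z)) 0"
  unfolding loop_pairing_def
  by (rule residue_cong) (use eventually_loop_eval_loop_of[OF assms] in \<open>auto elim: eventually_mono\<close>)

lemma loop_eval_holomorphic:
  assumes "\<And>a. ereal R \<le> fls_conv_radius (\<zeta> $ a)"
  shows "(\<lambda>w. loop_eval \<zeta> w $ b) holomorphic_on ball 0 R - {0}"
proof -
  have "eval_fls (\<zeta> $ b) holomorphic_on ball 0 R - {0}"
  proof (rule holomorphic_on_subset[OF holomorphic_on_eval_fls[OF order_refl]])
    have "ereal (dist 0 w) < fls_conv_radius (\<zeta> $ b)" if "dist 0 w < R" for w :: complex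
      using that assms[of b] by (meson ereal_less_le less_ereal.simps(1) less_le_trans)
    thus "(ball 0 R - {0} :: complex set) \<subseteq> eball 0 (fls_conv_radius (\<zeta> $ b)) - (if fls_subdegree (\<zeta> $ b) \<ge> 0 then {} else {0})"
      by (auto simp: eball_def)
  qed
  thus ?thesis by (simp add: loop_eval_def)
qed

lemma loop_eval_laurent:
  assumes "\<zeta> \<in> loop_space"
  shows "(\<lambda>w. loop_eval \<zeta> w $ b) has_laurent_expansion \<zeta> $ b"
  using assms by (simp add: loop_eval_def loop_space_def eval_fls_has_laurent_expansion)

lemma loop_bracket_eval:
  assumes lie: "lie_algebra br" and X: "X \<in> loop_space" and Y: "Y \<in> loop_space"
  shows "eventually (\<lambda>w. loop_eval (loop_bracket br Y X) w = br (loop_eval Y w) (loop_eval X w)) (at 0)"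
proof -
  have "(\<lambda>w. \<Sum>a\<in>UNIV. \<Sum>b\<in>UNIV. br (bv a) (bv b) $ c * loop_eval Y w $ a * loop_eval X w $ b)
      has_laurent_expansion loop_bracket br Y X $ c" for c
    unfolding loop_bracket_def vec_lambda_beta
    by (intro has_laurent_expansion_sum has_laurent_expansion_mult has_laurent_expansion_const loop_eval_laurent X Y)
  moreover have "(\<Sum>a\<in>UNIV. \<Sum>b\<in>UNIV. br (bv a) (bv b) $ c * u $ a * v $ b) = br u v $ c" for u v c
    by (subst (2) br_expand[OF lie]) (simp add: mult_ac)
  ultimately have "(\<lambda>w. br (loop_eval Y w) (loop_eval X w) $ c) has_laurent_expansion loop_bracket br Y X $ c" for c
    by simp
  hence "eventually (\<lambda>w. \<forall>c\<in>UNIV. eval_fls (loop_bracket br Y X $ c) w = br (loop_eval Y w) (loop_eval X w) $ c) (at 0)"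
    by (intro eventually_ball_finite) (auto simp: has_laurent_expansion_def)
  thus ?thesis by eventually_elim (simp add: loop_eval_def vec_eq_iff)
qed

lemma dir_deriv_zero [simp]: "dir_deriv 0 r q z = 0"
  by (simp add: dir_deriv_def vec_eq_iff)

lemma bv_sum_smult: "(\<Sum>i\<in>UNIV. bv j $ i *s f i) = (f j :: complex^'n)"
  by (simp add: vec_eq_iff bv_mult_sum)

lemma has_vector_derivative_vec:
  fixes f :: "real \<Rightarrow> complex^'n"
  assumes "\<And>a. ((\<lambda>t. f t $ a) has_vector_derivative D $ a) (at t)"
  shows "(f has_vector_derivative D) (at t)"
  unfolding has_vector_derivative_def
proof (subst has_derivative_componentwise_within, intro ballI)
  fix i :: "complex^'n" assume "i \<in> Basis"
  then obtain a b where i: "i = axis a b" by (auto simp: Basis_vec_def)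
  have "((\<lambda>t. f t $ a) has_derivative (\<lambda>x. x *\<^sub>R D $ a)) (at t)"
    using assms[of a] by (simp add: has_vector_derivative_def)
  from has_derivative_inner_left[OF this, of b]
  show "((\<lambda>x. f x \<bullet> i) has_derivative (\<lambda>x. x *\<^sub>R D \<bullet> i)) (at t)"
    by (simp add: i inner_axis)
qed

lemma exists_ereal_bound:
  assumes "\<And>a. ereal x < c (a :: 'n::finite)"
  shows "\<exists>R>x. \<forall>a. ereal R < c a"
proof -
  have "ereal x < Min (range c)" using assms by simp
  then obtain R where "ereal x < ereal R" "ereal R < Min (range c)" using ereal_dense2 by blast
  thus ?thesis by (intro exI[of _ R]) auto
qed

text \<open>With z fixed, q is confined to where r(-, z) is regular. These coordinate functions of L
  are the test functions inserted into \<open>hamiltonian_curve\<close>.\<close>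

lemma holo_on_L_at:
  fixes r :: "('l::finite, 'n::finite) rmat"
  shows "holo_on sc_phase (\<lambda>x. L_at h r x z $ a) ({q \<in> q_domain r. (q, z) \<in> regular_points r} \<times> UNIV \<times> UNIV)"
    (is "holo_on _ _ ?W")
proof -
  have "open ((\<lambda>q. (q, z)) -` regular_points r)"
    by (intro open_vimage open_regular_points continuous_on_Pair continuous_on_id continuous_on_const)
  hence "open (q_domain r \<inter> (\<lambda>q. (q, z)) -` regular_points r)"
    by (intro open_Int open_q_domain)
  also have "q_domain r \<inter> (\<lambda>q. (q, z)) -` regular_points r = {q \<in> q_domain r. (q, z) \<in> regular_points r}"
    by auto
  finally have W: "open ?W" by (intro open_Times open_UNIV)
  have p: "holo_on sc_phase (\<lambda>x. fst (snd x) $ i) ?W" for i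
    by (rule holo_on_linear[OF W])
       (auto simp: sc_phase_def intro!: bounded_linear_compose[OF bounded_linear_vec_nth]
          bounded_linear_compose[OF bounded_linear_fst] bounded_linear_snd)
  have x: "holo_on sc_phase (\<lambda>x. snd (snd x) $ i) ?W" for i
    by (rule holo_on_linear[OF W])
       (auto simp: sc_phase_def intro!: bounded_linear_compose[OF bounded_linear_vec_nth]
          bounded_linear_compose[OF bounded_linear_snd] bounded_linear_snd)
  have r: "holo_on sc_phase (\<lambda>x. rfun r a b ((0, z) + (fst x, 0))) ?W" for b
  proof (rule holo_on_compose_affine[OF holo_on_regular W])
    show "bounded_linear (\<lambda>x. (fst x, 0))"
      by (intro bounded_linear_Pair bounded_linear_fst bounded_linear_zero)
  qed (auto simp: sc_phase_def sc_qz_def)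
  have "holo_on sc_phase (\<lambda>x. (\<Sum>i\<in>UNIV. fst (snd x) $ i * h i $ a) +
       (\<Sum>b\<in>UNIV. rfun r a b ((0, z) + (fst x, 0)) * snd (snd x) $ b)) ?W"
    by (intro holo_on_add holo_on_sum holo_on_mult holo_on_const W p x r)
  thus ?thesis by (rule holo_on_cong) (auto simp: L_at_nth)
qed

text \<open>The factor r(q + s d, w - z) is regular for all |w| < R, so the only singularity inside
  is that of E at 0, which does not move with s. The residue is then an integral over the fixed
  circle of radius R/2, and the derivative passes under it.\<close>

lemma residue_family_has_derivative:
  fixes r :: "('l::finite, 'n::finite) rmat"
  assumes E: "\<And>b. (\<lambda>w. E w $ b) holomorphic_on ball 0 R - {0}" and R: "0 < R"
    and \<delta>: "\<delta> > 0" and reg: "\<And>s w. s \<in> ball 0 \<delta> \<Longrightarrow> w \<in> ball 0 R \<Longrightarrow> (q + s *s d, w - z) \<in> regular_points r"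
  shows "((\<lambda>s. residue (\<lambda>w. (E w v* r (q + s *s d) (w - z)) $ c) 0) has_field_derivative
     residue (\<lambda>w. (E w v* dir_deriv d r q (w - z)) $ c) 0) (at 0)"
proof -
  define e where "e = R / 2"
  have e: "e > 0" "e < R" using R by (auto simp: e_def)
  let ?\<gamma> = "circlepath 0 e"
  let ?v = "\<lambda>t::real. 2 * pi * \<i> * e * exp (2 * of_real pi * \<i> * t)"
  have \<gamma>: "?\<gamma> t \<in> ball 0 R - {0}" for t using e by (auto simp: norm_circlepath_0)
  have B: "open (ball (0::complex) R)" "0 \<in> ball (0::complex) R" using R by auto
  have res: "residue (\<lambda>w. (E w v* t w) $ c) 0 =
      1 / (2 * pi * \<i>) * integral {0..1} (\<lambda>x. (E (?\<gamma> x) v* t (?\<gamma> x)) $ c * ?v x)"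
    if t: "\<And>b. (\<lambda>w. t w $ b $ c) holomorphic_on ball 0 R" for t
  proof -
    have "(\<lambda>w. (E w v* t w) $ c) holomorphic_on ball 0 R - {0}"
      unfolding vector_matrix_nth
      by (intro holomorphic_on_sum holomorphic_on_mult E holomorphic_on_subset[OF t]) auto
    hence "contour_integral ?\<gamma> (\<lambda>w. (E w v* t w) $ c) = 2 * pi * \<i> * residue (\<lambda>w. (E w v* t w) $ c) 0"
      using e by (intro contour_integral_unique base_residue[OF B]) auto
    thus ?thesis by (simp add: contour_integral_integral vector_derivative_circlepath)
  qed
  have hol: "(\<lambda>w. r (q + s *s d) (w - z) $ b $ c) holomorphic_on ball 0 R"
       "(\<lambda>w. dir_deriv d r (q + s *s d) (w - z) $ b $ c) holomorphic_on ball 0 R" if "s \<in> ball 0 \<delta>" for s b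
    using holomorphic_on_compose_gen[of "\<lambda>w. w - z" "ball 0 R" "\<lambda>u. r (q + s *s d) u $ b $ c" "(\<lambda>w. w - z) ` ball 0 R"]
       holomorphic_on_compose_gen[of "\<lambda>w. w - z" "ball 0 R" "\<lambda>u. dir_deriv d r (q + s *s d) u $ b $ c" "(\<lambda>w. w - z) ` ball 0 R"]
       r_holomorphic[of "(\<lambda>w. w - z) ` ball 0 R" "q + s *s d" r] reg[OF that]
    by (force simp: o_def intro!: holomorphic_intros)+
  have cont_E: "continuous_on A (\<lambda>x. E (?\<gamma> x) $ b)" for A b
    by (rule continuous_on_compose2[OF holomorphic_on_imp_continuous_on[OF E]])
       (use \<gamma> in \<open>auto intro!: continuous_on_circlepath_param continuous_on_id\<close>)
  have cont_v: "continuous_on A ?v" for A by (intro continuous_intros)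
  have cont_line: "continuous_on A (\<lambda>y. (q + fst y *s d, ?\<gamma> (snd y) - z))" for A :: "(complex \<times> real) set"
    by (intro continuous_on_Pair continuous_on_add continuous_on_const continuous_on_vmult continuous_on_fst
        continuous_on_id continuous_on_diff continuous_on_circlepath_param continuous_on_snd)
  have in_reg: "(q + s *s d, ?\<gamma> t - z) \<in> regular_points r" if "s \<in> ball 0 \<delta>" for s t
    using reg[OF that] \<gamma>[of t] by auto
  let ?f = "\<lambda>s x. (E (?\<gamma> x) v* r (q + s *s d) (?\<gamma> x - z)) $ c * ?v x"
  let ?fx = "\<lambda>s x. (E (?\<gamma> x) v* dir_deriv d r (q + s *s d) (?\<gamma> x - z)) $ c * ?v x"
  have "((\<lambda>s. integral (cbox 0 1) (?f s)) has_field_derivative integral (cbox 0 1) (?fx 0)) (at 0 within ball 0 \<delta>)"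
  proof (rule leibniz_rule_field_derivative[where fx = ?fx and f = ?f])
    fix s :: complex and x :: real assume s: "s \<in> ball 0 \<delta>"
    have "((\<lambda>s. ?f s x) has_field_derivative ?fx s x) (at s)"
      unfolding vector_matrix_nth
      by (intro DERIV_cmult_right DERIV_sum DERIV_cmult dir_deriv_has_derivative in_reg s)
    thus "((\<lambda>s. ?f s x) has_field_derivative ?fx s x) (at s within ball 0 \<delta>)"
      by (rule has_field_derivative_at_within)
  next
    fix s :: complex assume s: "s \<in> ball 0 \<delta>"
    have cr: "continuous_on (cbox 0 1) (\<lambda>x. r (q + s *s d) (?\<gamma> x - z) $ b $ c)" for b
    proof (rule continuous_on_compose2[OF holomorphic_on_imp_continuous_on[OF hol(1)[OF s]]])
      show "continuous_on (cbox 0 1) ?\<gamma>" by (intro continuous_on_circlepath_param continuous_on_id)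
    qed (use \<gamma> in auto)
    show "?f s integrable_on cbox 0 1"
      unfolding vector_matrix_nth
      by (rule integrable_continuous[OF continuous_on_mult[OF _ cont_v]])
         (intro continuous_on_mult continuous_on_sum cont_E cr)
  next
    have cd: "continuous_on (ball 0 \<delta> \<times> cbox 0 1) (\<lambda>y. dir_deriv d r (q + fst y *s d) (?\<gamma> (snd y) - z) $ b $ c)" for b
    proof -
      have "continuous_on (regular_points r) (ddir (d, 0) (rfun r b c))"
        by (rule continuous_on_ddir[OF line_holo_on_regular])
      moreover have "(\<lambda>y. (q + fst y *s d, ?\<gamma> (snd y) - z)) ` (ball 0 \<delta> \<times> cbox 0 1) \<subseteq> regular_points r"
        using in_reg by force
      ultimately show ?thesis
        unfolding dir_deriv_eq_ddir by (rule continuous_on_compose2[OF _ cont_line])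
    qed
    have cE: "continuous_on (ball 0 \<delta> \<times> cbox 0 1) (\<lambda>y::complex \<times> real. E (?\<gamma> (snd y)) $ b)" for b
      by (rule continuous_on_compose2[OF cont_E continuous_on_snd[OF continuous_on_id] order_refl])
    show "continuous_on (ball 0 \<delta> \<times> cbox 0 1) (\<lambda>(s, x). ?fx s x)"
      unfolding split_beta vector_matrix_nth
      by (rule continuous_on_mult[OF _ continuous_on_compose2[OF cont_v continuous_on_snd[OF continuous_on_id] order_refl]])
         (intro continuous_on_mult continuous_on_sum cd cE)
  qed (use \<delta> in auto)
  hence "((\<lambda>s. integral {0..1} (?f s)) has_field_derivative integral {0..1} (?fx 0)) (at 0)"
    using \<delta> by (simp add: at_within_open[of _ "ball 0 \<delta>"])
  from DERIV_cmult[OF this, of "1 / (2 * pi * \<i>)"]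
  have "((\<lambda>s. 1 / (2 * pi * \<i>) * integral {0..1} (?f s)) has_field_derivative
      residue (\<lambda>w. (E w v* dir_deriv d r q (w - z)) $ c) 0) (at 0)"
    using res[OF hol(2)[of 0]] \<delta> by simp
  thus ?thesis
    by (rule has_field_derivative_transform_within_open[of _ _ _ "ball 0 \<delta>"]) (use \<delta> res[OF hol(1)] in auto)
qed

section \<open>The Lax equation\<close>

context dynamical_r_matrix_on
begin

text \<open>The residue is this limit only because the pole has order at most one; here
  \<open>simple_pole\<close> enters.\<close>

lemma r_pole_limit:
  assumes "q \<in> q_domain r"
  shows "((\<lambda>u. u * r q u $ a $ b) \<longlongrightarrow> casimir q $ a $ b) (at 0)"
proof -
  obtain F where F: "(\<lambda>u. r q u $ a $ b) has_laurent_expansion F" "\<forall>j < - int 1. fls_nth F j = 0"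
    using simple_pole[OF assms, of a b] unfolding pole_order_le_def by blast
  have "casimir q $ a $ b = fls_nth F (- int 1)"
    using has_laurent_expansion_residue_0[OF F(1)] by (simp add: casimir_def)
  with pole_order_le_tendsto[OF F] show ?thesis by simp
qed

text \<open>The integrand has at w = z a pole of order at most one, with residue the contraction of
  \<open>\<zeta>\<close> with the Casimir element, and half of it is counted. The radius R + |z| in
  the hypothesis bounds |w - z| for |w| < R.\<close>

lemma R_op_eq:
  assumes q: "q \<in> q_domain r" and z: "z \<noteq> 0" "norm z < R"
    and \<zeta>: "\<And>a. ereal R \<le> fls_conv_radius (\<zeta> $ a)"
    and reg: "\<And>u. u \<in> ball 0 (R + norm z) - {0} \<Longrightarrow> (q, u) \<in> regular_points r"
  shows "R_op r q \<zeta> z $ c = residue (\<lambda>w. (loop_eval \<zeta> w v* r q (w - z)) $ c) 0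
           + (loop_eval \<zeta> z v* casimir q) $ c / 2"
proof -
  let ?g = "\<lambda>w. (loop_eval \<zeta> w v* r q (w - z)) $ c"
  note E = loop_eval_holomorphic[OF \<zeta>]
  have "(\<lambda>w. r q (w - z) $ b $ c) holomorphic_on ball 0 R - {0, z}" for b
  proof -
    have "(\<lambda>u. r q u $ b $ c) holomorphic_on (\<lambda>w. w - z) ` (ball 0 R - {0, z})"
    proof (rule r_holomorphic(1))
      fix u assume "u \<in> (\<lambda>w. w - z) ` (ball 0 R - {0, z})"
      then obtain w where "u = w - z" "w \<in> ball 0 R - {0, z}" by blast
      hence w: "u = w - z" "norm w < R" "w \<noteq> z" by auto
      have "norm u < R + norm z" using norm_triangle_ineq4[of w z] w by simp
      thus "(q, u) \<in> regular_points r" using w by (intro reg) auto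
    qed
    moreover have sh: "(\<lambda>w. w - z) holomorphic_on ball 0 R - {0, z}" by (intro holomorphic_intros)
    ultimately show ?thesis using holomorphic_on_compose[OF sh] by (simp add: o_def)
  qed
  hence g: "?g holomorphic_on ball 0 R - {0, z}"
    unfolding vector_matrix_nth
    by (intro holomorphic_on_sum holomorphic_on_mult holomorphic_on_subset[OF E]) auto
  have sh: "filterlim (\<lambda>w. w - z) (at 0) (at z)"
    by (auto simp: filterlim_at eventually_at_filter intro!: tendsto_eq_intros)
  have Ez: "((\<lambda>w. loop_eval \<zeta> w $ b) \<longlongrightarrow> loop_eval \<zeta> z $ b) (at z)" for b
    using holomorphic_on_imp_continuous_on[OF E, of b] z
    by (simp add: continuous_on_eq_continuous_at open_delete isCont_def)
  have "((\<lambda>w. \<Sum>b\<in>UNIV. loop_eval \<zeta> w $ b * ((w - z) * r q (w - z) $ b $ c)) \<longlongrightarrow>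
      (\<Sum>b\<in>UNIV. loop_eval \<zeta> z $ b * casimir q $ b $ c)) (at z)"
    by (intro tendsto_sum tendsto_mult Ez filterlim_compose[OF r_pole_limit[OF q] sh, simplified])
  hence lim: "((\<lambda>w. (w - z) * ?g w) \<longlongrightarrow> (loop_eval \<zeta> z v* casimir q) $ c) (at z)"
    by (simp add: vector_matrix_nth sum_distrib_left mult.left_commute)
  show ?thesis
    using pv_circle_simple_pole[OF z g lim] by (simp add: R_op_def)
qed

text \<open>By the chain rule each gradient of the composite of f with L is the residue of
  \<open>df\<close> paired with the corresponding gradient of L. This residue is linear in the
  gradient, so it can be moved outside the Poisson bracket.\<close>

lemma poisson_f_L_map:
  assumes f: "smooth_with_differential f df" and q: "q \<in> q_domain r"
    and K: "\<And>w. w \<in> ball 0 \<epsilon> - {0} \<Longrightarrow> (q, w) \<in> regular_points r" "\<epsilon> > 0"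
    and \<zeta>: "\<zeta> = df (L_map h r (q, p, \<xi>))" "\<And>a. ereal \<epsilon> \<le> fls_conv_radius (\<zeta> $ a)"
  shows "poisson br G (f \<circ> L_map h r) (q, p, \<xi>) =
     residue (\<lambda>w. pair (loop_eval \<zeta> w) (\<chi> b. poisson br G (\<lambda>x. L_at h r x w $ b) (q, p, \<xi>))) 0"
proof -
  let ?x = "(q, p, \<xi>)" and ?E = "loop_eval \<zeta>" and ?S = "ball (0::complex) \<epsilon>"
  have S: "open ?S" "0 \<in> ?S" using K by auto
  note E = loop_eval_holomorphic[OF \<zeta>(2)]
  let ?\<Lambda> = "\<lambda>V. residue (\<lambda>w. pair (?E w) (V w)) 0"
  let ?A = "\<lambda>i w. dir_deriv (bv i) r q w *v \<xi>" and ?C = "\<lambda>c w. column c (r q w)"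
  have hA: "(\<lambda>w. ?A i w $ b) holomorphic_on ?S - {0}" for i b
    unfolding matrix_vector_mult_def vec_lambda_beta
    by (intro holomorphic_on_sum holomorphic_on_mult holomorphic_on_const r_holomorphic(2) K(1))
  have hC: "(\<lambda>w. ?C c w $ b) holomorphic_on ?S - {0}" for c b
    unfolding column_def vec_lambda_beta by (intro r_holomorphic(1) K(1))
  have lA: "\<exists>F. (\<lambda>w. ?A i w $ b) has_laurent_expansion F" for i b
    unfolding matrix_vector_mult_def vec_lambda_beta
    by (intro ex_laurent_sum ex_laurent_mult ex_laurent_const ex_laurent_dir_deriv[OF meromorphic q])
  have lC: "\<exists>F. (\<lambda>w. ?C c w $ b) has_laurent_expansion F" for c b
    unfolding column_def vec_lambda_beta by (rule ex_laurent_r[OF meromorphic q])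
  have col: "r q w *v bv c = ?C c w" for w c
    by (simp add: matrix_vector_mult_def column_def bv_mult_sum vec_eq_iff)
  have dF: "deriv (\<lambda>s. f (L_map h r (q + s *s d, p + s *s e, \<xi> + s *s \<eta>))) 0 =
      loop_pairing \<zeta> (loop_of (\<lambda>z. (\<Sum>i\<in>UNIV. e $ i *s h i) + dir_deriv d r q z *v \<xi> + r q z *v \<eta>))" for d e \<eta>
    unfolding \<zeta>(1) by (rule DERIV_imp_deriv[OF f_L_map_has_derivative[OF f meromorphic q]])
  have dq: "grad_q (f \<circ> L_map h r) ?x $ i = ?\<Lambda> (?A i)" for i
    using dF[of "bv i" 0 0] loop_pairing_loop_of[OF lA[of i], of \<zeta>] by (simp add: grad_q_def)
  have dp: "grad_p (f \<circ> L_map h r) ?x $ i = ?\<Lambda> (\<lambda>w. h i)" for i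
    using dF[of 0 "bv i" 0] loop_pairing_loop_of[OF ex_laurent_const[of "h i $ _"], of \<zeta>]
    by (simp add: grad_p_def bv_sum_smult)
  have dx: "grad_xi (f \<circ> L_map h r) ?x = (\<chi> c. ?\<Lambda> (?C c))"
    using dF[of 0 0 "bv _"] loop_pairing_loop_of[OF lC, of \<zeta>] by (simp add: grad_xi_def col)
  let ?gp = "grad_p G ?x" and ?gq = "grad_q G ?x" and ?k = "\<lambda>c. pair \<xi> (br (grad_xi G ?x) (bv c))"
  have pair_br: "pair \<xi> (br (grad_xi G ?x) v) = (\<Sum>c\<in>UNIV. ?k c * v $ c)" for v
    by (subst br_expand_right[OF lie]) (simp add: pair_sum_right pair_smult_right mult.commute)
  have "poisson br G (f \<circ> L_map h r) ?x =
     (\<Sum>i\<in>UNIV. ?gp $ i * ?\<Lambda> (?A i)) + (\<Sum>i\<in>UNIV. (- ?gq $ i) * ?\<Lambda> (\<lambda>w. h i)) + (\<Sum>c\<in>UNIV. ?k c * ?\<Lambda> (?C c))"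
    using pair_br[of "\<chi> c. ?\<Lambda> (?C c)"] by (simp add: poisson_def dq dp dx sum_subtractf sum_negf)
  also have "\<dots> = ?\<Lambda> (\<lambda>w. \<Sum>i\<in>UNIV. ?gp $ i *s ?A i w) + ?\<Lambda> (\<lambda>w. \<Sum>i\<in>UNIV. (- ?gq $ i) *s h i) +
       ?\<Lambda> (\<lambda>w. \<Sum>c\<in>UNIV. ?k c *s ?C c w)"
    by (simp only: residue_pair_sum[OF S finite E hA] residue_pair_sum[OF S finite E hC]
          residue_pair_sum[OF S finite E holomorphic_on_const])
  also have "\<dots> = ?\<Lambda> (\<lambda>w. (\<Sum>i\<in>UNIV. ?gp $ i *s ?A i w) + (\<Sum>i\<in>UNIV. (- ?gq $ i) *s h i) +
        (\<Sum>c\<in>UNIV. ?k c *s ?C c w))"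
  proof -
    have h1: "(\<lambda>w. (\<Sum>i\<in>UNIV. ?gp $ i *s ?A i w) $ b) holomorphic_on ?S - {0}"
      "(\<lambda>w. (\<Sum>c\<in>UNIV. ?k c *s ?C c w) $ b) holomorphic_on ?S - {0}" for b
      unfolding sum_component vector_smult_component
      by (intro holomorphic_on_sum holomorphic_on_mult holomorphic_on_const hA hC)+
    have h2: "(\<lambda>w. ((\<Sum>i\<in>UNIV. ?gp $ i *s ?A i w) + (\<Sum>i\<in>UNIV. (- ?gq $ i) *s h i)) $ b) holomorphic_on ?S - {0}" for b
      unfolding vector_add_component by (intro holomorphic_on_add holomorphic_on_const h1(1))
    show ?thesis
      by (simp only: residue_pair_add[OF S E h2 h1(2)] residue_pair_add[OF S E h1(1) holomorphic_on_const])
  qed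
  also have "\<dots> = ?\<Lambda> (\<lambda>w. \<chi> b. poisson br G (\<lambda>x. L_at h r x w $ b) ?x)"
  proof (rule residue_cong[OF _ refl])
    show "\<forall>\<^sub>F w in at 0. pair (?E w) ((\<Sum>i\<in>UNIV. ?gp $ i *s ?A i w) + (\<Sum>i\<in>UNIV. (- ?gq $ i) *s h i) +
        (\<Sum>c\<in>UNIV. ?k c *s ?C c w)) = pair (?E w) (\<chi> b. poisson br G (\<lambda>x. L_at h r x w $ b) ?x)"
      using eventually_at_in_open[OF S]
    proof eventually_elim
      case (elim w)
      have w: "(q, w) \<in> regular_points r" using elim by (rule K(1))
      show ?case
        by (rule arg_cong[where f = "pair (?E w)"])
           (simp add: vec_eq_iff poisson_def grad_L_at w pair_br[of "r q w $ _"] sum_subtractf sum_negf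
             matrix_vector_mult_def column_def)
    qed
  qed
  finally show ?thesis .
qed

text \<open>Ad-invariance for test loops given as functions: V need only have Laurent expansions at
  0, which admits the rows of r(q, z - w) as functions of w.\<close>

lemma ad_invariant_residue:
  assumes f: "smooth_with_differential f df" "ad_invariant br df" and q: "q \<in> q_domain r"
    and \<zeta>: "\<zeta> = df (L_map h r (q, p, \<xi>))"
    and V: "\<And>a. \<exists>F. (\<lambda>w. V w $ a) has_laurent_expansion F"
  shows "residue (\<lambda>w. pair (loop_eval \<zeta> w) (br (V w) (L_at h r (q, p, \<xi>) w))) 0 = 0"
proof -
  let ?X = "L_map h r (q, p, \<xi>)"
  have X: "?X \<in> loop_space"
    unfolding L_map_eq_loop_of by (rule loop_of_in_loop_space[OF L_at_ex_laurent[OF meromorphic q]])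
  have Y: "loop_of V \<in> loop_space" by (rule loop_of_in_loop_space[OF V])
  have "0 = loop_pairing \<zeta> (loop_bracket br (loop_of V) ?X)"
    using f(2) X Y unfolding ad_invariant_def \<zeta> by simp
  also have "\<dots> = residue (\<lambda>w. pair (loop_eval \<zeta> w) (br (V w) (L_at h r (q, p, \<xi>) w))) 0"
    unfolding loop_pairing_def
  proof (rule residue_cong[OF _ refl])
    show "\<forall>\<^sub>F w in at 0. pair (loop_eval \<zeta> w) (loop_eval (loop_bracket br (loop_of V) ?X) w) =
        pair (loop_eval \<zeta> w) (br (V w) (L_at h r (q, p, \<xi>) w))"
      using loop_bracket_eval[OF lie X Y] eventually_loop_eval_loop_of[OF V]
        eventually_loop_eval_loop_of[OF L_at_ex_laurent[OF meromorphic q, of h p \<xi>], folded L_map_eq_loop_of]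
      by eventually_elim simp
  qed
  finally show ?thesis by simp
qed

text \<open>Testing with the loops w^n y extracts every Laurent coefficient of the pairing. All of
  them vanish, so the pairing is 0 near 0, and analytic continuation carries this to z.\<close>

lemma ad_invariant_pointwise:
  assumes f: "smooth_with_differential f df" "ad_invariant br df" and q: "q \<in> q_domain r"
    and \<zeta>: "\<zeta> = df (L_map h r (q, p, \<xi>))" "\<And>a. ereal R \<le> fls_conv_radius (\<zeta> $ a)"
    and reg: "\<And>u. u \<in> ball 0 R - {0} \<Longrightarrow> (q, u) \<in> regular_points r"
    and z: "z \<in> ball 0 R - {0}"
  shows "pair (loop_eval \<zeta> z) (br y (L_at h r (q, p, \<xi>) z)) = 0"
proof -
  let ?\<phi> = "\<lambda>w. pair (loop_eval \<zeta> w) (br y (L_at h r (q, p, \<xi>) w))"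
  have br: "br y v $ b = (\<Sum>i\<in>UNIV. br y (bv i) $ b * v $ i)" for v b
    by (subst br_expand_right[OF lie]) (simp add: mult.commute)
  have "df (L_map h r (q, p, \<xi>)) \<in> loop_space"
    using f(1) loop_of_in_loop_space[OF L_at_ex_laurent[OF meromorphic q, of h p \<xi>]]
    unfolding smooth_with_differential_def L_map_eq_loop_of by blast
  hence "\<exists>F. (\<lambda>w. loop_eval \<zeta> w $ b) has_laurent_expansion F" for b
    using loop_eval_laurent \<zeta>(1) by blast
  hence "\<exists>\<Phi>. (\<lambda>w. \<Sum>b\<in>UNIV. loop_eval \<zeta> w $ b * (\<Sum>i\<in>UNIV. br y (bv i) $ b * L_at h r (q, p, \<xi>) w $ i)) has_laurent_expansion \<Phi>"
    by (intro ex_laurent_sum ex_laurent_mult ex_laurent_const L_at_ex_laurent[OF meromorphic q])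
  then obtain \<Phi> where \<Phi>: "?\<phi> has_laurent_expansion \<Phi>"
    unfolding pair_def br[of "L_at h r (q, p, \<xi>) _"] by blast
  have "fls_nth \<Phi> m = 0" for m
  proof -
    \<comment> \<open>Multiplication by w^n moves the coefficient of index m to index -1.\<close>
    define n where "n = - 1 - m"
    have "(\<lambda>w. ?\<phi> w * w powi n) has_laurent_expansion fls_shift (- n) \<Phi>"
      using \<Phi> by (rule has_laurent_expansion_shift)
    hence "residue (\<lambda>w. ?\<phi> w * w powi n) 0 = fls_residue (fls_shift (- n) \<Phi>)"
      by (rule has_laurent_expansion_residue_0)
    moreover have "residue (\<lambda>w. ?\<phi> w * w powi n) 0 = 0"
    proof -
      have "\<exists>F. (\<lambda>w. (w powi n *s y) $ a) has_laurent_expansion F" for a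
        unfolding vector_smult_component
        by (intro ex_laurent_mult ex_laurent_const, rule exI, rule has_laurent_expansion_fps_X_power_int)
      from ad_invariant_residue[OF f q \<zeta>(1) this] show ?thesis
        by (simp add: br_smult[OF lie] pair_smult_right mult.commute)
    qed
    ultimately show ?thesis by (simp add: n_def)
  qed
  hence "\<Phi> = 0" by (simp add: fls_eq_iff)
  moreover have "?\<phi> holomorphic_on ball 0 R - {0}"
    unfolding pair_def br[of "L_at h r (q, p, \<xi>) _"]
    by (intro holomorphic_on_sum holomorphic_on_mult holomorphic_on_const loop_eval_holomorphic \<zeta>(2)
         L_at_holomorphic reg)
  ultimately show ?thesis
    using \<Phi> z by (intro has_laurent_expansion_0_analytic_continuation[where A = "ball 0 R" and f = ?\<phi>])
      (auto intro: le_less_trans[OF norm_ge_zero])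
qed

text \<open>Invariance of the Casimir element shifts the bracket to its other leg: component b is
  minus the pairing of e with the bracket of column b and x, an instance of the hypothesis.\<close>

lemma casimir_ad_invariant:
  assumes "q \<in> q_domain r" "\<And>y. pair e (br y x) = 0"
  shows "br (e v* casimir q) x = 0"
proof -
  have "br (e v* casimir q) x $ b = 0" for b
  proof -
    have "e v* casimir q = (\<Sum>a\<in>UNIV. e $ a *s casimir q $ a)"
      by (simp add: vec_eq_iff vector_matrix_nth)
    hence "br (e v* casimir q) x $ b = (\<Sum>a\<in>UNIV. e $ a * br (casimir q $ a) x $ b)"
      by (simp add: br_sum[OF lie] br_smult[OF lie])
    also have "\<dots> = (\<Sum>a\<in>UNIV. e $ a * - br (column b (casimir q)) x $ a)"
      using casimir_invariant[OF lie is_casimir_casimir[OF assms(1)], of b x] by simp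
    also have "\<dots> = - pair e (br (column b (casimir q)) x)" by (simp add: pair_def sum_negf)
    finally show ?thesis using assms(2) by simp
  qed
  thus ?thesis by (simp add: vec_eq_iff)
qed

text \<open>For |w| < |z| neither z - w nor w - z is 0, and both have modulus below 2 |z|, so the
  residues at w = 0 see only the singularities of \<open>df\<close> and of L(w).\<close>

lemma poisson_f_L_map_eq:
  assumes f: "smooth_with_differential f df" "ad_invariant br df" and q: "q \<in> q_domain r"
    and \<zeta>: "\<zeta> = df (L_map h r (q, p, \<xi>))" "\<And>a. ereal (norm z) \<le> fls_conv_radius (\<zeta> $ a)"
    and z: "z \<noteq> 0" and reg: "\<And>u. u \<in> ball 0 (2 * norm z) - {0} \<Longrightarrow> (q, u) \<in> regular_points r"
  shows "poisson br (\<lambda>x. L_at h r x z $ a) (f \<circ> L_map h r) (q, p, \<xi>) =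
     br (\<chi> c. residue (\<lambda>w. (loop_eval \<zeta> w v* r q (w - z)) $ c) 0) (L_at h r (q, p, \<xi>) z) $ a
     + residue (\<lambda>w. (loop_eval \<zeta> w v* dir_deriv (istar h \<xi>) r q (w - z)) $ a) 0"
proof -
  let ?L = "L_at h r (q, p, \<xi>)" and ?E = "loop_eval \<zeta>" and ?S = "ball (0::complex) (norm z)"
  let ?X = "dir_deriv (istar h \<xi>) r q"
  have S: "open ?S" "0 \<in> ?S" using z by auto
  note E = loop_eval_holomorphic[OF \<zeta>(2)]
  have reg0: "(q, z - w) \<in> regular_points r" "(q, w - z) \<in> regular_points r" if w: "w \<in> ?S" for w
  proof -
    have "norm (w - z) < 2 * norm z" using norm_triangle_ineq4[of w z] w by simp
    moreover have "w \<noteq> z" using w by auto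
    ultimately show "(q, z - w) \<in> regular_points r" "(q, w - z) \<in> regular_points r"
      by (auto intro!: reg simp: norm_minus_commute)
  qed
  have regs: "(q, z) \<in> regular_points r" "(q, w) \<in> regular_points r" "(q, z - w) \<in> regular_points r"
      "(q, w - z) \<in> regular_points r" if w: "w \<in> ?S - {0}" for w
  proof -
    have "norm w < 2 * norm z" using w norm_ge_zero[of w] by (simp del: norm_ge_zero)
    thus "(q, w) \<in> regular_points r" using w by (intro reg) simp
    show "(q, z) \<in> regular_points r" using reg0(1)[OF S(2)] by simp
  qed (use reg0 w in blast)+
  have hr: "(\<lambda>w. r q (z - w) $ b $ c) holomorphic_on ?S" "(\<lambda>w. r q (w - z) $ b $ c) holomorphic_on ?S"
     "(\<lambda>w. ?X (w - z) $ b $ c) holomorphic_on ?S" for b c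
  proof -
    have sh: "(\<lambda>w. z - w) holomorphic_on ?S" "(\<lambda>w. w - z) holomorphic_on ?S"
      by (intro holomorphic_intros)+
    have "(\<lambda>u. r q u $ b $ c) holomorphic_on (\<lambda>w. z - w) ` ?S"
      by (rule r_holomorphic(1)) (use reg0 in auto)
    from holomorphic_on_compose[OF sh(1) this] show "(\<lambda>w. r q (z - w) $ b $ c) holomorphic_on ?S"
      by (simp add: o_def)
    have "(\<lambda>u. r q u $ b $ c) holomorphic_on (\<lambda>w. w - z) ` ?S"
      by (rule r_holomorphic(1)) (use reg0 in auto)
    from holomorphic_on_compose[OF sh(2) this] show "(\<lambda>w. r q (w - z) $ b $ c) holomorphic_on ?S"
      by (simp add: o_def)
    have "(\<lambda>u. ?X u $ b $ c) holomorphic_on (\<lambda>w. w - z) ` ?S"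
      by (rule r_holomorphic(2)) (use reg0 in auto)
    from holomorphic_on_compose[OF sh(2) this] show "(\<lambda>w. ?X (w - z) $ b $ c) holomorphic_on ?S"
      by (simp add: o_def)
  qed
  let ?\<rho> = "\<lambda>w. ?E w v* r q (w - z)" and ?\<sigma> = "\<lambda>w. (?E w v* ?X (w - z)) $ a"
  \<comment> \<open>This is the term with L(w), which ad-invariance will remove.\<close>
  let ?\<tau> = "\<lambda>w. pair (?E w) (br (r q (z - w) $ a) (?L w))"
  have h\<rho>: "(\<lambda>w. ?\<rho> w $ c) holomorphic_on ?S - {0}" for c
    unfolding vector_matrix_nth
    by (intro holomorphic_on_sum holomorphic_on_mult E holomorphic_on_subset[OF hr(2)]) auto
  have h\<sigma>: "?\<sigma> holomorphic_on ?S - {0}"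
    unfolding vector_matrix_nth
    by (intro holomorphic_on_sum holomorphic_on_mult E holomorphic_on_subset[OF hr(3)]) auto
  have h\<tau>: "?\<tau> holomorphic_on ?S - {0}"
  proof (intro holomorphic_on_pair E)
    fix b
    have eq: "br u v $ b = (\<Sum>i\<in>UNIV. \<Sum>j\<in>UNIV. u $ i * v $ j * br (bv i) (bv j) $ b)" for u v
      by (subst br_expand[OF lie]) simp
    have "(\<lambda>w. \<Sum>i\<in>UNIV. \<Sum>j\<in>UNIV. r q (z - w) $ a $ i * ?L w $ j * br (bv i) (bv j) $ b) holomorphic_on ?S - {0}"
      by (intro holomorphic_on_sum holomorphic_on_mult holomorphic_on_const holomorphic_on_subset[OF hr(1)]
          L_at_holomorphic regs(2)) auto
    thus "(\<lambda>w. br (r q (z - w) $ a) (?L w) $ b) holomorphic_on ?S - {0}"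
      by (subst eq)
  qed
  have "poisson br (\<lambda>x. L_at h r x z $ a) (f \<circ> L_map h r) (q, p, \<xi>) =
      residue (\<lambda>w. pair (?E w) (\<chi> b. poisson br (\<lambda>x. L_at h r x z $ a) (\<lambda>x. L_at h r x w $ b) (q, p, \<xi>))) 0"
    using z by (intro poisson_f_L_map[OF f(1) q _ _ \<zeta>] regs(2)) auto
  also have "\<dots> = residue (\<lambda>w. (- br (?L z) (?\<rho> w) $ a + - ?\<tau> w) + ?\<sigma> w) 0"
  proof (rule residue_cong[OF eventually_mono[OF eventually_at_in_open[OF S]] refl])
    fix w assume w: "w \<in> ?S - {0}"
    \<comment> \<open>Unitarity turns r(z - w) into r(w - z), the form in which r enters R, and
      exchanges the legs so that \<open>df\<close> is contracted with the first one.\<close>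
    have u: "r q (z - w) $ i $ j = - r q (w - z) $ j $ i" "?X (z - w) $ i $ j = - ?X (w - z) $ j $ i" for i j
      using unitarity[OF regs(4)[OF w], of i j] dir_deriv_unitarity[OF regs(4)[OF w], of "istar h \<xi>" i j]
        regs(3)[OF w] by simp_all
    have PB: "(\<chi> b. poisson br (\<lambda>x. L_at h r x z $ a) (\<lambda>x. L_at h r x w $ b) (q, p, \<xi>)) =
        (\<chi> b. br (r q (w - z) $ b) (?L z) $ a) + - br (r q (z - w) $ a) (?L w) + (\<chi> b. ?X (w - z) $ b $ a)"
    proof -
      have col: "column b (r q (z - w)) = - (r q (w - z) $ b)" for b
        by (simp add: vec_eq_iff column_def u(1))
      show ?thesis
        unfolding vec_eq_iff
        by (simp add: poisson_L_at[OF regs(1-3)[OF w]] br_minus[OF lie] u(2) col)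
    qed
    have "?\<rho> w = (\<Sum>b\<in>UNIV. ?E w $ b *s r q (w - z) $ b)"
      by (simp add: vec_eq_iff vector_matrix_nth)
    hence "br (?\<rho> w) (?L z) $ a = pair (?E w) (\<chi> b. br (r q (w - z) $ b) (?L z) $ a)"
      by (simp add: br_sum[OF lie] br_smult[OF lie] pair_def)
    moreover have "br (?\<rho> w) (?L z) $ a = - br (?L z) (?\<rho> w) $ a"
      by (subst br_anti[OF lie]) simp
    moreover have "?\<sigma> w = pair (?E w) (\<chi> b. ?X (w - z) $ b $ a)"
      by (simp add: vector_matrix_nth pair_def)
    ultimately show "pair (?E w) (\<chi> b. poisson br (\<lambda>x. L_at h r x z $ a) (\<lambda>x. L_at h r x w $ b) (q, p, \<xi>)) =
       (- br (?L z) (?\<rho> w) $ a + - ?\<tau> w) + ?\<sigma> w"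
      unfolding PB pair_add_right pair_minus_right by simp
  qed
  also have "\<dots> = (- residue (\<lambda>w. br (?L z) (?\<rho> w) $ a) 0 + - residue ?\<tau> 0) + residue ?\<sigma> 0"
    by (simp only: residue_add[OF S holomorphic_on_add[OF holomorphic_on_minus holomorphic_on_minus] h\<sigma>,
          OF residue_br(2)[OF lie S h\<rho>] h\<tau>]
        residue_add[OF S holomorphic_on_minus holomorphic_on_minus, OF residue_br(2)[OF lie S h\<rho>] h\<tau>]
        residue_neg[OF S residue_br(2)[OF lie S h\<rho>]] residue_neg[OF S h\<tau>])
  also have "residue ?\<tau> 0 = 0"
  proof (rule ad_invariant_residue[OF f q \<zeta>(1)])
    fix i
    \<comment> \<open>For fixed z the row of r(q, z - w) is holomorphic in w near 0 and so defines a
      test loop.\<close>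
    have "(\<lambda>w. r q (z - w) $ a $ i) analytic_on {0}"
      using hr(1)[of a i] S unfolding analytic_at by blast
    thus "\<exists>F. (\<lambda>w. r q (z - w) $ a $ i) has_laurent_expansion F"
      using analytic_at_imp_has_fps_expansion_0 has_laurent_expansion_fps by blast
  qed
  also have "residue (\<lambda>w. br (?L z) (?\<rho> w) $ a) 0 = br (?L z) (\<chi> c. residue (\<lambda>w. ?\<rho> w $ c) 0) $ a"
    by (rule residue_br(1)[OF lie S h\<rho>])
  also have "\<dots> = - br (\<chi> c. residue (\<lambda>w. ?\<rho> w $ c) 0) (?L z) $ a"
    by (subst br_anti[OF lie]) simp
  finally show ?thesis by (simp only: minus_minus minus_zero add_0_right)
qed

lemma casimir_eq:
  assumes "q \<in> q_domain r" "q' \<in> q_domain r"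
  shows "casimir q = casimir q'"
  using casimir_unique[OF lie is_casimir_casimir[OF assms(1)] is_casimir_casimir[OF assms(2)]] .

lemma poisson_L_at_f_L_map:
  assumes f: "smooth_with_differential f df" "ad_invariant br df" and q: "q \<in> q_domain r"
    and \<zeta>: "\<zeta> = df (L_map h r (q, p, \<xi>))" "\<And>a. norm z < fls_conv_radius (\<zeta> $ a)"
    and reg: "{q} \<times> (ball 0 r0 - {0}) \<subseteq> regular_points r" and z: "0 < norm z" "norm z < r0 / 2"
  shows "poisson br (\<lambda>x. L_at h r x z $ a) (f \<circ> L_map h r) (q, p, \<xi>) =
     (br (R_op r q \<zeta> z) (L_at h r (q, p, \<xi>) z) + dir_deriv_R (istar h \<xi>) r q \<zeta> z) $ a"
proof -
  let ?L = "L_at h r (q, p, \<xi>)" and ?E = "loop_eval \<zeta>"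
  \<comment> \<open>The circle |w| = |z| has to lie strictly inside the annulus of convergence; as
    there are finitely many coordinates, a common larger radius exists.\<close>
  obtain R1 where R1: "R1 > norm z" "\<And>a. ereal R1 < fls_conv_radius (\<zeta> $ a)"
    using exists_ereal_bound[of "norm z" "\<lambda>a. fls_conv_radius (\<zeta> $ a)"] \<zeta>(2) by blast
  define R where "R = min R1 (r0 / 2)"
  have R: "norm z < R" "R \<le> r0 / 2" and \<zeta>R: "\<And>a. ereal R \<le> fls_conv_radius (\<zeta> $ a)"
    using R1 z by (auto simp: R_def min_def intro: less_imp_le order.trans[OF _ less_imp_le[OF R1(2)]])
  have reg': "(q, u) \<in> regular_points r" if "u \<noteq> 0" "norm u < r0" for u
  proof -
    have "u \<in> ball 0 r0 - {0}" using that by simp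
    thus ?thesis using reg by blast
  qed
  have R0: "R > 0" by (rule le_less_trans[OF norm_ge_zero R(1)])
  define \<kappa> where "\<kappa> = R + norm z"
  have \<kappa>: "\<kappa> > 0" "\<kappa> < r0" using R add_pos_pos[OF R0 z(1)] z(2) unfolding \<kappa>_def by linarith+
  \<comment> \<open>The derivative in q needs the residue formula for all q' near q on one disc.
    Near u = 0 a neighbourhood comes from \<open>q_domain\<close>; on the compact annulus \<epsilon>
    \<le> |u| \<le> \<kappa> regularity at q spreads to nearby q' by the tube lemma.\<close>
  obtain N where N: "open N" "q \<in> N" "N \<subseteq> q_domain r" "N \<times> (ball 0 \<kappa> - {0}) \<subseteq> regular_points r"
  proof -
    obtain N1 \<epsilon> where N1: "open N1" "q \<in> N1" "\<epsilon> > 0" "N1 \<times> (ball 0 \<epsilon> - {0}) \<subseteq> regular_points r"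
      using q unfolding q_domain_def by blast
    let ?K = "cball (0::complex) \<kappa> - ball 0 \<epsilon>"
    have "?K \<subseteq> ball 0 r0 - {0}" using \<kappa> N1(3) by auto
    hence sub: "{q} \<times> ?K \<subseteq> regular_points r" using reg by blast
    have "compact ?K" by (intro compact_diff compact_cball open_ball)
    from Elementary_Topology.tube_lemma[OF this open_regular_points sub]
    obtain N2 where N2: "q \<in> N2" "open N2" "N2 \<times> ?K \<subseteq> regular_points r" by (elim exE conjE)
    have "ball 0 \<kappa> - {0} \<subseteq> ?K \<union> (ball 0 \<epsilon> - {0 :: complex})" by auto
    hence "(N1 \<inter> N2) \<times> (ball 0 \<kappa> - {0}) \<subseteq> regular_points r" using N1(4) N2(3) by blast
    moreover have "N1 \<inter> N2 \<subseteq> q_domain r" unfolding q_domain_def using N1 by blast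
    ultimately show ?thesis using N1(1,2) N2(1,2) by (intro that[of "N1 \<inter> N2"]) auto
  qed
  \<comment> \<open>By uniqueness the half residue is written with the Casimir element at q for
    every q' in N; being constant, it drops out of the derivative.\<close>
  have Rop: "R_op r q' \<zeta> z $ c = residue (\<lambda>w. (?E w v* r q' (w - z)) $ c) 0 + (?E z v* casimir q) $ c / 2"
    if "q' \<in> N" for q' c
  proof -
    have "R_op r q' \<zeta> z $ c = residue (\<lambda>w. (?E w v* r q' (w - z)) $ c) 0 + (?E z v* casimir q') $ c / 2"
    proof (rule R_op_eq[where R = R])
      fix u :: complex assume "u \<in> ball 0 (R + norm z) - {0}"
      thus "(q', u) \<in> regular_points r" using that N(4) unfolding \<kappa>_def by blast
    qed (use that N(3) z R \<zeta>R in auto)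
    moreover have "casimir q' = casimir q" using casimir_eq q that N(3) by blast
    ultimately show ?thesis by simp
  qed
  let ?\<rho> = "\<chi> c. residue (\<lambda>w. (?E w v* r q (w - z)) $ c) 0"
  have "br (R_op r q \<zeta> z) (?L z) = br ?\<rho> (?L z)"
  proof -
    have "R_op r q \<zeta> z = ?\<rho> + (1/2) *s (?E z v* casimir q)"
      by (simp add: vec_eq_iff Rop[OF N(2)])
    moreover have "br (?E z v* casimir q) (?L z) = 0"
    proof (rule casimir_ad_invariant[OF q])
      show "pair (?E z) (br y (?L z)) = 0" for y
      proof (rule ad_invariant_pointwise[OF f q \<zeta>(1) \<zeta>R])
        fix u :: complex assume "u \<in> ball 0 R - {0}"
        thus "(q, u) \<in> regular_points r" using R R0 by (intro reg') auto
      qed (use R z in auto)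
    qed
    ultimately show ?thesis by (simp add: br_add[OF lie] br_smult[OF lie])
  qed
  moreover have "dir_deriv_R (istar h \<xi>) r q \<zeta> z $ a = residue (\<lambda>w. (?E w v* dir_deriv (istar h \<xi>) r q (w - z)) $ a) 0"
  proof -
    let ?d = "istar h \<xi>"
    have "continuous_on UNIV (\<lambda>s. q + s *s ?d)"
      by (intro continuous_on_add continuous_on_const continuous_on_vmult continuous_on_id)
    hence "open ((\<lambda>s. q + s *s ?d) -` N)" using N(1) by (rule open_vimage[rotated])
    moreover have "0 \<in> (\<lambda>s. q + s *s ?d) -` N" using N by simp
    ultimately obtain \<delta> where \<delta>: "\<delta> > 0" "ball 0 \<delta> \<subseteq> (\<lambda>s. q + s *s ?d) -` N" by (rule openE)
    have in_N: "q + s *s ?d \<in> N" if "s \<in> ball 0 \<delta>" for s using \<delta>(2) that by auto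
    have E: "(\<lambda>w. ?E w $ b) holomorphic_on ball 0 (norm z) - {0}" for b
      by (rule holomorphic_on_subset[OF loop_eval_holomorphic[OF \<zeta>R]]) (use R in auto)
    have rg: "(q + s *s ?d, w - z) \<in> regular_points r" if "s \<in> ball 0 \<delta>" "w \<in> ball 0 (norm z)" for s w
    proof -
      have "w - z \<in> ball 0 \<kappa> - {0}"
        using that(2) R norm_triangle_ineq4[of w z] by (auto simp: \<kappa>_def)
      thus ?thesis using N(4) in_N[OF that(1)] by blast
    qed
    have "((\<lambda>s. residue (\<lambda>w. (?E w v* r (q + s *s ?d) (w - z)) $ a) 0 + (?E z v* casimir q) $ a / 2) has_field_derivative
       residue (\<lambda>w. (?E w v* dir_deriv ?d r q (w - z)) $ a) 0 + 0) (at 0)"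
      by (intro DERIV_add DERIV_const residue_family_has_derivative[OF E z(1) \<delta>(1) rg])
    hence "((\<lambda>s. R_op r (q + s *s ?d) \<zeta> z $ a) has_field_derivative
       residue (\<lambda>w. (?E w v* dir_deriv ?d r q (w - z)) $ a) 0 + 0) (at 0)"
      by (rule has_field_derivative_transform_within_open[of _ _ _ "ball 0 \<delta>"]) (use \<delta>(1) Rop in_N in auto)
    thus ?thesis by (simp add: dir_deriv_R_def DERIV_imp_deriv)
  qed
  moreover have "poisson br (\<lambda>x. L_at h r x z $ a) (f \<circ> L_map h r) (q, p, \<xi>) =
     br ?\<rho> (?L z) $ a + residue (\<lambda>w. (?E w v* dir_deriv (istar h \<xi>) r q (w - z)) $ a) 0"
  proof (rule poisson_f_L_map_eq[OF f q \<zeta>(1)])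
    fix u :: complex assume "u \<in> ball 0 (2 * norm z) - {0}"
    thus "(q, u) \<in> regular_points r" using z by (intro reg') auto
  qed (use \<zeta>(2) z in \<open>auto intro: less_imp_le\<close>)
  ultimately show ?thesis by simp
qed

end

theorem theoremA:
  fixes br :: "complex^'n \<Rightarrow> complex^'n \<Rightarrow> complex^'n"
    and H :: "(complex^'n) set"
    and h :: "'l::finite \<Rightarrow> complex^'n"
    and r :: "('l, 'n::finite) rmat"
    and M :: "('l, 'n) phase set"
  assumes g: "simple_lie_algebra br"
    and H: "cartan_subalgebra br H"
    and h: "orthonormal_basis br H h"
    and r: "dynamical_r_matrix br H h r"
  defines "M \<equiv> q_domain r \<times> UNIV \<times> UNIV"
  shows
    "(\<forall>x\<in>M. \<forall>a. (\<lambda>z. L_at h r x z $ a) has_laurent_expansion (L_map h r x $ a)) \<and>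
     (\<forall>q p \<xi> z w. (q, p, \<xi>) \<in> M \<longrightarrow>
        {(q, z), (q, w), (q, z - w), (q, w - z)} \<subseteq> regular_points r \<longrightarrow>
        (let L = L_at h r (q, p, \<xi>);
             PB = (\<chi> a b. poisson br (\<lambda>x. L_at h r x z $ a) (\<lambda>x. L_at h r x w $ b) (q, p, \<xi>))
         in PB = - comm1 br (r q (z - w)) (L z) + comm2 br (transpose (r q (w - z))) (L w)
                   - dir_deriv (istar h \<xi>) r q (z - w) \<and>
            PB = - (comm1 br (r q (z - w)) (L z) + comm2 br (r q (z - w)) (L w))
                   - dir_deriv (istar h \<xi>) r q (z - w))) \<and>
     (\<forall>f df \<phi> T. smooth_with_differential f df \<longrightarrow> ad_invariant br df \<longrightarrow>
        hamiltonian_curve br M (f \<circ> L_map h r) \<phi> T \<longrightarrow>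
        (\<forall>t\<in>T. \<forall>q p \<xi> \<zeta> r0 z. \<phi> t = (q, p, \<xi>) \<longrightarrow> \<zeta> = df (L_map h r (\<phi> t)) \<longrightarrow>
           {q} \<times> (ball 0 r0 - {0}) \<subseteq> regular_points r \<longrightarrow>
           0 < norm z \<longrightarrow> norm z < r0 / 2 \<longrightarrow> (\<forall>a. norm z < fls_conv_radius (\<zeta> $ a)) \<longrightarrow>
           ((\<lambda>t'. L_at h r (\<phi> t') z) has_vector_derivative
              br (R_op r q \<zeta> z) (L_at h r (\<phi> t) z) + dir_deriv_R (istar h \<xi>) r q \<zeta> z) (at t)))"
proof (intro conjI)
  interpret dynamical_r_matrix_on br H h r
    using g h r by unfold_locales
  show "\<forall>x\<in>M. \<forall>a. (\<lambda>z. L_at h r x z $ a) has_laurent_expansion (L_map h r x $ a)"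
  proof (intro ballI allI)
    fix x a assume "x \<in> M"
    then obtain q p \<xi> where x: "x = (q, p, \<xi>)" "q \<in> q_domain r" by (auto simp: M_def)
    show "(\<lambda>z. L_at h r x z $ a) has_laurent_expansion (L_map h r x $ a)"
      unfolding x(1) L_map_eq_loop_of by (rule loop_of_nth[OF L_at_ex_laurent[OF meromorphic x(2)]])
  qed
  show "\<forall>q p \<xi> z w. (q, p, \<xi>) \<in> M \<longrightarrow>
        {(q, z), (q, w), (q, z - w), (q, w - z)} \<subseteq> regular_points r \<longrightarrow>
        (let L = L_at h r (q, p, \<xi>);
             PB = (\<chi> a b. poisson br (\<lambda>x. L_at h r x z $ a) (\<lambda>x. L_at h r x w $ b) (q, p, \<xi>))
         in PB = - comm1 br (r q (z - w)) (L z) + comm2 br (transpose (r q (w - z))) (L w)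
                   - dir_deriv (istar h \<xi>) r q (z - w) \<and>
            PB = - (comm1 br (r q (z - w)) (L z) + comm2 br (r q (z - w)) (L w))
                   - dir_deriv (istar h \<xi>) r q (z - w))"
  proof (intro allI impI)
    fix q p \<xi> z w
    assume "{(q, z), (q, w), (q, z - w), (q, w - z)} \<subseteq> regular_points r"
    hence reg: "(q, z) \<in> regular_points r" "(q, w) \<in> regular_points r" "(q, z - w) \<in> regular_points r"
      "(q, w - z) \<in> regular_points r" by auto
    \<comment> \<open>The first form of the relation differs from the second only by this instance
      of unitarity.\<close>
    have tr: "transpose (r q (w - z)) $ a = - (r q (z - w) $ a)" for a
      using unitarity[OF reg(3)] reg(4) by (simp add: transpose_def vec_eq_iff)
    show "let L = L_at h r (q, p, \<xi>);
             PB = (\<chi> a b. poisson br (\<lambda>x. L_at h r x z $ a) (\<lambda>x. L_at h r x w $ b) (q, p, \<xi>))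
         in PB = - comm1 br (r q (z - w)) (L z) + comm2 br (transpose (r q (w - z))) (L w)
                   - dir_deriv (istar h \<xi>) r q (z - w) \<and>
            PB = - (comm1 br (r q (z - w)) (L z) + comm2 br (r q (z - w)) (L w))
                   - dir_deriv (istar h \<xi>) r q (z - w)"
      by (simp add: Let_def vec_eq_iff comm1_nth[OF lie] comm2_nth[OF lie] poisson_L_at[OF reg(1-3)]
            tr br_minus[OF lie])
  qed
  show "\<forall>f df \<phi> T. smooth_with_differential f df \<longrightarrow> ad_invariant br df \<longrightarrow>
        hamiltonian_curve br M (f \<circ> L_map h r) \<phi> T \<longrightarrow>
        (\<forall>t\<in>T. \<forall>q p \<xi> \<zeta> r0 z. \<phi> t = (q, p, \<xi>) \<longrightarrow> \<zeta> = df (L_map h r (\<phi> t)) \<longrightarrow>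
           {q} \<times> (ball 0 r0 - {0}) \<subseteq> regular_points r \<longrightarrow>
           0 < norm z \<longrightarrow> norm z < r0 / 2 \<longrightarrow> (\<forall>a. norm z < fls_conv_radius (\<zeta> $ a)) \<longrightarrow>
           ((\<lambda>t'. L_at h r (\<phi> t') z) has_vector_derivative
              br (R_op r q \<zeta> z) (L_at h r (\<phi> t) z) + dir_deriv_R (istar h \<xi>) r q \<zeta> z) (at t))"
  proof (intro allI impI ballI)
    fix f df \<phi> T t q p \<xi> \<zeta> r0 and z :: complex
    assume f: "smooth_with_differential f df" "ad_invariant br df"
      and \<phi>: "hamiltonian_curve br M (f \<circ> L_map h r) \<phi> T" and t: "t \<in> T" "\<phi> t = (q, p, \<xi>)"
      and \<zeta>: "\<zeta> = df (L_map h r (\<phi> t))" and reg: "{q} \<times> (ball 0 r0 - {0}) \<subseteq> regular_points r"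
      and z: "0 < norm z" "norm z < r0 / 2" "\<forall>a. norm z < fls_conv_radius (\<zeta> $ a)"
    have "\<phi> t \<in> M" using \<phi> t(1) unfolding hamiltonian_curve_def by blast
    hence q: "q \<in> q_domain r" by (simp add: t(2) M_def)
    \<comment> \<open>Since |z| < r0, the point (q, z) is regular, so the coordinates of L at z are
      holomorphic near the current point and admissible as test functions.\<close>
    let ?W = "{q \<in> q_domain r. (q, z) \<in> regular_points r} \<times> UNIV \<times> UNIV"
    have "norm z < r0" using z(1,2) by linarith
    hence "z \<in> ball 0 r0 - {0}" using z(1) by simp
    hence "(q, z) \<in> regular_points r" using reg by blast
    hence W: "?W \<subseteq> M" "\<phi> t \<in> ?W" using q by (auto simp: M_def t(2))
    show "((\<lambda>t'. L_at h r (\<phi> t') z) has_vector_derivative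
              br (R_op r q \<zeta> z) (L_at h r (\<phi> t) z) + dir_deriv_R (istar h \<xi>) r q \<zeta> z) (at t)"
    proof (rule has_vector_derivative_vec)
      fix a
      have "((\<lambda>t'. L_at h r (\<phi> t') z $ a) has_vector_derivative
          poisson br (\<lambda>x. L_at h r x z $ a) (f \<circ> L_map h r) (\<phi> t)) (at t)"
        using \<phi> unfolding hamiltonian_curve_def
        by (elim conjE) (drule bspec[OF _ t(1)], elim allE impE, rule W(1), rule W(2), rule holo_on_L_at)
      also have "poisson br (\<lambda>x. L_at h r x z $ a) (f \<circ> L_map h r) (\<phi> t) =
          (br (R_op r q \<zeta> z) (L_at h r (\<phi> t) z) + dir_deriv_R (istar h \<xi>) r q \<zeta> z) $ a"
        unfolding t(2) using \<zeta> z by (intro poisson_L_at_f_L_map[OF f q _ _ reg]) (auto simp: t(2))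
      finally show "((\<lambda>t'. L_at h r (\<phi> t') z $ a) has_vector_derivative
          (br (R_op r q \<zeta> z) (L_at h r (\<phi> t) z) + dir_deriv_R (istar h \<xi>) r q \<zeta> z) $ a) (at t)" .
    qed
  qed
qed

end
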